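(* Let $F(X)$ be a quantum program scheme in a program identifier $X$. Then $\mu X.F(X)$ is the least solution of the equation $X=F(X)$; that is, (1) $\mu X.F(X)\equiv F(\mu X.F(X))$, and (2) for any quantum program $P$, if $P\equiv F(P)$ then $\mu X.F(X)\sqsubseteq P$, where $Q\sqsubseteq P$ means that $[\![Q]\!](\rho)\sqsubseteq[\![P]\!](\rho)$ (in the Löwner order) for any density operator $\rho$.
   Context: A set $QV$ of quantum variables is given; each quantum variable $q$ has a Hilbert space $\mathcal H_q$; a register $\bar q$ is a sequence $q_1,\dots,q_n$ of distinct variables with space $\mathcal H_{\bar q}=\bigotimes_i\mathcal H_{q_i}$. $\mathcal H_{QV}$ is the state space of the composite system of all variables in $QV$; operators on $\mathcal H_{\bar q}$ are identified with their extensions by the identity. $\mathcal D(\mathcal H_{QV})$ is the set of partial density operators (positive operators of trace $\le1$) on $\mathcal H_{QV}$. Löwner order: $A\sqsubseteq B$ iff $B-A$ is positive semidefinite. Circuits: $C::=\mathbf{skip}\mid U[\bar q]\mid C_1;C_2\mid \mathbf{qif}\,[\bar q](\square_{i=1}^d|\psi_i\rangle\to C_i)\,\mathbf{fiq}$ ($U$ a unitary constant from a given set, $\{|\psi_i\rangle\}$ an orthonormal basis of $\mathcal H_{\bar q}$, $\bar q$ disjoint from the variables of all $C_i$), with unitary semantics $I$, $U_{\bar q}$, $[\![C_2]\!][\![C_1]\!]$, $\sum_i|\psi_i\rangle_{\bar q}\langle\psi_i|\otimes[\![C_i]\!]$. A measurement on $\bar q$ is a family $M=\{M_m\}$ of linear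 operators with $\sum_mM_m^\dagger M_m=I$. Programs: $P::=\mathbf{skip}\mid\mathbf{abort}\mid\bar q:=|\psi\rangle\mid C\mid P_1;P_2\mid\mathbf{if}\,M[\bar q](\square m\to P_m)\,\mathbf{fi}\mid\mathbf{while}\,M[\bar q]=1\,\mathbf{do}\,P\,\mathbf{od}$ (in loops $M$ has outcomes $0,1$). Semantics on $\mathcal D(\mathcal H_{QV})$: $[\![\mathbf{skip}]\!](\rho)=\rho$; $[\![\mathbf{abort}]\!](\rho)=0$; $[\![\bar q:=|\psi\rangle]\!](\rho)=\sum_n|\psi\rangle_{\bar q}\langle n|\rho|n\rangle_{\bar q}\langle\psi|$ ($\{|n\rangle\}$ an orthonormal basis of $\mathcal H_{\bar q}$); $[\![C]\!](\rho)=[\![C]\!]\rho[\![C]\!]^\dagger$; $[\![P_1;P_2]\!]=[\![P_2]\!]\circ[\![P_1]\!]$; $[\![\mathbf{if}\,M[\bar q](\square m\to P_m)\,\mathbf{fi}]\!](\rho)=\sum_m[\![P_m]\!](M_m\rho M_m^\dagger)$; $[\![\mathbf{while}\,M[\bar q]=1\,\mathbf{do}\,P\,\mathbf{od}]\!]=\sum_{n\ge0}\mathcal E_0\circ([\![P]\!]\circ\mathcal E_1)^n$, $\mathcal E_i(\rho)=M_i\rho M_i^\dagger$. $P\equiv Q$ iff $[\![P]\!]=[\![Q]\!]$. Recursion: a program scheme $F(X)$ is an expression obtained by adding a program identifier $X$ to the program syntax above; $F(P)$ is $F(X)$ with $X$ replaced by $P$ (its semantics is computed by the same structural clauses also when $P$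 is a recursive program). $F^{(0)}=\mathbf{abort}$, $F^{(n+1)}=F(F^{(n)})$. $\mu X.F(X)$ is the recursive program declared by $X=F(X)$, with semantics $[\![\mu X.F(X)]\!]=\bigsqcup_{n\ge0}[\![F^{(n)}]\!]$, the least upper bound in the CPO of quantum operations (trace-nonincreasing super-operators) on $\mathcal H_{QV}$ under the order $\mathcal E\sqsubseteq\mathcal F$ iff $\mathcal E(\rho)\sqsubseteq\mathcal F(\rho)$ for all $\rho$. *)

theory Defs
  imports "HOL-Analysis.Analysis" "HOL-Library.Function_Algebras"
begin

section \<open>Hilbert spaces and operators\<close>

text \<open>
  A Hilbert space with an orthonormal basis indexed by the set \<open>I\<close> is rendered as the space
  of square-summable families over \<open>I\<close>; the dimension may be infinite.  Vectors vanish outside \<open>I\<close>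
  and operators vanish outside the space, so that equality of vectors and of operators is
  equality in HOL.  Sums and differences of vectors and operators are the pointwise
  ones of Function-Algebras.
\<close>

type_synonym 'i vect = "'i \<Rightarrow> complex"
type_synonym 'i oper = "'i vect \<Rightarrow> 'i vect"

definition ell2 :: "'i set \<Rightarrow> 'i vect set" where
  "ell2 I = {x. (\<forall>i. i \<notin> I \<longrightarrow> x i = 0) \<and> (\<lambda>i. (cmod (x i))\<^sup>2) summable_on I}"

definition ip :: "'i set \<Rightarrow> 'i vect \<Rightarrow> 'i vect \<Rightarrow> complex" where
  "ip I x y = (\<Sum>\<^sub>\<infinity>i\<in>I. cnj (x i) * y i)"

definition nrm :: "'i set \<Rightarrow> 'i vect \<Rightarrow> real" where
  "nrm I x = sqrt (\<Sum>\<^sub>\<infinity>i\<in>I. (cmod (x i))\<^sup>2)"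

definition ket :: "'i \<Rightarrow> 'i vect" where
  "ket i = (\<lambda>j. if j = i then 1 else 0)"

definition bounded_op :: "'i set \<Rightarrow> 'i oper \<Rightarrow> bool" where
  "bounded_op I A \<longleftrightarrow>
     (\<forall>x. x \<notin> ell2 I \<longrightarrow> A x = 0) \<and>
     (\<forall>x\<in>ell2 I. A x \<in> ell2 I) \<and>
     (\<forall>x\<in>ell2 I. \<forall>y\<in>ell2 I. A (x + y) = A x + A y) \<and>
     (\<forall>c. \<forall>x\<in>ell2 I. A (\<lambda>i. c * x i) = (\<lambda>i. c * A x i)) \<and>
     (\<exists>K. \<forall>x\<in>ell2 I. nrm I (A x) \<le> K * nrm I x)"

definition idop :: "'i set \<Rightarrow> 'i oper" where
  "idop I = (\<lambda>x. if x \<in> ell2 I then x else 0)"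

text \<open>The coordinate at \<open>i\<close> of the adjoint applied to \<open>x\<close> is the inner product of
  \<open>A (ket i)\<close> with \<open>x\<close>.\<close>

definition adj :: "'i set \<Rightarrow> 'i oper \<Rightarrow> 'i oper" where
  "adj I A = (\<lambda>x i. if x \<in> ell2 I \<and> i \<in> I then ip I (A (ket i)) x else 0)"

text \<open>The operator usually written as the ket of \<open>\<phi>\<close> followed by the bra of \<open>\<omega>\<close>.\<close>

definition outer :: "'i set \<Rightarrow> 'i vect \<Rightarrow> 'i vect \<Rightarrow> 'i oper" where
  "outer I \<phi> \<omega> = (\<lambda>x i. if x \<in> ell2 I then \<phi> i * ip I \<omega> x else 0)"

definition unitary :: "'i set \<Rightarrow> 'i oper \<Rightarrow> bool" where
  "unitary I U \<longleftrightarrow> bounded_op I U \<and> adj I U \<circ> U = idop I \<and> U \<circ> adj I U = idop I"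

definition positive :: "'i set \<Rightarrow> 'i oper \<Rightarrow> bool" where
  "positive I A \<longleftrightarrow> bounded_op I A \<and> (\<forall>x\<in>ell2 I. ip I x (A x) \<in> \<real>\<^sub>\<ge>\<^sub>0)"

definition lowner :: "'i set \<Rightarrow> 'i oper \<Rightarrow> 'i oper \<Rightarrow> bool" where
  "lowner I A B \<longleftrightarrow> positive I (B - A)"

definition tr :: "'i set \<Rightarrow> 'i oper \<Rightarrow> complex" where
  "tr I A = (\<Sum>\<^sub>\<infinity>i\<in>I. ip I (ket i) (A (ket i)))"

definition pos_tc :: "'i set \<Rightarrow> 'i oper set" where
  "pos_tc I = {A. positive I A \<and> (\<lambda>i. ip I (ket i) (A (ket i))) summable_on I}"

text \<open>An operator is of trace class iff it is a combination \<open>A\<^sub>0 + \<i> A\<^sub>1 - A\<^sub>2 - \<i> A\<^sub>3\<close> of positive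
  operators with finite trace.\<close>

definition trace_class :: "'i set \<Rightarrow> 'i oper set" where
  "trace_class I =
     {T. \<exists>A :: nat \<Rightarrow> 'i oper. (\<forall>k<4. A k \<in> pos_tc I) \<and> T = (\<lambda>x i. \<Sum>k<4. \<i> ^ k * A k x i)}"

text \<open>Partial density operators.\<close>

definition pdo :: "'i set \<Rightarrow> 'i oper set" where
  "pdo I = {\<rho> \<in> pos_tc I. Re (tr I \<rho>) \<le> 1}"

text \<open>Possibly infinite sums of operators, converging in the weak sense, that is, for each
  coordinate of the image of each vector.\<close>

definition opsum :: "'k set \<Rightarrow> ('k \<Rightarrow> 'i oper) \<Rightarrow> 'i oper" where
  "opsum J A = (\<lambda>x i. \<Sum>\<^sub>\<infinity>k\<in>J. A k x i)"

text \<open>The completeness relation: the operators \<open>M m\<^sup>\<dagger> M m\<close>, \<open>m \<in> J\<close>, sum to the identity.\<close>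

definition measurement :: "'i set \<Rightarrow> 'm set \<Rightarrow> ('m \<Rightarrow> 'i oper) \<Rightarrow> bool" where
  "measurement I J M \<longleftrightarrow>
     (\<forall>m\<in>J. bounded_op I (M m)) \<and>
     (\<forall>x\<in>ell2 I. \<forall>i\<in>I. ((\<lambda>m. adj I (M m) (M m x) i) has_sum x i) J)"

definition orthonormal_basis :: "'i set \<Rightarrow> nat \<Rightarrow> (nat \<Rightarrow> 'i vect) \<Rightarrow> bool" where
  "orthonormal_basis I d \<psi> \<longleftrightarrow>
     (\<forall>i\<in>{1..d}. \<psi> i \<in> ell2 I) \<and>
     (\<forall>i\<in>{1..d}. \<forall>j\<in>{1..d}. ip I (\<psi> i) (\<psi> j) = (if i = j then 1 else 0)) \<and>
     (\<forall>x\<in>ell2 I. x = (\<Sum>i=1..d. (\<lambda>b. ip I (\<psi> i) x * \<psi> i b)))"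

section \<open>Quantum operations\<close>

type_synonym 'i superop = "'i oper \<Rightarrow> 'i oper"

text \<open>Positivity of an \<open>n \<times> n\<close> block operator, acting on the direct sum of \<open>n\<close> copies of the space.\<close>

definition block_positive :: "'i set \<Rightarrow> nat \<Rightarrow> (nat \<Rightarrow> nat \<Rightarrow> 'i oper) \<Rightarrow> bool" where
  "block_positive I n T \<longleftrightarrow>
     (\<forall>y :: nat \<Rightarrow> 'i vect. (\<forall>i<n. y i \<in> ell2 I) \<longrightarrow>
        (\<Sum>i<n. \<Sum>j<n. ip I (y i) (T i j (y j))) \<in> \<real>\<^sub>\<ge>\<^sub>0)"

definition completely_positive :: "'i set \<Rightarrow> 'i superop \<Rightarrow> bool" where
  "completely_positive I E \<longleftrightarrow>
     (\<forall>n T. (\<forall>i<n. \<forall>j<n. T i j \<in> trace_class I) \<and> block_positive I n T \<longrightarrow>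
        block_positive I n (\<lambda>i j. E (T i j)))"

text \<open>Trace-nonincreasing completely positive linear maps on the trace class operators.  Values
  outside the trace class are irrelevant.\<close>

definition quantum_operation :: "'i set \<Rightarrow> 'i superop \<Rightarrow> bool" where
  "quantum_operation I E \<longleftrightarrow>
     (\<forall>T\<in>trace_class I. E T \<in> trace_class I) \<and>
     (\<forall>T\<in>trace_class I. \<forall>T'\<in>trace_class I. E (T + T') = E T + E T') \<and>
     (\<forall>c. \<forall>T\<in>trace_class I. E (\<lambda>x i. c * T x i) = (\<lambda>x i. c * E T x i)) \<and>
     completely_positive I E \<and>
     (\<forall>\<rho>\<in>pos_tc I. Re (tr I (E \<rho>)) \<le> Re (tr I \<rho>))"

definition superop_le :: "'i set \<Rightarrow> 'i superop \<Rightarrow> 'i superop \<Rightarrow> bool" where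
  "superop_le I E G \<longleftrightarrow> (\<forall>\<rho>\<in>pdo I. lowner I (E \<rho>) (G \<rho>))"

definition is_qlub :: "'i set \<Rightarrow> (nat \<Rightarrow> 'i superop) \<Rightarrow> 'i superop \<Rightarrow> bool" where
  "is_qlub I f E \<longleftrightarrow>
     quantum_operation I E \<and> (\<forall>n. superop_le I (f n) E) \<and>
     (\<forall>G. quantum_operation I G \<and> (\<forall>n. superop_le I (f n) G) \<longrightarrow> superop_le I E G)"

text \<open>Least upper bounds of quantum operations agree on all trace class operators, so
  the choice is immaterial.\<close>

definition qlub :: "'i set \<Rightarrow> (nat \<Rightarrow> 'i superop) \<Rightarrow> 'i superop" where
  "qlub I f = (SOME E. is_qlub I f E)"

section \<open>Registers\<close>

text \<open>
  The elements of the type \<open>'v\<close> are the quantum variables.  \<open>B q\<close> indexes an orthonormal basis of the space of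
  the variable \<open>q\<close>, so the tensor product of the spaces of a register \<open>qs\<close> has the basis
  \<open>listset (map B qs)\<close>.

  \<open>S\<close> indexes the product basis of the space of all variables.  If \<open>'v\<close> is finite, the conditions
  force \<open>S\<close> to be the set of all families \<open>\<sigma>\<close> with \<open>\<sigma> q \<in> B q\<close>.  If it is infinite, they also admit the
  incomplete tensor product, with \<open>S\<close> the families that differ from a reference family in
  finitely many places.
\<close>

definition composite_basis :: "('v \<Rightarrow> 'b set) \<Rightarrow> ('v \<Rightarrow> 'b) set \<Rightarrow> bool" where
  "composite_basis B S \<longleftrightarrow>
     S \<noteq> {} \<and> (\<forall>\<sigma>\<in>S. \<forall>q. \<sigma> q \<in> B q) \<and> (\<forall>\<sigma>\<in>S. \<forall>q. \<forall>b\<in>B q. \<sigma>(q := b) \<in> S)"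

definition reg :: "('v \<Rightarrow> 'b set) \<Rightarrow> 'v list \<Rightarrow> 'b list set" where
  "reg B qs = listset (map B qs)"

definition update :: "('v \<Rightarrow> 'b) \<Rightarrow> 'v list \<Rightarrow> 'b list \<Rightarrow> 'v \<Rightarrow> 'b" where
  "update \<sigma> qs bs = (\<lambda>q. case map_of (zip qs bs) q of None \<Rightarrow> \<sigma> q | Some b \<Rightarrow> b)"

text \<open>The extension by the identity of an operator on the register \<open>qs\<close>: apply it to the slice of \<open>x\<close> in which the
  variables outside \<open>qs\<close> are held at their values in \<open>\<sigma>\<close>.\<close>

definition extend ::
    "('v \<Rightarrow> 'b set) \<Rightarrow> ('v \<Rightarrow> 'b) set \<Rightarrow> 'v list \<Rightarrow> 'b list oper \<Rightarrow> ('v \<Rightarrow> 'b) oper" where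
  "extend B S qs A = (\<lambda>x \<sigma>.
     if x \<in> ell2 S \<and> \<sigma> \<in> S
     then A (\<lambda>bs. if bs \<in> reg B qs then x (update \<sigma> qs bs) else 0) (map \<sigma> qs)
     else 0)"

section \<open>Circuits\<close>

datatype ('v, 'b) circuit =
    CSkip
  | Gate "'b list oper" "'v list"
  | CSeq "('v, 'b) circuit" "('v, 'b) circuit"
  | QIf "'v list" nat "nat \<Rightarrow> 'b list vect" "nat \<Rightarrow> ('v, 'b) circuit"

primrec cvars :: "('v, 'b) circuit \<Rightarrow> 'v set" where
  "cvars CSkip = {}"
| "cvars (Gate U qs) = set qs"
| "cvars (CSeq C D) = cvars C \<union> cvars D"
| "cvars (QIf qs d \<psi> C) = set qs \<union> (\<Union>i\<in>{1..d}. cvars (C i))"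

text \<open>\<open>\<U>\<close> is the given set of unitary constants.\<close>

primrec wf_circuit ::
    "('v \<Rightarrow> 'b set) \<Rightarrow> 'b list oper set \<Rightarrow> ('v, 'b) circuit \<Rightarrow> bool" where
  "wf_circuit B \<U> CSkip \<longleftrightarrow> True"
| "wf_circuit B \<U> (Gate U qs) \<longleftrightarrow> distinct qs \<and> U \<in> \<U> \<and> unitary (reg B qs) U"
| "wf_circuit B \<U> (CSeq C D) \<longleftrightarrow> wf_circuit B \<U> C \<and> wf_circuit B \<U> D"
| "wf_circuit B \<U> (QIf qs d \<psi> C) \<longleftrightarrow>
     distinct qs \<and> orthonormal_basis (reg B qs) d \<psi> \<and>
     (\<forall>i\<in>{1..d}. wf_circuit B \<U> (C i) \<and> set qs \<inter> cvars (C i) = {})"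

text \<open>In the clause for \<open>QIf\<close> the two factors act on disjoint sets of variables, so the
  composition of their extensions is their tensor product.\<close>

primrec csem ::
    "('v \<Rightarrow> 'b set) \<Rightarrow> ('v \<Rightarrow> 'b) set \<Rightarrow> ('v, 'b) circuit \<Rightarrow> ('v \<Rightarrow> 'b) oper" where
  "csem B S CSkip = idop S"
| "csem B S (Gate U qs) = extend B S qs U"
| "csem B S (CSeq C D) = csem B S D \<circ> csem B S C"
| "csem B S (QIf qs d \<psi> C) =
     (\<Sum>i=1..d. extend B S qs (outer (reg B qs) (\<psi> i) (\<psi> i)) \<circ> csem B S (C i))"

section \<open>Programs and program schemes\<close>

text \<open>Program expressions with identifiers in \<open>'x\<close>; measurement outcomes are of type \<open>'m\<close>.\<close>

datatype ('v, 'b, 'm, 'x) expr =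
    Skip
  | Abort
  | Init "'v list" "'b list vect"
  | Circ "('v, 'b) circuit"
  | Seq "('v, 'b, 'm, 'x) expr" "('v, 'b, 'm, 'x) expr"
  | Cond "'v list" "'m set" "'m \<Rightarrow> 'b list oper" "'m \<Rightarrow> ('v, 'b, 'm, 'x) expr"
  | While "'v list" "nat \<Rightarrow> 'b list oper" "('v, 'b, 'm, 'x) expr"
  | Ident 'x

text \<open>
  A scheme has the single identifier \<open>Ident ()\<close>, written \<open>X\<close> informally.  In a program, every
  identifier is the scheme \<open>F\<close> of its declaration \<open>X = F(X)\<close>: the expression \<open>Ident F\<close> is the
  recursive program \<open>\<mu>X. F(X)\<close>.
\<close>

type_synonym ('v, 'b, 'm) scheme = "('v, 'b, 'm, unit) expr"
type_synonym ('v, 'b, 'm) program = "('v, 'b, 'm, ('v, 'b, 'm) scheme) expr"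

abbreviation Mu :: "('v, 'b, 'm) scheme \<Rightarrow> ('v, 'b, 'm) program" where
  "Mu F \<equiv> Ident F"

primrec wf_expr ::
    "('v \<Rightarrow> 'b set) \<Rightarrow> 'b list oper set \<Rightarrow> ('x \<Rightarrow> bool) \<Rightarrow> ('v, 'b, 'm, 'x) expr \<Rightarrow> bool" where
  "wf_expr B \<U> ok Skip \<longleftrightarrow> True"
| "wf_expr B \<U> ok Abort \<longleftrightarrow> True"
| "wf_expr B \<U> ok (Init qs \<psi>) \<longleftrightarrow> distinct qs \<and> \<psi> \<in> ell2 (reg B qs) \<and> nrm (reg B qs) \<psi> = 1"
| "wf_expr B \<U> ok (Circ C) \<longleftrightarrow> wf_circuit B \<U> C"
| "wf_expr B \<U> ok (Seq P Q) \<longleftrightarrow> wf_expr B \<U> ok P \<and> wf_expr B \<U> ok Q"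
| "wf_expr B \<U> ok (Cond qs J M P) \<longleftrightarrow>
     distinct qs \<and> measurement (reg B qs) J M \<and> (\<forall>m\<in>J. wf_expr B \<U> ok (P m))"
| "wf_expr B \<U> ok (While qs M P) \<longleftrightarrow>
     distinct qs \<and> measurement (reg B qs) {0, 1} M \<and> wf_expr B \<U> ok P"
| "wf_expr B \<U> ok (Ident x) \<longleftrightarrow> ok x"

definition wf_scheme ::
    "('v \<Rightarrow> 'b set) \<Rightarrow> 'b list oper set \<Rightarrow> ('v, 'b, 'm) scheme \<Rightarrow> bool" where
  "wf_scheme B \<U> F \<longleftrightarrow> wf_expr B \<U> (\<lambda>_. True) F"

definition wf_program ::
    "('v \<Rightarrow> 'b set) \<Rightarrow> 'b list oper set \<Rightarrow> ('v, 'b, 'm) program \<Rightarrow> bool" where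
  "wf_program B \<U> P \<longleftrightarrow> wf_expr B \<U> (wf_scheme B \<U>) P"

text \<open>\<open>subst F P\<close> is \<open>F(P)\<close>.\<close>

primrec subst ::
    "('v, 'b, 'm) scheme \<Rightarrow> ('v, 'b, 'm, 'x) expr \<Rightarrow> ('v, 'b, 'm, 'x) expr" where
  "subst Skip P = Skip"
| "subst Abort P = Abort"
| "subst (Init qs \<psi>) P = Init qs \<psi>"
| "subst (Circ C) P = Circ C"
| "subst (Seq F G) P = Seq (subst F P) (subst G P)"
| "subst (Cond qs J M F) P = Cond qs J M (\<lambda>m. subst (F m) P)"
| "subst (While qs M F) P = While qs M (subst F P)"
| "subst (Ident u) P = P"

text \<open>The syntactic approximations \<open>F\<^sup>(\<^sup>n\<^sup>)\<close>; they contain no identifier.\<close>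

primrec approx :: "('v, 'b, 'm) scheme \<Rightarrow> nat \<Rightarrow> ('v, 'b, 'm) scheme" where
  "approx F 0 = Abort"
| "approx F (Suc n) = subst F (approx F n)"

text \<open>
  The semantics under an interpretation \<open>\<eta>\<close> of the identifiers.  Initialisation is independent of the
  orthonormal basis of the register over which the sum ranges; the standard one is used.
\<close>

primrec sem ::
    "('v \<Rightarrow> 'b set) \<Rightarrow> ('v \<Rightarrow> 'b) set \<Rightarrow> ('x \<Rightarrow> ('v \<Rightarrow> 'b) superop) \<Rightarrow>
     ('v, 'b, 'm, 'x) expr \<Rightarrow> ('v \<Rightarrow> 'b) superop" where
  "sem B S \<eta> Skip = (\<lambda>\<rho>. \<rho>)"
| "sem B S \<eta> Abort = (\<lambda>\<rho>. 0)"
| "sem B S \<eta> (Init qs \<psi>) = (\<lambda>\<rho>. opsum (reg B qs) (\<lambda>n.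
     extend B S qs (outer (reg B qs) \<psi> (ket n)) \<circ> \<rho> \<circ> extend B S qs (outer (reg B qs) (ket n) \<psi>)))"
| "sem B S \<eta> (Circ C) = (\<lambda>\<rho>. csem B S C \<circ> \<rho> \<circ> adj S (csem B S C))"
| "sem B S \<eta> (Seq P Q) = sem B S \<eta> Q \<circ> sem B S \<eta> P"
| "sem B S \<eta> (Cond qs J M P) = (\<lambda>\<rho>. opsum J (\<lambda>m.
     sem B S \<eta> (P m) (extend B S qs (M m) \<circ> \<rho> \<circ> adj S (extend B S qs (M m)))))"
| "sem B S \<eta> (While qs M P) =
     (let \<E> = (\<lambda>i \<rho>. extend B S qs (M i) \<circ> \<rho> \<circ> adj S (extend B S qs (M i)))
      in (\<lambda>\<rho>. opsum UNIV (\<lambda>n. (\<E> 0 \<circ> ((sem B S \<eta> P \<circ> \<E> 1) ^^ n)) \<rho>)))"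
| "sem B S \<eta> (Ident x) = \<eta> x"

text \<open>The interpretation of \<open>X\<close> is immaterial in \<open>mu_sem\<close>, since the approximations do not contain \<open>X\<close>.\<close>

definition mu_sem ::
    "('v \<Rightarrow> 'b set) \<Rightarrow> ('v \<Rightarrow> 'b) set \<Rightarrow> ('v, 'b, 'm) scheme \<Rightarrow> ('v \<Rightarrow> 'b) superop" where
  "mu_sem B S F = qlub S (\<lambda>n. sem B S (\<lambda>_ _. 0) (approx F n))"

definition denote ::
    "('v \<Rightarrow> 'b set) \<Rightarrow> ('v \<Rightarrow> 'b) set \<Rightarrow> ('v, 'b, 'm) program \<Rightarrow> ('v \<Rightarrow> 'b) superop" where
  "denote B S P = sem B S (mu_sem B S) P"

definition prog_equiv ::
    "('v \<Rightarrow> 'b set) \<Rightarrow> ('v \<Rightarrow> 'b) set \<Rightarrow> ('v, 'b, 'm) program \<Rightarrow> ('v, 'b, 'm) program \<Rightarrow> bool" where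
  "prog_equiv B S P Q \<longleftrightarrow> (\<forall>\<rho>\<in>pdo S. denote B S P \<rho> = denote B S Q \<rho>)"

definition prog_le ::
    "('v \<Rightarrow> 'b set) \<Rightarrow> ('v \<Rightarrow> 'b) set \<Rightarrow> ('v, 'b, 'm) program \<Rightarrow> ('v, 'b, 'm) program \<Rightarrow> bool" where
  "prog_le B S Q P \<longleftrightarrow> (\<forall>\<rho>\<in>pdo S. lowner S (denote B S Q \<rho>) (denote B S P \<rho>))"

end

theory Submission
  imports Defs
begin

text \<open>
  The order of quantum operations is checked with traces.  If \<open>f n \<sqsubseteq> E\<close>, then \<open>E \<rho> - f n \<rho>\<close> is positive,
  so \<open>tr (f n \<rho>) \<longlonglongrightarrow> tr (E \<rho>)\<close> says that \<open>f n \<rho>\<close> converges to \<open>E \<rho>\<close> in trace norm.  This kind of convergence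
  is preserved by composition, because quantum operations do not increase the trace, and by the sums in
  conditionals and loops, by dominated convergence.  So the semantics of a scheme is continuous in the
  meaning of its identifier.  The approximations \<open>F\<^sup>(\<^sup>n\<^sup>)\<close> increase, and converge in this sense to their supremum
  \<open>M\<close> and, by continuity, to \<open>F(M)\<close>; as \<open>M \<sqsubseteq> F(M)\<close> and both have the same trace at every \<open>\<rho>\<close>, they agree.

  That the semantic clauses do not increase the trace needs no spectral theorem: a compression of a positive operator
  to finitely many coordinates has a Cholesky decomposition into operators of rank one, and the bounds
  pass to the limit.
\<close>

section \<open>Square-summable families\<close>

text \<open>The order alone does not show that suprema pass through the infinite sums of the
  clauses: those sums converge only weakly, and a weak limit may lose trace, as the projections onto
  successive basis vectors of an infinite-dimensional space show. What helps is that the trace of a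
  positive operator bounds its norm. It therefore separates ordered operators, so two comparable
  operators of equal trace coincide, and it controls differences along increasing sequences.
  Equality can only be expected on trace class operators, since quantum operations are unconstrained
  elsewhere and \<open>qlub\<close> is a choice; comparisons are made on \<open>pos_tc\<close>, and
  a statement about partial density operators is carried there by rescaling. Leastness is the usual
  induction over the approximations and rests on monotonicity, which is read off from continuity.
  The same structural induction also shows that meanings are quantum operations, as this is built
  into the relations \<open>below\<close> and \<open>approximates\<close>.\<close>

lemma sum_apply: "(\<Sum>k\<in>K. f k) x = (\<Sum>k\<in>K. f k x)"
  by (induction K rule: infinite_finite_induct) auto

lemma ell2_outside: "x \<in> ell2 I \<Longrightarrow> i \<notin> I \<Longrightarrow> x i = 0"
  by (auto simp: ell2_def)

lemma ell2_summable: "x \<in> ell2 I \<Longrightarrow> (\<lambda>i. (cmod (x i))\<^sup>2) summable_on I"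
  by (auto simp: ell2_def)

lemma nrm_nonneg [simp]: "0 \<le> nrm I x"
  by (auto simp: nrm_def intro!: infsum_nonneg)

lemma nrm_sq: "(nrm I x)\<^sup>2 = (\<Sum>\<^sub>\<infinity>i\<in>I. (cmod (x i))\<^sup>2)"
  by (auto simp: nrm_def intro!: infsum_nonneg)

lemma sum_le_nrm:
  assumes "x \<in> ell2 I" "finite F" "F \<subseteq> I"
  shows "(\<Sum>i\<in>F. (cmod (x i))\<^sup>2) \<le> (nrm I x)\<^sup>2"
  unfolding nrm_sq using assms by (intro finite_sum_le_infsum ell2_summable) auto

text \<open>All terms are nonnegative, so a common bound on finite partial sums gives summability
  and bounds the sum. Membership in \<open>ell2\<close> thereby reduces to estimates on finitely
  many coordinates.\<close>

lemma ell2_boundI: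
  assumes "\<And>i. i \<notin> I \<Longrightarrow> x i = 0"
    and "\<And>F. finite F \<Longrightarrow> F \<subseteq> I \<Longrightarrow> (\<Sum>i\<in>F. (cmod (x i))\<^sup>2) \<le> C"
  shows "x \<in> ell2 I" and "(nrm I x)\<^sup>2 \<le> C"
proof -
  have s: "(\<lambda>i. (cmod (x i))\<^sup>2) summable_on I"
    by (rule nonneg_bdd_above_summable_on) (auto intro!: bdd_aboveI[of _ C] assms(2))
  then show "x \<in> ell2 I" using assms(1) by (auto simp: ell2_def)
  show "(nrm I x)\<^sup>2 \<le> C"
    unfolding nrm_sq using s assms(2) by (intro infsum_le_finite_sums)
qed

lemma cmod_add_sq_le: "(cmod (a + b))\<^sup>2 \<le> 2 * (cmod a)\<^sup>2 + 2 * (cmod b)\<^sup>2"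
proof -
  have "(cmod (a + b))\<^sup>2 \<le> (cmod a + cmod b)\<^sup>2"
    by (intro power_mono norm_triangle_ineq norm_ge_zero)
  also have "\<dots> \<le> 2 * (cmod a)\<^sup>2 + 2 * (cmod b)\<^sup>2"
    using sum_squares_bound[of "cmod a" "cmod b"] by (simp add: power2_sum)
  finally show ?thesis .
qed

lemma ell2_add [intro]:
  assumes "x \<in> ell2 I" "y \<in> ell2 I" shows "x + y \<in> ell2 I"
proof (rule ell2_boundI)
  fix F assume F: "finite F" "F \<subseteq> I"
  have "(\<Sum>i\<in>F. (cmod ((x + y) i))\<^sup>2) \<le> (\<Sum>i\<in>F. 2 * (cmod (x i))\<^sup>2 + 2 * (cmod (y i))\<^sup>2)"
    by (intro sum_mono) (simp add: cmod_add_sq_le)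
  also have "\<dots> \<le> 2 * (nrm I x)\<^sup>2 + 2 * (nrm I y)\<^sup>2"
    using sum_le_nrm[OF assms(1) F] sum_le_nrm[OF assms(2) F]
    by (simp add: sum.distrib sum_distrib_left[symmetric])
  finally show "(\<Sum>i\<in>F. (cmod ((x + y) i))\<^sup>2) \<le> 2 * (nrm I x)\<^sup>2 + 2 * (nrm I y)\<^sup>2" .
qed (use assms in \<open>auto simp: ell2_outside\<close>)

lemma ell2_scale [intro]:
  assumes "x \<in> ell2 I" shows "(\<lambda>i. c * x i) \<in> ell2 I"
  using assms by (auto simp: ell2_def norm_mult power_mult_distrib intro!: summable_on_cmult_right)

lemma ell2_0 [simp, intro]: "0 \<in> ell2 I"
  by (auto simp: ell2_def)

lemma ell2_0' [simp, intro]: "(\<lambda>_. 0) \<in> ell2 I"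
  by (auto simp: ell2_def)

lemma ell2_minus [intro]:
  assumes "x \<in> ell2 I" "y \<in> ell2 I" shows "x - y \<in> ell2 I"
proof -
  have "x - y = x + (\<lambda>i. (-1) * y i)" by auto
  then show ?thesis using ell2_add[OF assms(1) ell2_scale[OF assms(2), of "-1"]] by (simp only:)
qed

lemma ell2_sum [intro]:
  "(\<And>k. k \<in> K \<Longrightarrow> f k \<in> ell2 I) \<Longrightarrow> (\<Sum>k\<in>K. f k) \<in> ell2 I"
  by (induction K rule: infinite_finite_induct) auto

lemma nrm_scale: "nrm I (\<lambda>i. c * x i) = cmod c * nrm I x"
  by (simp add: nrm_def norm_mult power_mult_distrib infsum_cmult_right' real_sqrt_mult)

text \<open>Cauchy-Schwarz on finitely many coordinates. The bound is uniform in \<open>F\<close>,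
  which makes the series defining \<open>ip\<close> absolutely convergent.\<close>

lemma sum_cmod_mult_le:
  assumes "x \<in> ell2 I" "y \<in> ell2 I" "finite F" "F \<subseteq> I"
  shows "(\<Sum>i\<in>F. cmod (x i) * cmod (y i)) \<le> nrm I x * nrm I y"
proof -
  have "(\<Sum>i\<in>F. cmod (x i) * cmod (y i)) \<le> L2_set (\<lambda>i. cmod (x i)) F * L2_set (\<lambda>i. cmod (y i)) F"
    using L2_set_mult_ineq[of "\<lambda>i. cmod (x i)" "\<lambda>i. cmod (y i)" F] by simp
  also have "\<dots> \<le> nrm I x * nrm I y"
    unfolding L2_set_def
    by (intro mult_mono real_le_lsqrt sum_nonneg sum_le_nrm assms) (auto simp: sum_nonneg)
  finally show ?thesis .
qed

lemma ip_abs_summable: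
  assumes "x \<in> ell2 I" "y \<in> ell2 I"
  shows "(\<lambda>i. norm (cnj (x i) * y i)) summable_on I"
  by (rule nonneg_bdd_above_summable_on)
    (auto simp: norm_mult intro!: bdd_aboveI[of _ "nrm I x * nrm I y"] sum_cmod_mult_le assms)

lemma ip_summable:
  assumes "x \<in> ell2 I" "y \<in> ell2 I"
  shows "(\<lambda>i. cnj (x i) * y i) summable_on I"
  using ip_abs_summable[OF assms] by (rule abs_summable_summable)

lemma ip_has_sum:
  assumes "x \<in> ell2 I" "y \<in> ell2 I"
  shows "((\<lambda>i. cnj (x i) * y i) has_sum ip I x y) I"
  unfolding ip_def using ip_summable[OF assms] by simp

lemma ip_bound:
  assumes "x \<in> ell2 I" "y \<in> ell2 I"
  shows "cmod (ip I x y) \<le> nrm I x * nrm I y"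
proof -
  have "cmod (ip I x y) \<le> (\<Sum>\<^sub>\<infinity>i\<in>I. norm (cnj (x i) * y i))"
    unfolding ip_def by (rule norm_infsum_bound[OF ip_abs_summable[OF assms]])
  also have "\<dots> \<le> nrm I x * nrm I y"
    by (rule infsum_le_finite_sums[OF ip_abs_summable[OF assms]])
      (auto simp: norm_mult intro!: sum_cmod_mult_le assms)
  finally show ?thesis .
qed

lemma ip_add_right:
  assumes "x \<in> ell2 I" "y \<in> ell2 I" "z \<in> ell2 I"
  shows "ip I x (y + z) = ip I x y + ip I x z"
  unfolding ip_def using assms
  by (simp add: distrib_left infsum_add ip_summable)

lemma ip_scale_right: "ip I x (\<lambda>i. c * y i) = c * ip I x y"
  unfolding ip_def by (simp add: infsum_cmult_right'[symmetric] ac_simps)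

lemma ip_cnj: "cnj (ip I x y) = ip I y x"
  unfolding ip_def by (simp add: infsum_cnj[symmetric] mult.commute del: infsum_cnj)

lemma ip_add_left:
  assumes "x \<in> ell2 I" "y \<in> ell2 I" "z \<in> ell2 I"
  shows "ip I (x + y) z = ip I x z + ip I y z"
  using ip_add_right[of z I x y] assms by (metis complex_cnj_add ip_cnj)

lemma ip_0_right [simp]: "ip I x 0 = 0"
  by (simp add: ip_def)

lemma ip_minus_right:
  assumes "x \<in> ell2 I" "y \<in> ell2 I" "z \<in> ell2 I"
  shows "ip I x (y - z) = ip I x y - ip I x z"
proof -
  have "y = (y - z) + z" by auto
  then have "ip I x y = ip I x (y - z) + ip I x z"
    using ip_add_right[OF assms(1) ell2_minus[OF assms(2,3)] assms(3)] by simp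
  then show ?thesis by simp
qed

lemma ip_minus_left:
  assumes "x \<in> ell2 I" "y \<in> ell2 I" "z \<in> ell2 I"
  shows "ip I (x - y) z = ip I x z - ip I y z"
  using ip_minus_right[of z I x y] assms by (metis complex_cnj_diff ip_cnj)

lemma ip_sum_right:
  assumes "x \<in> ell2 I" "\<And>k. k \<in> K \<Longrightarrow> f k \<in> ell2 I"
  shows "ip I x (\<Sum>k\<in>K. f k) = (\<Sum>k\<in>K. ip I x (f k))"
  using assms(2)
proof (induction K rule: infinite_finite_induct)
  case (insert k K)
  have "sum f (insert k K) = f k + sum f K" by (rule sum.insert[OF insert(1,2)])
  moreover have "ip I x (f k + sum f K) = ip I x (f k) + ip I x (sum f K)"
    using insert assms(1) by (intro ip_add_right ell2_sum) auto
  moreover have "ip I x (sum f K) = (\<Sum>k\<in>K. ip I x (f k))" using insert by blast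
  ultimately show ?case using sum.insert[OF insert(1,2), of "\<lambda>k. ip I x (f k)"] by (simp only:)
qed auto

lemma ip_sum_left:
  assumes "x \<in> ell2 I" "\<And>k. k \<in> K \<Longrightarrow> f k \<in> ell2 I"
  shows "ip I (\<Sum>k\<in>K. f k) x = (\<Sum>k\<in>K. ip I (f k) x)"
  using arg_cong[OF ip_sum_right[OF assms], where f = cnj] by (simp add: cnj_sum ip_cnj)

lemma ip_self: "x \<in> ell2 I \<Longrightarrow> ip I x x = of_real ((nrm I x)\<^sup>2)"
proof -
  assume x: "x \<in> ell2 I"
  have "((\<lambda>i. (cmod (x i))\<^sup>2) has_sum (nrm I x)\<^sup>2) I"
    using ell2_summable[OF x] by (simp add: nrm_sq)
  then have "((\<lambda>i. of_real ((cmod (x i))\<^sup>2)) has_sum complex_of_real ((nrm I x)\<^sup>2)) I"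
    by (rule has_sum_of_real)
  moreover have "complex_of_real ((cmod (x i))\<^sup>2) = cnj (x i) * x i" for i
    unfolding complex_norm_square by (rule mult.commute)
  ultimately show ?thesis by (simp add: ip_def infsumI)
qed

lemma nrm_triangle:
  assumes "x \<in> ell2 I" "y \<in> ell2 I"
  shows "nrm I (x + y) \<le> nrm I x + nrm I y"
proof -
  have "complex_of_real ((nrm I (x + y))\<^sup>2) = ip I x x + ip I x y + (ip I y x + ip I y y)"
    using assms by (simp add: ip_self[symmetric] ell2_add ip_add_left ip_add_right del: of_real_power)
  then have "(nrm I (x + y))\<^sup>2 = Re (ip I x x + ip I x y + (ip I y x + ip I y y))"
    by (metis Re_complex_of_real)
  also have "\<dots> \<le> (nrm I x)\<^sup>2 + nrm I x * nrm I y + (nrm I y * nrm I x + (nrm I y)\<^sup>2)"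
    using ip_bound[OF assms] ip_bound[OF assms(2,1)] assms
      complex_Re_le_cmod[of "ip I x y"] complex_Re_le_cmod[of "ip I y x"]
    by (simp add: ip_self mult.commute[of "nrm I y"])
  also have "\<dots> = (nrm I x + nrm I y)\<^sup>2" by (simp add: power2_eq_square algebra_simps)
  finally show ?thesis by (rule power2_le_imp_le) simp
qed

lemma nrm_minus_triangle:
  assumes "x \<in> ell2 I" "y \<in> ell2 I"
  shows "nrm I (x - y) \<le> nrm I x + nrm I y"
proof -
  have "x - y = x + (\<lambda>i. (-1) * y i)" by auto
  moreover have "nrm I (\<lambda>i. (-1) * y i) = nrm I y" by (simp only: nrm_scale) simp
  ultimately show ?thesis using nrm_triangle[OF assms(1) ell2_scale[OF assms(2), of "-1"]]
    by (simp only:)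
qed

lemma ket_ell2 [simp]:
  fixes i :: 'i assumes "i \<in> I" shows "ket i \<in> ell2 I"
proof (rule ell2_boundI)
  fix F :: "'i set" assume "finite F"
  have "(\<Sum>j\<in>F. (cmod (ket i j))\<^sup>2) = (\<Sum>j\<in>F. if j = i then 1 else 0)"
    by (intro sum.cong) (auto simp: ket_def)
  also have "\<dots> \<le> 1" using \<open>finite F\<close> by simp
  finally show "(\<Sum>j\<in>F. (cmod (ket i j))\<^sup>2) \<le> 1" .
qed (use assms in \<open>auto simp: ket_def\<close>)

lemma ip_ket_left: "i \<in> I \<Longrightarrow> ip I (ket i) x = x i"
proof -
  assume i: "i \<in> I"
  have "ip I (ket i) x = (\<Sum>\<^sub>\<infinity>j\<in>{i}. cnj (ket i j) * x j)"
    unfolding ip_def by (rule infsum_cong_neutral) (use i in \<open>auto simp: ket_def\<close>)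
  then show ?thesis by (simp add: ket_def)
qed

lemma ip_ket_right: "i \<in> I \<Longrightarrow> ip I x (ket i) = cnj (x i)"
  by (metis ip_ket_left ip_cnj)

lemma nrm_ket [simp]: "i \<in> I \<Longrightarrow> nrm I (ket i) = 1"
proof -
  assume i: "i \<in> I"
  have "complex_of_real ((nrm I (ket i))\<^sup>2) = 1"
    using ip_ket_left[OF i, of "ket i"] ip_self[OF ket_ell2[OF i]] by (simp add: ket_def)
  then have "(nrm I (ket i))\<^sup>2 = 1\<^sup>2" by (simp only: of_real_eq_1_iff power_one)
  then show ?thesis by (rule power2_eq_imp_eq) auto
qed

lemma coord_le_nrm: "x \<in> ell2 I \<Longrightarrow> cmod (x i) \<le> nrm I x"
proof (cases "i \<in> I")
  case True
  assume "x \<in> ell2 I"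
  then show ?thesis using ip_bound[of "ket i" I x] True by (simp add: ip_ket_left)
qed (simp add: ell2_outside)

section \<open>Truncation to finitely many coordinates and coordinatewise limits\<close>

definition trunc :: "'i set \<Rightarrow> 'i vect \<Rightarrow> 'i vect" where
  "trunc F x = (\<lambda>i. if i \<in> F then x i else 0)"

lemma trunc_ell2 [simp]: "x \<in> ell2 I \<Longrightarrow> trunc F x \<in> ell2 I"
  and nrm_trunc_le: "x \<in> ell2 I \<Longrightarrow> nrm I (trunc F x) \<le> nrm I x"
proof -
  assume x: "x \<in> ell2 I"
  have "(\<Sum>i\<in>G. (cmod (trunc F x i))\<^sup>2) \<le> (nrm I x)\<^sup>2" if "finite G" "G \<subseteq> I" for G
  proof -
    have "(\<Sum>i\<in>G. (cmod (trunc F x i))\<^sup>2) \<le> (\<Sum>i\<in>G. (cmod (x i))\<^sup>2)"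
      by (intro sum_mono) (auto simp: trunc_def)
    then show ?thesis using sum_le_nrm[OF x that] by simp
  qed
  from ell2_boundI[OF _ this] show "trunc F x \<in> ell2 I" "nrm I (trunc F x) \<le> nrm I x"
    using x by (auto simp: trunc_def ell2_outside intro: power2_le_imp_le)
qed

lemma trunc_eq_sum: "finite F \<Longrightarrow> trunc F x = (\<Sum>i\<in>F. (\<lambda>j. x i * ket i j))"
proof
  fix j assume "finite F"
  have "(\<Sum>i\<in>F. x i * ket i j) = (\<Sum>i\<in>F. if i = j then x i else 0)"
    by (intro sum.cong) (auto simp: ket_def)
  then show "trunc F x j = (\<Sum>i\<in>F. (\<lambda>j. x i * ket i j)) j"
    using \<open>finite F\<close> by (simp add: sum_apply trunc_def)
qed

text \<open>The squared norm of the tail is \<open>(nrm I x)\<^sup>2\<close> minus a partial sum of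
  the series that converges to it.\<close>

lemma trunc_tendsto:
  assumes x: "x \<in> ell2 I"
  shows "((\<lambda>F. nrm I (x - trunc F x)) \<longlongrightarrow> 0) (finite_subsets_at_top I)"
proof -
  let ?s = "\<lambda>F. \<Sum>i\<in>F. (cmod (x i))\<^sup>2"
  have lim: "(?s \<longlongrightarrow> (nrm I x)\<^sup>2) (finite_subsets_at_top I)"
    unfolding nrm_sq by (rule infsum_tendsto[OF ell2_summable[OF x]])
  have eq: "(nrm I (x - trunc F x))\<^sup>2 = (nrm I x)\<^sup>2 - ?s F" if "finite F" "F \<subseteq> I" for F
  proof -
    have 1: "((\<lambda>i. (cmod (x i))\<^sup>2) has_sum (nrm I x)\<^sup>2) I"
      using ell2_summable[OF x] by (simp add: nrm_sq)
    have 2: "((\<lambda>i. if i \<in> F then (cmod (x i))\<^sup>2 else 0) has_sum ?s F) I"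
      using that by (intro has_sum_finite_neutralI) auto
    have "((\<lambda>i. (cmod (x i))\<^sup>2 - (if i \<in> F then (cmod (x i))\<^sup>2 else 0)) has_sum (nrm I x)\<^sup>2 - ?s F) I"
      using has_sum_add[OF 1 has_sum_uminusI[OF 2]] by simp
    also have "(\<lambda>i. (cmod (x i))\<^sup>2 - (if i \<in> F then (cmod (x i))\<^sup>2 else 0)) = (\<lambda>i. (cmod ((x - trunc F x) i))\<^sup>2)"
      by (auto simp: trunc_def)
    finally show ?thesis unfolding nrm_sq[of I "x - trunc F x"] by (rule infsumI)
  qed
  have "((\<lambda>F. sqrt ((nrm I x)\<^sup>2 - ?s F)) \<longlongrightarrow> sqrt ((nrm I x)\<^sup>2 - (nrm I x)\<^sup>2)) (finite_subsets_at_top I)"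
    by (intro tendsto_real_sqrt tendsto_diff tendsto_const lim)
  moreover have "\<forall>\<^sub>F F in finite_subsets_at_top I. sqrt ((nrm I x)\<^sup>2 - ?s F) = nrm I (x - trunc F x)"
    by (rule eventually_finite_subsets_at_top_weakI) (simp add: eq[symmetric])
  ultimately show ?thesis by (simp add: tendsto_cong)
qed

text \<open>A norm bound turns coordinatewise convergence into weak convergence: replacing
  \<open>y\<close> by a finite truncation costs at most the norm of the tail times
  \<open>2 * C\<close>, and against a truncated vector only finitely many coordinates count. The
  bound itself survives by Fatou's argument on finite partial sums.\<close>

lemma coordinatewise_limit:
  assumes nt: "\<FF> \<noteq> bot" and out: "\<And>i. i \<notin> I \<Longrightarrow> z i = 0"
    and bd: "\<forall>\<^sub>F k in \<FF>. f k \<in> ell2 I \<and> nrm I (f k) \<le> C"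
    and lim: "\<And>i. i \<in> I \<Longrightarrow> ((\<lambda>k. f k i) \<longlongrightarrow> z i) \<FF>"
  shows "z \<in> ell2 I" and "nrm I z \<le> C" and "y \<in> ell2 I \<Longrightarrow> ((\<lambda>k. ip I y (f k)) \<longlongrightarrow> ip I y z) \<FF>"
proof -
  have C: "C \<ge> 0"
    using eventually_happens'[OF nt bd] nrm_nonneg order_trans by blast
  have *: "(\<Sum>i\<in>F. (cmod (z i))\<^sup>2) \<le> C\<^sup>2" if F: "finite F" "F \<subseteq> I" for F
  proof (rule tendsto_upperbound[OF _ _ nt])
    show "((\<lambda>k. \<Sum>i\<in>F. (cmod (f k i))\<^sup>2) \<longlongrightarrow> (\<Sum>i\<in>F. (cmod (z i))\<^sup>2)) \<FF>"
      using F by (intro tendsto_intros lim) auto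
    show "\<forall>\<^sub>F k in \<FF>. (\<Sum>i\<in>F. (cmod (f k i))\<^sup>2) \<le> C\<^sup>2"
      using bd
    proof eventually_elim
      case (elim k)
      then show ?case using sum_le_nrm[OF _ F, of "f k"] power_mono[of "nrm I (f k)" C 2] by simp
    qed
  qed
  show z: "z \<in> ell2 I" by (rule ell2_boundI[OF out *])
  have "(nrm I z)\<^sup>2 \<le> C\<^sup>2" by (rule ell2_boundI(2)[OF out *])
  then show zC: "nrm I z \<le> C" using C by (rule power2_le_imp_le)
  assume y: "y \<in> ell2 I"
  show "((\<lambda>k. ip I y (f k)) \<longlongrightarrow> ip I y z) \<FF>"
  proof (rule tendstoI)
    fix e :: real assume e: "e > 0"
    \<comment> \<open>Since \<open>nrm I (f k - z) \<le> 2 * C\<close>, a tail of norm below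
      \<open>d\<close> contributes less than \<open>e / 2\<close>; the summand 1 keeps the
      denominator positive when \<open>C = 0\<close>.\<close>
    define d where "d = e / (2 * (2 * C + 1))"
    have d: "d > 0" using e C by (simp add: d_def)
    have "\<forall>\<^sub>F F in finite_subsets_at_top I. nrm I (y - trunc F y) < d"
      using order_tendstoD(2)[OF trunc_tendsto[OF y] d] .
    then have "\<forall>\<^sub>F F in finite_subsets_at_top I. nrm I (y - trunc F y) < d \<and> finite F \<and> F \<subseteq> I"
      by (rule eventually_conj) (rule eventually_finite_subsets_at_top_weakI, simp)
    then obtain F where F: "nrm I (y - trunc F y) < d" "finite F" "F \<subseteq> I"
      using eventually_happens'[OF finite_subsets_at_top_neq_bot] by blast
    have ipt: "ip I (trunc F y) w = (\<Sum>i\<in>F. cnj (y i) * w i)" for w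
      unfolding ip_def
      by (rule infsumI, rule has_sum_finite_neutralI) (use F in \<open>auto simp: trunc_def intro!: sum.cong\<close>)
    have "((\<lambda>k. \<Sum>i\<in>F. cnj (y i) * (f k i - z i)) \<longlongrightarrow> (\<Sum>i\<in>F. cnj (y i) * (z i - z i))) \<FF>"
      using F by (intro tendsto_intros lim) auto
    then have "((\<lambda>k. ip I (trunc F y) (f k - z)) \<longlongrightarrow> 0) \<FF>"
      by (simp add: ipt)
    from tendstoD[OF this, of "e/2"] e
    have "\<forall>\<^sub>F k in \<FF>. cmod (ip I (trunc F y) (f k - z)) < e / 2" by simp
    with bd show "\<forall>\<^sub>F k in \<FF>. dist (ip I y (f k)) (ip I y z) < e"
    proof eventually_elim
      case (elim k)
      have fz: "f k - z \<in> ell2 I" using elim z by auto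
      have "ip I y (f k) - ip I y z = ip I y (f k - z)"
        using elim y z by (simp add: ip_minus_right)
      also have "\<dots> = ip I (y - trunc F y) (f k - z) + ip I (trunc F y) (f k - z)"
        using fz y by (simp add: ip_minus_left)
      finally have "cmod (ip I y (f k) - ip I y z) \<le> cmod (ip I (y - trunc F y) (f k - z)) + e/2"
        using elim norm_triangle_ineq[of "ip I (y - trunc F y) (f k - z)" "ip I (trunc F y) (f k - z)"] by simp
      moreover have "cmod (ip I (y - trunc F y) (f k - z)) \<le> nrm I (y - trunc F y) * nrm I (f k - z)"
        using fz y by (intro ip_bound) auto
      moreover have "\<dots> \<le> d * (2 * C)"
        using F d elim nrm_minus_triangle[of "f k" I z] z zC by (intro mult_mono) auto
      moreover have "d * (2 * C) < e / 2"
        using e C by (simp add: d_def field_simps)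
      ultimately show ?case
        using elim by (simp add: dist_norm) 
    qed
  qed
qed

lemma norm_limit_imp_ip_limit:
  assumes "\<And>k. f k \<in> ell2 I" "z \<in> ell2 I" "y \<in> ell2 I" "((\<lambda>k. nrm I (z - f k)) \<longlongrightarrow> 0) \<FF>"
  shows "((\<lambda>k. ip I y (f k)) \<longlongrightarrow> ip I y z) \<FF>"
proof (rule LIM_zero_cancel, rule Lim_null_comparison)
  show "\<forall>\<^sub>F k in \<FF>. norm (ip I y (f k) - ip I y z) \<le> nrm I y * nrm I (z - f k)"
  proof (intro always_eventually allI)
    fix k
    have "norm (ip I y (f k) - ip I y z) = norm (ip I y (z - f k))"
      using assms by (simp add: ip_minus_right norm_minus_commute)
    also have "\<dots> \<le> nrm I y * nrm I (z - f k)" using assms by (intro ip_bound) auto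
    finally show "norm (ip I y (f k) - ip I y z) \<le> nrm I y * nrm I (z - f k)" .
  qed
  show "((\<lambda>k. nrm I y * nrm I (z - f k)) \<longlongrightarrow> 0) \<FF>"
    using tendsto_mult_right_zero[OF assms(4)] .
qed

lemma nrm_eq_0_imp: "x \<in> ell2 I \<Longrightarrow> nrm I x = 0 \<Longrightarrow> x = 0"
  using coord_le_nrm[of x I] by (auto simp: fun_eq_iff)

section \<open>Bounded and positive operators\<close>

lemma bounded_op_outside: "bounded_op I A \<Longrightarrow> x \<notin> ell2 I \<Longrightarrow> A x = 0"
  and bounded_op_add: "bounded_op I A \<Longrightarrow> x \<in> ell2 I \<Longrightarrow> y \<in> ell2 I \<Longrightarrow> A (x + y) = A x + A y"
  and bounded_op_scale: "bounded_op I A \<Longrightarrow> x \<in> ell2 I \<Longrightarrow> A (\<lambda>i. c * x i) = (\<lambda>i. c * A x i)"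
  by (auto simp: bounded_op_def)

lemma bounded_op_ell2 [simp, intro]: "bounded_op I A \<Longrightarrow> A x \<in> ell2 I"
  by (cases "x \<in> ell2 I") (auto simp: bounded_op_def)

lemma bounded_op_0 [simp]: "bounded_op I A \<Longrightarrow> A 0 = 0"
  using bounded_op_scale[of I A 0 0] by (simp add: zero_fun_def)

lemma bounded_op_minus:
  assumes "bounded_op I A" "x \<in> ell2 I" "y \<in> ell2 I" shows "A (x - y) = A x - A y"
proof -
  have "A ((x - y) + y) = A (x - y) + A y" by (rule bounded_op_add[OF assms(1) ell2_minus[OF assms(2,3)] assms(3)])
  moreover have "(x - y) + y = x" by simp
  ultimately show ?thesis by (simp only: eq_diff_eq)
qed

lemma bounded_op_sum:
  assumes "bounded_op I A" "\<And>k. k \<in> K \<Longrightarrow> f k \<in> ell2 I"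
  shows "A (\<Sum>k\<in>K. f k) = (\<Sum>k\<in>K. A (f k))"
  using assms(2)
proof (induction K rule: infinite_finite_induct)
  case (insert k K)
  have "A (f k + sum f K) = A (f k) + A (sum f K)"
    using insert assms(1) by (intro bounded_op_add ell2_sum) auto
  moreover have "A (sum f K) = (\<Sum>k\<in>K. A (f k))" using insert by blast
  ultimately show ?case
    using sum.insert[OF insert(1,2), of f] sum.insert[OF insert(1,2), of "\<lambda>k. A (f k)"] by (simp only:)
qed (use assms(1) in auto)

lemma bounded_op_bound:
  assumes "bounded_op I A"
  obtains K where "K \<ge> 0" "\<And>x. x \<in> ell2 I \<Longrightarrow> nrm I (A x) \<le> K * nrm I x"
proof -
  obtain K where K: "\<And>x. x \<in> ell2 I \<Longrightarrow> nrm I (A x) \<le> K * nrm I x"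
    using assms unfolding bounded_op_def by blast
  have "nrm I (A x) \<le> \<bar>K\<bar> * nrm I x" if "x \<in> ell2 I" for x
    using K[OF that] by (meson abs_ge_self mult_right_mono nrm_nonneg order_trans)
  then show ?thesis using that[of "\<bar>K\<bar>"] by auto
qed

lemma bounded_op_comp:
  assumes "bounded_op I A" "bounded_op I B" shows "bounded_op I (A \<circ> B)"
proof -
  obtain K where K: "K \<ge> 0" "\<And>x. x \<in> ell2 I \<Longrightarrow> nrm I (A x) \<le> K * nrm I x"
    using bounded_op_bound[OF assms(1)] by auto
  obtain L where L: "L \<ge> 0" "\<And>x. x \<in> ell2 I \<Longrightarrow> nrm I (B x) \<le> L * nrm I x"
    using bounded_op_bound[OF assms(2)] by auto
  have "nrm I (A (B x)) \<le> (K * L) * nrm I x" if "x \<in> ell2 I" for x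
    using K(2)[of "B x"] mult_left_mono[OF L(2)[OF that] K(1)] assms(2) by (simp add: mult.assoc)
  then have "\<exists>K. \<forall>x\<in>ell2 I. nrm I (A (B x)) \<le> K * nrm I x" by blast
  moreover have "A (B (x + y)) = A (B x) + A (B y)" if "x \<in> ell2 I" "y \<in> ell2 I" for x y
    unfolding bounded_op_add[OF assms(2) that]
    by (rule bounded_op_add[OF assms(1) bounded_op_ell2[OF assms(2)] bounded_op_ell2[OF assms(2)]])
  ultimately show ?thesis using assms
    unfolding o_def bounded_op_def[of I "\<lambda>x. A (B x)"]
    using bounded_op_0[OF assms(1)] by (simp add: bounded_op_scale bounded_op_outside zero_fun_def)
qed

lemma bounded_op_plus:
  assumes "bounded_op I A" "bounded_op I B" shows "bounded_op I (A + B)"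
proof -
  obtain K where K: "K \<ge> 0" "\<And>x. x \<in> ell2 I \<Longrightarrow> nrm I (A x) \<le> K * nrm I x"
    using bounded_op_bound[OF assms(1)] by auto
  obtain L where L: "L \<ge> 0" "\<And>x. x \<in> ell2 I \<Longrightarrow> nrm I (B x) \<le> L * nrm I x"
    using bounded_op_bound[OF assms(2)] by auto
  have bd: "nrm I (A x + B x) \<le> (K + L) * nrm I x" if "x \<in> ell2 I" for x
    using K(2)[OF that] L(2)[OF that] nrm_triangle[of "A x" I "B x"] assms
    by (simp add: distrib_right)
  show ?thesis
    unfolding bounded_op_def
  proof (intro conjI ballI allI impI)
    fix x y assume xy: "x \<in> ell2 I" "y \<in> ell2 I"
    show "(A + B) (x + y) = (A + B) x + (A + B) y"
      unfolding plus_fun_apply[of A] bounded_op_add[OF assms(1) xy] bounded_op_add[OF assms(2) xy]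
      by (simp only: ac_simps)
  next
    fix c x assume "x \<in> ell2 I"
    then show "(A + B) (\<lambda>i. c * x i) = (\<lambda>i. c * (A + B) x i)"
      using assms by (simp add: fun_eq_iff bounded_op_scale distrib_left)
  next
    have "\<forall>x\<in>ell2 I. nrm I ((A + B) x) \<le> (K + L) * nrm I x" using bd by (simp add: plus_fun_def)
    then show "\<exists>K. \<forall>x\<in>ell2 I. nrm I ((A + B) x) \<le> K * nrm I x" by blast
  next
    fix x assume "x \<in> ell2 I"
    show "(A + B) x \<in> ell2 I" using ell2_add[of "A x" I "B x"] assms by (simp add: plus_fun_def)
  next
    fix x assume "x \<notin> ell2 I"
    then show "(A + B) x = 0" using assms by (simp add: fun_eq_iff bounded_op_outside)
  qed
qed

lemma bounded_op_scaled:
  assumes "bounded_op I A" shows "bounded_op I (\<lambda>x i. c * A x i)"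
proof -
  obtain K where K: "K \<ge> 0" "\<And>x. x \<in> ell2 I \<Longrightarrow> nrm I (A x) \<le> K * nrm I x"
    using bounded_op_bound[OF assms(1)] by auto
  have "nrm I (\<lambda>i. c * A x i) \<le> (cmod c * K) * nrm I x" if "x \<in> ell2 I" for x
    using mult_left_mono[OF K(2)[OF that] norm_ge_zero[of c]] by (simp add: nrm_scale mult.assoc)
  then have "\<exists>K. \<forall>x\<in>ell2 I. nrm I (\<lambda>i. c * A x i) \<le> K * nrm I x" by blast
  then show ?thesis using assms unfolding bounded_op_def
    by (simp add: fun_eq_iff algebra_simps ell2_scale)
qed

lemma bounded_op_zero: "bounded_op I 0"
  unfolding bounded_op_def by (auto simp: zero_fun_def nrm_def intro!: exI[of _ 0])

lemma bounded_op_idop: "bounded_op I (idop I)"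
  unfolding bounded_op_def idop_def by (auto intro: exI[of _ 1])

lemma bounded_op_diff:
  assumes "bounded_op I A" "bounded_op I B" shows "bounded_op I (A - B)"
proof -
  have "A - B = A + (\<lambda>x i. (-1) * B x i)" by (auto simp: fun_eq_iff)
  then show ?thesis using bounded_op_plus[OF assms(1) bounded_op_scaled[OF assms(2), of "-1"]] by (simp only:)
qed

lemma bounded_op_sum_ops:
  "(\<And>k. k \<in> K \<Longrightarrow> bounded_op I (f k)) \<Longrightarrow> bounded_op I (\<Sum>k\<in>K. f k)"
  by (induction K rule: infinite_finite_induct) (auto intro: bounded_op_plus bounded_op_zero)

lemma bounded_op_norm_limit:
  assumes A: "bounded_op I A" and "\<And>k. f k \<in> ell2 I" "x \<in> ell2 I" "((\<lambda>k. nrm I (x - f k)) \<longlongrightarrow> 0) \<FF>"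
  shows "((\<lambda>k. nrm I (A x - A (f k))) \<longlongrightarrow> 0) \<FF>"
proof -
  obtain K where K: "K \<ge> 0" "\<And>x. x \<in> ell2 I \<Longrightarrow> nrm I (A x) \<le> K * nrm I x"
    using bounded_op_bound[OF A] by auto
  show ?thesis
  proof (rule Lim_null_comparison)
    show "\<forall>\<^sub>F k in \<FF>. norm (nrm I (A x - A (f k))) \<le> K * nrm I (x - f k)"
      using K(2)[of "x - f _"] assms by (intro always_eventually allI) (simp add: bounded_op_minus[symmetric] ell2_minus)
    show "((\<lambda>k. K * nrm I (x - f k)) \<longlongrightarrow> 0) \<FF>" using tendsto_mult_right_zero[OF assms(4)] .
  qed
qed

section \<open>Forms of bounded operators as limits of finite compressions\<close>

lemma ip_trunc_tendsto:
  assumes "bounded_op I A" "x \<in> ell2 I" "y \<in> ell2 I"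
  shows "((\<lambda>F. ip I y (A (trunc F x))) \<longlongrightarrow> ip I y (A x)) (finite_subsets_at_top I)"
  by (rule norm_limit_imp_ip_limit[OF _ _ assms(3) bounded_op_norm_limit[OF assms(1) _ assms(2) trunc_tendsto]])
    (use assms in auto)

text \<open>The vectors \<open>A (trunc F x)\<close> stay bounded in norm while
  \<open>y - trunc F y\<close> tends to 0, so truncating both arguments has the same limit as
  truncating one. This is how bounds on finite matrices reach the whole operator.\<close>

lemma ip_trunc_trunc_tendsto:
  assumes A: "bounded_op I A" and x: "x \<in> ell2 I" and y: "y \<in> ell2 I"
  shows "((\<lambda>F. ip I (trunc F y) (A (trunc F x))) \<longlongrightarrow> ip I y (A x)) (finite_subsets_at_top I)"
proof -
  obtain K where K: "K \<ge> 0" "\<And>x. x \<in> ell2 I \<Longrightarrow> nrm I (A x) \<le> K * nrm I x"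
    using bounded_op_bound[OF A] by auto
  have "((\<lambda>F. ip I (y - trunc F y) (A (trunc F x))) \<longlongrightarrow> 0) (finite_subsets_at_top I)"
  proof (rule Lim_null_comparison)
    show "\<forall>\<^sub>F F in finite_subsets_at_top I. norm (ip I (y - trunc F y) (A (trunc F x))) \<le> nrm I (y - trunc F y) * (K * nrm I x)"
    proof (intro always_eventually allI)
      fix F
      have "nrm I (A (trunc F x)) \<le> K * nrm I x"
        using K(2)[of "trunc F x"] mult_left_mono[OF nrm_trunc_le[OF x, of F] K(1)] x by simp
      then show "norm (ip I (y - trunc F y) (A (trunc F x))) \<le> nrm I (y - trunc F y) * (K * nrm I x)"
        using ip_bound[of "y - trunc F y" I "A (trunc F x)"] x y A
          mult_left_mono[of _ _ "nrm I (y - trunc F y)"]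
        by (smt (verit) bounded_op_ell2 ell2_minus nrm_nonneg trunc_ell2)
    qed
    show "((\<lambda>F. nrm I (y - trunc F y) * (K * nrm I x)) \<longlongrightarrow> 0) (finite_subsets_at_top I)"
      using tendsto_mult_left_zero[OF trunc_tendsto[OF y]] .
  qed
  from tendsto_diff[OF ip_trunc_tendsto[OF A x y] this]
  show ?thesis using x y A by (simp add: ip_minus_left)
qed

lemma trunc_finite_ell2: "finite F \<Longrightarrow> F \<subseteq> I \<Longrightarrow> trunc F x \<in> ell2 I"
  by (auto simp: trunc_eq_sum intro!: ell2_sum ell2_scale)

lemma ip_trunc_left: "finite F \<Longrightarrow> F \<subseteq> I \<Longrightarrow> ip I (trunc F y) x = (\<Sum>i\<in>F. cnj (y i) * x i)"
  unfolding ip_def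
  by (rule infsumI, rule has_sum_finite_neutralI) (auto simp: trunc_def intro!: sum.cong)

lemma ip_trunc_right: "finite F \<Longrightarrow> F \<subseteq> I \<Longrightarrow> ip I y (trunc F x) = (\<Sum>i\<in>F. cnj (y i) * x i)"
  unfolding ip_def
  by (rule infsumI, rule has_sum_finite_neutralI) (auto simp: trunc_def intro!: sum.cong)

lemma nrm_trunc: "finite F \<Longrightarrow> F \<subseteq> I \<Longrightarrow> (nrm I (trunc F x))\<^sup>2 = (\<Sum>i\<in>F. (cmod (x i))\<^sup>2)"
  unfolding nrm_sq
  by (rule infsumI, rule has_sum_finite_neutralI) (auto simp: trunc_def intro!: sum.cong)

lemma bounded_op_trunc:
  assumes "bounded_op I A" "finite F" "F \<subseteq> I"
  shows "A (trunc F x) = (\<Sum>i\<in>F. (\<lambda>j. x i * A (ket i) j))"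
proof -
  have "A (trunc F x) = (\<Sum>i\<in>F. A (\<lambda>j. x i * ket i j))"
    unfolding trunc_eq_sum[OF assms(2)] using assms by (intro bounded_op_sum ell2_scale) auto
  also have "\<dots> = (\<Sum>i\<in>F. (\<lambda>j. x i * A (ket i) j))"
    using assms by (intro sum.cong bounded_op_scale) auto
  finally show ?thesis .
qed

lemma ip_bounded_op_trunc:
  assumes "bounded_op I A" "finite F" "F \<subseteq> I" "y \<in> ell2 I"
  shows "ip I y (A (trunc F x)) = (\<Sum>i\<in>F. x i * ip I y (A (ket i)))"
proof -
  have "ip I y (A (trunc F x)) = (\<Sum>i\<in>F. ip I y (\<lambda>j. x i * A (ket i) j))"
    unfolding bounded_op_trunc[OF assms(1-3)] using assms by (intro ip_sum_right ell2_scale) auto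
  then show ?thesis by (simp only: ip_scale_right)
qed

section \<open>Adjoints\<close>

lemma adj_apply: "x \<in> ell2 I \<Longrightarrow> i \<in> I \<Longrightarrow> adj I A x i = ip I (A (ket i)) x"
  by (simp add: adj_def)

text \<open>\<open>adj\<close> is given coordinate by coordinate, so square-summability of its
  values has to be proved. Pairing \<open>x\<close> with the image of a truncation of
  \<open>?z\<close> reproduces the squared norm of that truncation; Cauchy-Schwarz and cancellation
  of one factor bound it by \<open>K * nrm I x\<close>.\<close>

lemma adj_ell2_bound:
  assumes A: "bounded_op I A" and K: "K \<ge> 0" "\<And>x. x \<in> ell2 I \<Longrightarrow> nrm I (A x) \<le> K * nrm I x"
    and x: "x \<in> ell2 I"
  shows "adj I A x \<in> ell2 I" and "nrm I (adj I A x) \<le> K * nrm I x"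
proof -
  let ?z = "adj I A x"
  have *: "(\<Sum>i\<in>F. (cmod (?z i))\<^sup>2) \<le> (K * nrm I x)\<^sup>2" if F: "finite F" "F \<subseteq> I" for F
  proof -
    let ?s = "\<Sum>i\<in>F. (cmod (?z i))\<^sup>2"
    have t: "trunc F ?z \<in> ell2 I" by (rule trunc_finite_ell2[OF F])
    have "ip I x (A (trunc F ?z)) = (\<Sum>i\<in>F. ?z i * ip I x (A (ket i)))"
      by (rule ip_bounded_op_trunc[OF A F x])
    also have "\<dots> = (\<Sum>i\<in>F. of_real ((cmod (?z i))\<^sup>2))"
    proof (rule sum.cong)
      fix i assume "i \<in> F"
      then have "ip I x (A (ket i)) = cnj (?z i)" using F x by (auto simp: adj_apply ip_cnj)
      then show "?z i * ip I x (A (ket i)) = of_real ((cmod (?z i))\<^sup>2)"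
        by (simp only: complex_norm_square)
    qed simp
    finally have eq: "ip I x (A (trunc F ?z)) = of_real ?s" by (simp only: of_real_sum)
    have "?s = cmod (ip I x (A (trunc F ?z)))" unfolding eq norm_of_real by (simp add: sum_nonneg)
    also have "\<dots> \<le> nrm I x * nrm I (A (trunc F ?z))" using A x by (intro ip_bound) auto
    also have "\<dots> \<le> nrm I x * (K * nrm I (trunc F ?z))" using K(2)[OF t] by (intro mult_left_mono) auto
    finally have le: "?s \<le> (K * nrm I x) * nrm I (trunc F ?z)" by (simp add: mult.commute mult.left_commute)
    have s: "?s = (nrm I (trunc F ?z))\<^sup>2" by (simp add: nrm_trunc[OF F])
    have "nrm I (trunc F ?z) \<le> K * nrm I x"
    proof (cases "nrm I (trunc F ?z) = 0")
      case False
      then have "0 < nrm I (trunc F ?z)" using nrm_nonneg[of I "trunc F ?z"] by linarith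
      have "nrm I (trunc F ?z) * nrm I (trunc F ?z) \<le> (K * nrm I x) * nrm I (trunc F ?z)"
        using le s power2_eq_square[of "nrm I (trunc F ?z)"] by linarith
      then show ?thesis using \<open>0 < nrm I (trunc F ?z)\<close> by (rule mult_right_le_imp_le)
    qed (use K in simp)
    then show ?thesis unfolding s by (intro power_mono) auto
  qed
  have out: "?z i = 0" if "i \<notin> I" for i using that by (simp add: adj_def)
  show "?z \<in> ell2 I" by (rule ell2_boundI(1)[OF out *])
  have "(nrm I ?z)\<^sup>2 \<le> (K * nrm I x)\<^sup>2" by (rule ell2_boundI(2)[OF out *])
  then show "nrm I ?z \<le> K * nrm I x" by (rule power2_le_imp_le) (use K in simp)
qed

lemma bounded_op_adj:
  assumes A: "bounded_op I A" shows "bounded_op I (adj I A)"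
proof -
  obtain K where K: "K \<ge> 0" "\<And>x. x \<in> ell2 I \<Longrightarrow> nrm I (A x) \<le> K * nrm I x"
    using bounded_op_bound[OF A] by auto
  note b = adj_ell2_bound[OF A K]
  show ?thesis
    unfolding bounded_op_def
  proof (intro conjI ballI allI impI)
    fix x y assume xy: "x \<in> ell2 I" "y \<in> ell2 I"
    then have "adj I A (x + y) i = adj I A x i + adj I A y i" for i
      using A ell2_add[OF xy] by (cases "i \<in> I") (simp_all add: adj_def ip_add_right del: plus_fun_apply)
    then show "adj I A (x + y) = adj I A x + adj I A y" by auto
  next
    fix c x assume "x \<in> ell2 I"
    then show "adj I A (\<lambda>i. c * x i) = (\<lambda>i. c * adj I A x i)"
      using A by (auto simp: adj_def fun_eq_iff ip_scale_right ell2_scale)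
  qed (use b in \<open>auto simp: adj_def fun_eq_iff\<close>)
qed

text \<open>For truncated \<open>y\<close> the identity is linearity and the definition of
  \<open>adj\<close>; both sides converge as the truncation grows.\<close>

lemma ip_adj_left:
  assumes A: "bounded_op I A" and x: "x \<in> ell2 I" and y: "y \<in> ell2 I"
  shows "ip I (adj I A x) y = ip I x (A y)"
proof -
  have "((\<lambda>F. \<Sum>i\<in>F. cnj (adj I A x i) * y i) \<longlongrightarrow> ip I (adj I A x) y) (finite_subsets_at_top I)"
    using ip_has_sum[OF bounded_op_ell2[OF bounded_op_adj[OF A]] y] unfolding has_sum_def .
  moreover have "\<forall>\<^sub>F F in finite_subsets_at_top I. (\<Sum>i\<in>F. cnj (adj I A x i) * y i) = ip I x (A (trunc F y))"
  proof (rule eventually_finite_subsets_at_top_weakI)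
    fix F assume F: "finite F" "F \<subseteq> I"
    have "cnj (adj I A x i) * y i = y i * ip I x (A (ket i))" if "i \<in> F" for i
      using that F x by (subst adj_apply) (auto simp: ip_cnj)
    then show "(\<Sum>i\<in>F. cnj (adj I A x i) * y i) = ip I x (A (trunc F y))"
      unfolding ip_bounded_op_trunc[OF A F x] by (rule sum.cong[OF refl])
  qed
  ultimately have "((\<lambda>F. ip I x (A (trunc F y))) \<longlongrightarrow> ip I (adj I A x) y) (finite_subsets_at_top I)"
    by (rule Lim_transform_eventually)
  from tendsto_unique[OF finite_subsets_at_top_neq_bot this ip_trunc_tendsto[OF A y x]]
  show ?thesis .
qed

lemma ip_adj_right:
  assumes A: "bounded_op I A" and x: "x \<in> ell2 I" and y: "y \<in> ell2 I"
  shows "ip I x (adj I A y) = ip I (A x) y"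
  using arg_cong[OF ip_adj_left[OF A y x], where f = cnj] by (simp add: ip_cnj)

section \<open>Cholesky decomposition of positive semidefinite matrices\<close>

text \<open>Nonnegativity at all complex coefficient vectors includes that the form is real, which
  forces the matrix to be Hermitian; symmetry is derived, not assumed.\<close>

definition psd_kernel :: "'i set \<Rightarrow> ('i \<Rightarrow> 'i \<Rightarrow> complex) \<Rightarrow> bool" where
  "psd_kernel F K \<longleftrightarrow> (\<forall>c. (\<Sum>i\<in>F. \<Sum>j\<in>F. cnj (c i) * K i j * c j) \<in> \<real>\<^sub>\<ge>\<^sub>0)"

text \<open>Induction on the index set: with pivot \<open>d = K a a\<close>, the vector of
  \<open>a\<close> is the column of \<open>a\<close> divided by the square root of \<open>d\<close>,
  and the Schur complement \<open>K'\<close> is again positive semidefinite on \<open>F\<close>. A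
  zero pivot is possible; then the column of \<open>a\<close> vanishes.\<close>

lemma psd_kernel_cholesky:
  assumes "finite F" "psd_kernel F K"
  shows "\<exists>v. \<forall>i\<in>F. \<forall>j\<in>F. K i j = (\<Sum>k\<in>F. v k i * cnj (v k j))"
  using assms
proof (induction F arbitrary: K rule: finite_induct)
  case (insert a F)
  define Q where "Q K c = (\<Sum>i\<in>F. \<Sum>j\<in>F. cnj (c i) * K i j * c j)" for K and c :: "'a \<Rightarrow> complex"
  define d where "d = K a a"
  have expand: "(\<Sum>i\<in>insert a F. \<Sum>j\<in>insert a F. cnj (c i) * K i j * c j) =
      cnj (c a) * d * c a + cnj (c a) * (\<Sum>j\<in>F. K a j * c j) + (\<Sum>i\<in>F. cnj (c i) * K i a) * c a + Q K c" for c
    using insert by (simp add: Q_def d_def sum.distrib sum_distrib_left sum_distrib_right algebra_simps)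
  have nonneg: "cnj (c a) * d * c a + cnj (c a) * (\<Sum>j\<in>F. K a j * c j) + (\<Sum>i\<in>F. cnj (c i) * K i a) * c a + Q K c \<in> \<real>\<^sub>\<ge>\<^sub>0" for c
    using insert(4) unfolding psd_kernel_def expand[symmetric] by blast
  \<comment> \<open>The form at the vector with entry \<open>s\<close> at \<open>a\<close>,
    \<open>t\<close> at \<open>i\<close> and 0 elsewhere; these values are enough for Hermitian
    symmetry and for the case of a zero pivot.\<close>
  have two: "cnj s * d * s + cnj s * K a i * t + cnj t * K i a * s + cnj t * K i i * t \<in> \<real>\<^sub>\<ge>\<^sub>0" if "i \<in> F" for i s t
  proof -
    define c where "c = (\<lambda>j. if j = a then s else if j = i then t else 0)"
    have ai: "a \<noteq> i" "finite F" "a \<notin> F" using insert that by auto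
    have cF: "c j = (if j = i then t else 0)" if "j \<in> F" for j using that ai by (auto simp: c_def)
    have "(\<Sum>j\<in>F. K a j * c j) = (\<Sum>j\<in>F. if j = i then K a i * t else 0)"
      by (rule sum.cong) (auto simp: cF)
    moreover have "(\<Sum>j\<in>F. cnj (c j) * K j a) = (\<Sum>j\<in>F. if j = i then cnj t * K i a else 0)"
      by (rule sum.cong) (auto simp: cF)
    moreover have "Q K c = (\<Sum>j\<in>F. if j = i then cnj t * K i i * t else 0)"
      unfolding Q_def
    proof (rule sum.cong[OF refl])
      fix j assume j: "j \<in> F"
      have "(\<Sum>l\<in>F. cnj (c j) * K j l * c l) = (\<Sum>l\<in>F. if l = i then cnj (c j) * K j i * t else 0)"
        by (rule sum.cong) (auto simp: cF)
      then show "(\<Sum>l\<in>F. cnj (c j) * K j l * c l) = (if j = i then cnj t * K i i * t else 0)"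
        using ai that j by (auto simp: cF)
    qed
    ultimately show ?thesis using nonneg[of c] ai that by (simp add: c_def algebra_simps)
  qed
  have d: "d \<in> \<real>\<^sub>\<ge>\<^sub>0"
    using nonneg[of "\<lambda>j. if j = a then 1 else 0"] insert by (auto simp: Q_def sum.neutral if_distrib cong: if_cong)
  have dr: "d = of_real (Re d)" and dpos: "Re d \<ge> 0" using d by (auto elim!: nonneg_Reals_cases)
  \<comment> \<open>Polarisation: the form is real at \<open>(1, 1)\<close> and at
    \<open>(\<i>, 1)\<close>, which gives the imaginary and the real part of the claim.\<close>
  have herm: "K i a = cnj (K a i)" if i: "i \<in> F" for i
  proof -
    have ii: "Im (K i i) = 0" using two[OF i, of 0 1] by (auto elim!: nonneg_Reals_cases)
    have "Im (K a i + K i a) = 0"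
      using two[OF i, of 1 1] ii by (subst (asm) dr) (auto elim!: nonneg_Reals_cases simp: complex_eq_iff)
    moreover have "Im (\<i> * K i a - \<i> * K a i) = 0"
      using two[OF i, of \<i> 1] ii by (subst (asm) dr) (auto elim!: nonneg_Reals_cases simp: complex_eq_iff)
    ultimately show ?thesis by (simp add: complex_eq_iff)
  qed
  \<comment> \<open>The Schur complement of the pivot. If \<open>d = 0\<close>, division by zero
    gives 0 and \<open>K'\<close> is \<open>K\<close> itself.\<close>
  define K' where "K' i j = K i j - K i a * K a j / d" for i j
  have "psd_kernel F K'"
  proof (cases "d = 0")
    case True
    then have "K' = K" by (intro ext) (simp add: K'_def)
    moreover have "Q K c \<in> \<real>\<^sub>\<ge>\<^sub>0" for c
    proof -
      have "Q K c = Q K (c(a := 0))" unfolding Q_def using insert by (intro sum.cong) auto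
      then show ?thesis using nonneg[of "c(a := 0)"] by simp
    qed
    ultimately show ?thesis by (simp add: psd_kernel_def Q_def)
  next
    case False
    show ?thesis unfolding psd_kernel_def
    proof
      fix c :: "'a \<Rightarrow> complex"
      define r where "r = (\<Sum>j\<in>F. K a j * c j)"
      define l where "l = (\<Sum>i\<in>F. cnj (c i) * K i a)"
      \<comment> \<open>Completing the square: the coefficient \<open>- r / d\<close> at
        \<open>a\<close> makes the form of \<open>K\<close> at \<open>c'\<close> equal to that of
        \<open>K'\<close> at \<open>c\<close>.\<close>
      define c' where "c' = c(a := - r / d)"
      have eqs: "(\<Sum>j\<in>F. K a j * c' j) = r" "(\<Sum>i\<in>F. cnj (c' i) * K i a) = l" "Q K c' = Q K c"
        unfolding r_def l_def Q_def using insert by (auto simp: c'_def intro!: sum.cong)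
      have "(\<Sum>i\<in>F. \<Sum>j\<in>F. cnj (c i) * K' i j * c j) = Q K c - l * r / d"
      proof -
        have "l * r / d = (\<Sum>i\<in>F. \<Sum>j\<in>F. (cnj (c i) * K i a) * (K a j * c j) / d)"
          unfolding l_def r_def by (simp only: sum_product sum_divide_distrib)
        then show ?thesis
          unfolding Q_def K'_def
          by (simp add: sum_subtractf[symmetric] left_diff_distrib right_diff_distrib mult.assoc)
      qed
      also have "\<dots> = cnj (c' a) * d * c' a + cnj (c' a) * r + l * c' a + Q K c"
        using False by (simp add: c'_def field_simps)
      finally show "(\<Sum>i\<in>F. \<Sum>j\<in>F. cnj (c i) * K' i j * c j) \<in> \<real>\<^sub>\<ge>\<^sub>0"
        using nonneg[of c'] unfolding eqs by simp
    qed
  qed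
  then obtain v where v: "\<And>i j. i \<in> F \<Longrightarrow> j \<in> F \<Longrightarrow> K' i j = (\<Sum>k\<in>F. v k i * cnj (v k j))"
    using insert.IH by blast
  have zero: "K i a = 0" if "d = 0" "i \<in> F" for i
  proof (rule ccontr)
    assume "K i a \<noteq> 0"
    define m where "m = (cmod (K i a))\<^sup>2"
    have m: "m > 0" "complex_of_real m = K i a * cnj (K i a)"
      using \<open>K i a \<noteq> 0\<close> by (auto simp: m_def complex_norm_square[symmetric])
    \<comment> \<open>Scaled so that \<open>K i a * s\<close> is minus
      \<open>Re (K i i) + 1\<close>; the form at \<open>(s, 1)\<close> then has real part
      \<open>- Re (K i i) - 2\<close>, which is negative.\<close>
    define s where "s = - (of_real ((Re (K i i) + 1) / m)) * cnj (K i a)"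
    have "cnj s * K a i + K i a * s + K i i \<in> \<real>\<^sub>\<ge>\<^sub>0"
      using two[OF that(2), of s 1] that by simp
    moreover have "K i a * s = - of_real ((Re (K i i) + 1))"
    proof -
      have "K i a * s = - (of_real ((Re (K i i) + 1) / m) * (K i a * cnj (K i a)))"
        unfolding s_def by (simp only: mult_ac mult_minus_left mult_minus_right)
      also have "\<dots> = - of_real ((Re (K i i) + 1) / m * m)"
        by (simp only: m(2)[symmetric] of_real_mult)
      finally show ?thesis using m(1) by simp
    qed
    moreover have "cnj s * K a i = cnj (K i a * s)"
      using herm[OF that(2)] by (simp add: mult.commute)
    ultimately have "- 2 * (Re (K i i) + 1) + Re (K i i) \<ge> 0"
      by (auto elim!: nonneg_Reals_cases simp: complex_eq_iff)
    moreover have "Re (K i i) \<ge> 0" using two[OF that(2), of 0 1] by (auto elim!: nonneg_Reals_cases)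
    ultimately show False by (simp add: algebra_simps)
  qed
  \<comment> \<open>The vectors for \<open>F\<close> get entry 0 at \<open>a\<close>, so that row
    and column of \<open>a\<close> come from the pivot vector alone. For \<open>d = 0\<close>
    division by zero makes the pivot vector 0.\<close>
  define w where "w k i = (if k = a then K i a / of_real (sqrt (Re d)) else if i = a then 0 else v k i)" for k i
  have wa: "w a i * cnj (w a j) = K i a * cnj (K j a) / d" for i j
  proof -
    have "complex_of_real (sqrt (Re d)) * complex_of_real (sqrt (Re d)) = d"
      using dr dpos by (metis of_real_mult real_sqrt_mult_self abs_of_nonneg)
    then show ?thesis by (simp add: w_def)
  qed
  show ?case
  proof (intro exI[of _ w] ballI)
    fix i j assume ij: "i \<in> insert a F" "j \<in> insert a F"
    have daa: "cnj d = d" using dr by (metis complex_cnj_complex_of_real)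
    have "(\<Sum>k\<in>F. w k i * cnj (w k j)) = (if i = a \<or> j = a then 0 else K' i j)"
    proof (cases "i = a \<or> j = a")
      case True
      then show ?thesis using insert by (intro trans[OF sum.neutral]) (auto simp: w_def)
    next
      case False
      then have "(\<Sum>k\<in>F. w k i * cnj (w k j)) = (\<Sum>k\<in>F. v k i * cnj (v k j))"
        using insert by (intro sum.cong) (auto simp: w_def)
      then show ?thesis using False ij v by auto
    qed
    then have "(\<Sum>k\<in>insert a F. w k i * cnj (w k j)) =
        K i a * cnj (K j a) / d + (if i = a \<or> j = a then 0 else K' i j)"
      using insert by (simp add: wa)
    also have "\<dots> = K i j"
    proof (cases "d = 0")
      case True
      have za: "K b a = 0" if "b \<in> insert a F" for b
        using that zero[OF True] True unfolding d_def by blast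
      then have "K a b = 0" if "b \<in> insert a F" for b
        using that herm[of b] by (cases "b = a") (auto simp: complex_eq_iff)
      then show ?thesis unfolding K'_def using True ij za by auto
    next
      case False
      have "cnj (K j a) = K a j"
      proof (cases "j = a")
        case True
        then show ?thesis using daa by (simp only: d_def)
      next
        case False
        then show ?thesis using ij herm[of j] by simp
      qed
      moreover have "K i a * K a j / d = K i j" if "i = a \<or> j = a"
        using that False by (auto simp: d_def)
      ultimately show ?thesis using ij by (simp add: K'_def)
    qed
    finally show "K i j = (\<Sum>k\<in>insert a F. w k i * cnj (w k j))" ..
  qed
qed simp

lemma positive_bounded: "positive I A \<Longrightarrow> bounded_op I A"
  and positive_ip: "positive I A \<Longrightarrow> x \<in> ell2 I \<Longrightarrow> ip I x (A x) \<in> \<real>\<^sub>\<ge>\<^sub>0"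
  by (auto simp: positive_def)

lemma positive_diag: "positive I A \<Longrightarrow> i \<in> I \<Longrightarrow> A (ket i) i \<in> \<real>\<^sub>\<ge>\<^sub>0"
  using positive_ip[of I A "ket i"] by (simp add: ip_ket_left)

text \<open>The matrix of \<open>\<rho>\<close> on \<open>H\<close> has a Cholesky factorisation,
  whose vectors are extended by zero outside \<open>H\<close>; hence no truncation is left on the
  right-hand side. On the diagonal the factorisation yields the trace of the compression as a sum of
  squared norms. These rank one pieces take the place of an eigenvector expansion.\<close>

lemma positive_finite_rank_decomposition:
  assumes \<rho>: "positive I \<rho>" and H: "finite H" "H \<subseteq> I"
  shows "\<exists>v. (\<forall>k. v k \<in> ell2 I) \<and>
    (\<forall>x\<in>ell2 I. \<forall>y\<in>ell2 I.
       ip I (trunc H y) (\<rho> (trunc H x)) = (\<Sum>k\<in>H. ip I y (v k) * ip I (v k) x)) \<and>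
    (\<Sum>k\<in>H. (nrm I (v k))\<^sup>2) = (\<Sum>h\<in>H. Re (\<rho> (ket h) h))"
proof -
  note b = positive_bounded[OF \<rho>]
  define K where "K i j = \<rho> (ket j) i" for i j
  have form: "ip I (trunc H y) (\<rho> (trunc H x)) = (\<Sum>i\<in>H. \<Sum>j\<in>H. cnj (y i) * K i j * x j)" for x y
  proof -
    have "ip I (trunc H y) (\<rho> (trunc H x)) = (\<Sum>j\<in>H. x j * ip I (trunc H y) (\<rho> (ket j)))"
      by (rule ip_bounded_op_trunc[OF b H trunc_finite_ell2[OF H]])
    also have "\<dots> = (\<Sum>j\<in>H. \<Sum>i\<in>H. cnj (y i) * K i j * x j)"
      by (simp add: ip_trunc_left[OF H] K_def sum_distrib_left mult_ac)
    also have "\<dots> = (\<Sum>i\<in>H. \<Sum>j\<in>H. cnj (y i) * K i j * x j)" by (rule sum.swap)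
    finally show ?thesis .
  qed
  have "psd_kernel H K" unfolding psd_kernel_def
  proof
    fix c show "(\<Sum>i\<in>H. \<Sum>j\<in>H. cnj (c i) * K i j * c j) \<in> \<real>\<^sub>\<ge>\<^sub>0"
      using positive_ip[OF \<rho> trunc_finite_ell2[OF H], of c] by (simp only: form)
  qed
  from psd_kernel_cholesky[OF H(1) this] obtain u
    where u: "\<And>i j. i \<in> H \<Longrightarrow> j \<in> H \<Longrightarrow> K i j = (\<Sum>k\<in>H. u k i * cnj (u k j))" by blast
  show ?thesis
  proof (intro exI[of _ "\<lambda>k. trunc H (u k)"] conjI allI ballI)
    show "trunc H (u k) \<in> ell2 I" for k by (rule trunc_finite_ell2[OF H])
    fix x y
    have "(\<Sum>i\<in>H. \<Sum>j\<in>H. cnj (y i) * K i j * x j) = (\<Sum>i\<in>H. \<Sum>j\<in>H. \<Sum>k\<in>H. (cnj (y i) * u k i) * (cnj (u k j) * x j))"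
      by (intro sum.cong refl) (simp add: u sum_distrib_left sum_distrib_right mult_ac)
    also have "\<dots> = (\<Sum>i\<in>H. \<Sum>k\<in>H. \<Sum>j\<in>H. (cnj (y i) * u k i) * (cnj (u k j) * x j))"
      by (intro sum.cong refl sum.swap)
    also have "\<dots> = (\<Sum>k\<in>H. \<Sum>i\<in>H. \<Sum>j\<in>H. (cnj (y i) * u k i) * (cnj (u k j) * x j))"
      by (rule sum.swap)
    also have "\<dots> = (\<Sum>k\<in>H. ip I y (trunc H (u k)) * ip I (trunc H (u k)) x)"
      by (simp add: ip_trunc_left[OF H] ip_trunc_right[OF H] sum_product)
    finally show "ip I (trunc H y) (\<rho> (trunc H x)) = (\<Sum>k\<in>H. ip I y (trunc H (u k)) * ip I (trunc H (u k)) x)"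
      unfolding form .
  next
    have "(\<Sum>k\<in>H. (nrm I (trunc H (u k)))\<^sup>2) = (\<Sum>k\<in>H. \<Sum>i\<in>H. (cmod (u k i))\<^sup>2)"
      by (simp add: nrm_trunc[OF H])
    also have "\<dots> = (\<Sum>i\<in>H. \<Sum>k\<in>H. (cmod (u k i))\<^sup>2)" by (rule sum.swap)
    also have "\<dots> = (\<Sum>i\<in>H. Re (\<rho> (ket i) i))"
    proof (rule sum.cong[OF refl])
      fix i assume i: "i \<in> H"
      have "\<rho> (ket i) i = of_real (\<Sum>k\<in>H. (cmod (u k i))\<^sup>2)"
        using u[OF i i] by (simp only: K_def complex_norm_square[symmetric] of_real_sum)
      then show "(\<Sum>k\<in>H. (cmod (u k i))\<^sup>2) = Re (\<rho> (ket i) i)" by (simp only: Re_complex_of_real)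
    qed
    finally show "(\<Sum>k\<in>H. (nrm I (trunc H (u k)))\<^sup>2) = (\<Sum>h\<in>H. Re (\<rho> (ket h) h))" .
  qed
qed

section \<open>Positive trace class operators\<close>

abbreviation rtr :: "'i set \<Rightarrow> 'i oper \<Rightarrow> real" where
  "rtr I A \<equiv> Re (tr I A)"

lemma has_sum_finite_sum:
  fixes f :: "'k \<Rightarrow> 'i \<Rightarrow> 'a::topological_comm_monoid_add"
  shows "(\<And>k. k \<in> K \<Longrightarrow> (f k has_sum s k) I) \<Longrightarrow> ((\<lambda>i. \<Sum>k\<in>K. f k i) has_sum (\<Sum>k\<in>K. s k)) I"
  by (induction K rule: infinite_finite_induct) (auto intro: has_sum_add)

lemma tendsto_nonneg_Reals:
  assumes "\<FF> \<noteq> bot" "(f \<longlongrightarrow> l) \<FF>" "\<forall>\<^sub>F k in \<FF>. f k \<in> \<real>\<^sub>\<ge>\<^sub>0" shows "l \<in> (\<real>\<^sub>\<ge>\<^sub>0 :: complex set)"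
  using Lim_in_closed_set[OF closed_nonneg_Reals_complex assms(3,1,2)] .

lemma pos_tc_positive: "\<rho> \<in> pos_tc I \<Longrightarrow> positive I \<rho>"
  by (simp add: pos_tc_def)

lemma pos_tc_bounded: "\<rho> \<in> pos_tc I \<Longrightarrow> bounded_op I \<rho>"
  by (simp add: pos_tc_def positive_def)

lemma pos_tc_trace_has_sum:
  assumes "\<rho> \<in> pos_tc I" shows "((\<lambda>i. Re (\<rho> (ket i) i)) has_sum rtr I \<rho>) I"
proof -
  have "((\<lambda>i. ip I (ket i) (\<rho> (ket i))) has_sum tr I \<rho>) I"
    using assms by (simp add: pos_tc_def tr_def)
  then have "((\<lambda>i. Re (ip I (ket i) (\<rho> (ket i)))) has_sum rtr I \<rho>) I" by (rule has_sum_Re)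
  then show ?thesis by (rule has_sum_cong[THEN iffD1, rotated]) (simp add: ip_ket_left)
qed

lemma pos_tc_diag_nonneg: "\<rho> \<in> pos_tc I \<Longrightarrow> i \<in> I \<Longrightarrow> 0 \<le> Re (\<rho> (ket i) i)"
  using positive_diag[of I \<rho> i] by (simp add: pos_tc_def complex_nonneg_Reals_iff)

lemma rtr_nonneg: "\<rho> \<in> pos_tc I \<Longrightarrow> 0 \<le> rtr I \<rho>"
  by (rule has_sum_nonneg[OF pos_tc_trace_has_sum[of \<rho> I]]) (auto intro: pos_tc_diag_nonneg)

lemma finite_diag_le_rtr:
  assumes "\<rho> \<in> pos_tc I" "finite F" "F \<subseteq> I" shows "(\<Sum>i\<in>F. Re (\<rho> (ket i) i)) \<le> rtr I \<rho>"
  using pos_tc_diag_nonneg[OF assms(1)] assms(3)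
  by (intro finite_sum_le_has_sum[OF pos_tc_trace_has_sum[OF assms(1)] assms(2,3)]) auto

text \<open>The diagonal of a positive operator consists of nonnegative reals, so bounding finite
  partial sums of real parts gives the complex summability demanded by \<open>pos_tc\<close> as well
  as the bound on the trace.\<close>

lemma pos_tcI:
  assumes \<rho>: "positive I \<rho>" and le: "\<And>F. finite F \<Longrightarrow> F \<subseteq> I \<Longrightarrow> (\<Sum>i\<in>F. Re (\<rho> (ket i) i)) \<le> C"
  shows "\<rho> \<in> pos_tc I" and "rtr I \<rho> \<le> C"
proof -
  have "(\<lambda>i. Re (\<rho> (ket i) i)) summable_on I"
    using positive_diag[OF \<rho>] le
    by (intro nonneg_bdd_above_summable_on) (auto simp: complex_nonneg_Reals_iff intro!: bdd_aboveI[of _ C])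
  then have "(\<lambda>i. complex_of_real (Re (\<rho> (ket i) i))) summable_on I"
    by (rule summable_on_of_real)
  moreover have "complex_of_real (Re (\<rho> (ket i) i)) = ip I (ket i) (\<rho> (ket i))" if "i \<in> I" for i
    using positive_diag[OF \<rho> that] unfolding ip_ket_left[OF that] by (auto elim!: nonneg_Reals_cases)
  ultimately have "(\<lambda>i. ip I (ket i) (\<rho> (ket i))) summable_on I"
    using summable_on_cong[of I "\<lambda>i. complex_of_real (Re (\<rho> (ket i) i))" "\<lambda>i. ip I (ket i) (\<rho> (ket i))"] by blast
  then show mem: "\<rho> \<in> pos_tc I" using \<rho> by (simp add: pos_tc_def)
  show "rtr I \<rho> \<le> C"
    by (rule has_sum_le_finite_sums[OF pos_tc_trace_has_sum[OF mem] le])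
qed

text \<open>For one rank one piece, \<open>cmod (ip I y v * ip I v x)\<close> is at most
  \<open>(nrm I v)\<^sup>2 * (nrm I y * nrm I x)\<close>; summing over the Cholesky vectors of a
  compression gives its trace as the constant, and the compressions converge. This is the bound of
  the operator norm by the trace.\<close>

lemma pos_tc_ip_bound:
  assumes \<rho>: "\<rho> \<in> pos_tc I" and x: "x \<in> ell2 I" and y: "y \<in> ell2 I"
  shows "cmod (ip I y (\<rho> x)) \<le> rtr I \<rho> * (nrm I y * nrm I x)"
proof -
  have lim: "((\<lambda>F. cmod (ip I (trunc F y) (\<rho> (trunc F x)))) \<longlongrightarrow> cmod (ip I y (\<rho> x))) (finite_subsets_at_top I)"
    by (rule tendsto_norm, rule ip_trunc_trunc_tendsto[OF pos_tc_bounded[OF \<rho>] x y])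
  have "\<forall>\<^sub>F F in finite_subsets_at_top I. norm (ip I (trunc F y) (\<rho> (trunc F x))) \<le> rtr I \<rho> * (nrm I y * nrm I x)"
  proof (rule eventually_finite_subsets_at_top_weakI)
    fix F assume F: "finite F" "F \<subseteq> I"
    obtain v where v: "\<forall>k. v k \<in> ell2 I"
      and form: "\<forall>x\<in>ell2 I. \<forall>y\<in>ell2 I.
           ip I (trunc F y) (\<rho> (trunc F x)) = (\<Sum>k\<in>F. ip I y (v k) * ip I (v k) x)"
      and tr: "(\<Sum>k\<in>F. (nrm I (v k))\<^sup>2) = (\<Sum>h\<in>F. Re (\<rho> (ket h) h))"
      using positive_finite_rank_decomposition[OF pos_tc_positive[OF \<rho>] F] by blast
    have "cmod (\<Sum>k\<in>F. ip I y (v k) * ip I (v k) x) \<le> (\<Sum>k\<in>F. (nrm I (v k))\<^sup>2 * (nrm I y * nrm I x))"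
    proof (rule sum_norm_le)
      fix k assume "k \<in> F"
      have "cmod (ip I y (v k)) * cmod (ip I (v k) x) \<le> (nrm I y * nrm I (v k)) * (nrm I (v k) * nrm I x)"
        using ip_bound[OF y v[rule_format]] ip_bound[OF v[rule_format] x] by (intro mult_mono) auto
      then show "norm (ip I y (v k) * ip I (v k) x) \<le> (nrm I (v k))\<^sup>2 * (nrm I y * nrm I x)"
        by (simp add: norm_mult power2_eq_square mult_ac)
    qed
    also have "\<dots> = (\<Sum>h\<in>F. Re (\<rho> (ket h) h)) * (nrm I y * nrm I x)"
      by (simp only: sum_distrib_right[symmetric] tr)
    also have "\<dots> \<le> rtr I \<rho> * (nrm I y * nrm I x)"
      using finite_diag_le_rtr[OF \<rho> F] by (intro mult_right_mono) auto
    finally show "norm (ip I (trunc F y) (\<rho> (trunc F x))) \<le> rtr I \<rho> * (nrm I y * nrm I x)"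
      by (simp only: form[rule_format, OF x y])
  qed
  then show ?thesis by (rule tendsto_upperbound[OF lim]) simp
qed

lemma nrm_le_if_ip_le:
  assumes x: "x \<in> ell2 I" and "0 \<le> C" and le: "cmod (ip I x x) \<le> C * nrm I x"
  shows "nrm I x \<le> C"
proof (cases "nrm I x = 0")
  case False
  then have pos: "0 < nrm I x" using nrm_nonneg[of I x] by linarith
  have "nrm I x * nrm I x \<le> C * nrm I x"
    using le by (simp add: ip_self[OF x] power2_eq_square norm_mult)
  then show ?thesis using pos by (rule mult_right_le_imp_le)
qed (use assms in simp)

lemma pos_tc_nrm_bound:
  assumes \<rho>: "\<rho> \<in> pos_tc I" and x: "x \<in> ell2 I"
  shows "nrm I (\<rho> x) \<le> rtr I \<rho> * nrm I x"
proof (rule nrm_le_if_ip_le)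
  show r: "\<rho> x \<in> ell2 I" using pos_tc_bounded[OF \<rho>] by (rule bounded_op_ell2)
  show "cmod (ip I (\<rho> x) (\<rho> x)) \<le> rtr I \<rho> * nrm I x * nrm I (\<rho> x)"
    using pos_tc_ip_bound[OF \<rho> x r] by (simp add: mult_ac)
qed (use rtr_nonneg[OF \<rho>] in simp)

lemma pos_tc_rtr_0:
  assumes \<rho>: "\<rho> \<in> pos_tc I" and "rtr I \<rho> = 0" shows "\<rho> = 0"
proof
  fix x
  show "\<rho> x = 0 x"
  proof (cases "x \<in> ell2 I")
    case True
    have "nrm I (\<rho> x) = 0" using pos_tc_nrm_bound[OF \<rho> True] assms(2) nrm_nonneg[of I "\<rho> x"] by simp
    then show ?thesis
      using nrm_eq_0_imp[OF bounded_op_ell2[OF pos_tc_bounded[OF \<rho>]]] by simp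
  qed (use bounded_op_outside[OF pos_tc_bounded[OF \<rho>]] in simp)
qed

section \<open>Sums and differences in the Loewner order, and their traces\<close>

lemma positive_zero: "positive I 0"
  by (auto simp: positive_def bounded_op_zero)

lemma positive_add:
  assumes "positive I A" "positive I B" shows "positive I (A + B)"
proof -
  have "ip I x ((A + B) x) = ip I x (A x) + ip I x (B x)" if "x \<in> ell2 I" for x
    unfolding plus_fun_apply[of A]
    by (rule ip_add_right[OF that bounded_op_ell2 bounded_op_ell2]) (use assms in \<open>auto simp: positive_def\<close>)
  then show ?thesis using assms by (simp add: positive_def bounded_op_plus)
qed

lemma positive_scale:
  assumes "positive I A" "0 \<le> c" shows "positive I (\<lambda>x i. of_real c * A x i)"
  using assms by (simp add: positive_def bounded_op_scaled ip_scale_right)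

lemma pos_tc_0: "0 \<in> pos_tc I" "rtr I 0 = 0"
  by (auto simp: pos_tc_def positive_zero tr_def)

lemma pos_tc_add:
  assumes "A \<in> pos_tc I" "B \<in> pos_tc I"
  shows "A + B \<in> pos_tc I" and "rtr I (A + B) = rtr I A + rtr I B"
proof -
  have hs: "((\<lambda>i. Re ((A + B) (ket i) i)) has_sum rtr I A + rtr I B) I"
    using has_sum_add[OF pos_tc_trace_has_sum[OF assms(1)] pos_tc_trace_has_sum[OF assms(2)]] by simp
  have "(\<Sum>i\<in>F. Re ((A + B) (ket i) i)) \<le> rtr I A + rtr I B" if "finite F" "F \<subseteq> I" for F
    using finite_diag_le_rtr[OF assms(1) that] finite_diag_le_rtr[OF assms(2) that]
    by (simp add: sum.distrib)
  from pos_tcI(1)[OF positive_add[OF assms[THEN pos_tc_positive]] this]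
  show "A + B \<in> pos_tc I" by blast
  from has_sum_unique[OF pos_tc_trace_has_sum[OF this] hs]
  show "rtr I (A + B) = rtr I A + rtr I B" .
qed

lemma pos_tc_scale:
  assumes "A \<in> pos_tc I" "0 \<le> c"
  shows "(\<lambda>x i. of_real c * A x i) \<in> pos_tc I" and "rtr I (\<lambda>x i. of_real c * A x i) = c * rtr I A"
proof -
  let ?B = "\<lambda>x i. of_real c * A x i"
  have "(\<Sum>i\<in>F. Re (?B (ket i) i)) \<le> c * rtr I A" if "finite F" "F \<subseteq> I" for F
    using mult_left_mono[OF finite_diag_le_rtr[OF assms(1) that] assms(2)]
    by (simp add: sum_distrib_left)
  from pos_tcI(1)[OF positive_scale[OF pos_tc_positive[OF assms(1)] assms(2)] this]
  show B: "?B \<in> pos_tc I" by blast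
  have "((\<lambda>i. Re (?B (ket i) i)) has_sum c * rtr I A) I"
    using has_sum_cmult_right[OF pos_tc_trace_has_sum[OF assms(1)], of c] by simp
  from has_sum_unique[OF pos_tc_trace_has_sum[OF B] this]
  show "rtr I ?B = c * rtr I A" .
qed

lemma pos_tc_sum:
  assumes "\<And>k. k \<in> K \<Longrightarrow> f k \<in> pos_tc I"
  shows "(\<Sum>k\<in>K. f k) \<in> pos_tc I \<and> rtr I (\<Sum>k\<in>K. f k) = (\<Sum>k\<in>K. rtr I (f k))"
  using assms
proof (induction K rule: infinite_finite_induct)
  case (insert k K)
  then have "f k \<in> pos_tc I" "sum f K \<in> pos_tc I" "rtr I (sum f K) = (\<Sum>k\<in>K. rtr I (f k))" by auto
  note k = this
  have "sum f (insert k K) = f k + sum f K" by (rule sum.insert[OF insert(1,2)])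
  moreover have "(\<Sum>k\<in>insert k K. rtr I (f k)) = rtr I (f k) + (\<Sum>k\<in>K. rtr I (f k))"
    by (rule sum.insert[OF insert(1,2)])
  ultimately show ?case using pos_tc_add[OF k(1,2)] by (simp only: k(3))
qed (auto simp: pos_tc_0)

lemma pos_tc_diff:
  assumes A: "A \<in> pos_tc I" and B: "B \<in> pos_tc I" and le: "lowner I A B"
  shows "B - A \<in> pos_tc I" and "rtr I (B - A) = rtr I B - rtr I A"
proof -
  have pos: "positive I (B - A)" using le by (simp add: lowner_def)
  have "(\<Sum>i\<in>F. Re ((B - A) (ket i) i)) \<le> rtr I B" if F: "finite F" "F \<subseteq> I" for F
  proof -
    have "(\<Sum>i\<in>F. Re ((B - A) (ket i) i)) \<le> (\<Sum>i\<in>F. Re (B (ket i) i))"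
      using pos_tc_diag_nonneg[OF A] F by (intro sum_mono) auto
    also have "\<dots> \<le> rtr I B" by (rule finite_diag_le_rtr[OF B F])
    finally show ?thesis .
  qed
  from pos_tcI(1)[OF pos this] show D: "B - A \<in> pos_tc I" by blast
  have "B = A + (B - A)" by simp
  then show "rtr I (B - A) = rtr I B - rtr I A"
    using pos_tc_add(2)[OF A D] by simp
qed

lemma lowner_rtr_mono: "A \<in> pos_tc I \<Longrightarrow> B \<in> pos_tc I \<Longrightarrow> lowner I A B \<Longrightarrow> rtr I A \<le> rtr I B"
  using pos_tc_diff[of A I B] rtr_nonneg[of "B - A" I] by simp

text \<open>The difference is positive and has trace 0, hence vanishes. Both the uniqueness of
  suprema and the fixed point equation are obtained this way.\<close>

lemma lowner_rtr_eq:
  assumes "A \<in> pos_tc I" "B \<in> pos_tc I" "lowner I A B" "rtr I B \<le> rtr I A" shows "A = B"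
  using pos_tc_rtr_0[OF pos_tc_diff(1)[OF assms(1-3)]] pos_tc_diff(2)[OF assms(1-3)]
    lowner_rtr_mono[OF assms(1-3)] assms(4) by simp

lemma lowner_refl: "lowner I A A"
  by (simp add: lowner_def positive_zero)

lemma lowner_trans: "lowner I A B \<Longrightarrow> lowner I B C \<Longrightarrow> lowner I A C"
  using positive_add[of I "B - A" "C - B"] by (simp add: lowner_def)

lemma lowner_0_left: "positive I A \<Longrightarrow> lowner I 0 A"
  by (simp add: lowner_def)

section \<open>Weak limits of positive operators\<close>

text \<open>A bound on the traces bounds the norms, so coordinatewise convergence is weak
  convergence and positivity passes to the limit. Of the trace only an upper bound survives, since
  it is tested on finite parts of the diagonal. The filter is arbitrary because both finite partial
  sums and sequences occur.\<close>

lemma pos_tc_weak_limit: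
  assumes nt: "\<FF> \<noteq> bot"
    and f: "\<forall>\<^sub>F k in \<FF>. f k \<in> pos_tc I \<and> rtr I (f k) \<le> C"
    and lim: "\<And>x i. x \<in> ell2 I \<Longrightarrow> i \<in> I \<Longrightarrow> ((\<lambda>k. f k x i) \<longlongrightarrow> T x i) \<FF>"
    and out: "\<And>x i. x \<notin> ell2 I \<or> i \<notin> I \<Longrightarrow> T x i = 0"
  shows "T \<in> pos_tc I" and "rtr I T \<le> C"
    and "x \<in> ell2 I \<Longrightarrow> y \<in> ell2 I \<Longrightarrow> ((\<lambda>k. ip I y (f k x)) \<longlongrightarrow> ip I y (T x)) \<FF>"
proof -
  have bd: "\<forall>\<^sub>F k in \<FF>. f k x \<in> ell2 I \<and> nrm I (f k x) \<le> C * nrm I x" if x: "x \<in> ell2 I" for x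
    using f
  proof eventually_elim
    case (elim k)
    then have "rtr I (f k) * nrm I x \<le> C * nrm I x" by (intro mult_right_mono) auto
    then show ?case
      using pos_tc_nrm_bound[of "f k" I, OF _ x] elim bounded_op_ell2[OF pos_tc_bounded[of "f k" I]] by auto
  qed
  note cl = coordinatewise_limit[OF nt out bd lim]
  have Tx: "T x \<in> ell2 I" and Tn: "nrm I (T x) \<le> C * nrm I x" if "x \<in> ell2 I" for x
    using cl(1,2)[of x] that by auto
  show ipl: "((\<lambda>k. ip I y (f k x)) \<longlongrightarrow> ip I y (T x)) \<FF>" if "x \<in> ell2 I" "y \<in> ell2 I" for x y
    using cl(3)[of x] that by auto
  have b: "bounded_op I T" unfolding bounded_op_def
  proof (intro conjI ballI allI impI)
    fix x y assume xy: "x \<in> ell2 I" "y \<in> ell2 I"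
    show "T (x + y) = T x + T y"
    proof
      fix i
      show "T (x + y) i = (T x + T y) i"
      proof (cases "i \<in> I")
        case True
        have "((\<lambda>k. f k (x + y) i) \<longlongrightarrow> T x i + T y i) \<FF>"
        proof (rule Lim_transform_eventually[OF tendsto_add[OF lim[OF xy(1) True] lim[OF xy(2) True]]])
          show "\<forall>\<^sub>F k in \<FF>. f k x i + f k y i = f k (x + y) i"
            using f by eventually_elim (simp add: bounded_op_add[OF pos_tc_bounded xy])
        qed
        from tendsto_unique[OF nt lim[OF ell2_add[OF xy] True] this] show ?thesis by simp
      qed (simp add: out)
    qed
  next
    fix c x assume x: "x \<in> ell2 I"
    show "T (\<lambda>i. c * x i) = (\<lambda>i. c * T x i)"
    proof
      fix i
      show "T (\<lambda>i. c * x i) i = c * T x i"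
      proof (cases "i \<in> I")
        case True
        have "((\<lambda>k. f k (\<lambda>i. c * x i) i) \<longlongrightarrow> c * T x i) \<FF>"
        proof (rule Lim_transform_eventually[OF tendsto_mult_left[OF lim[OF x True]]])
          show "\<forall>\<^sub>F k in \<FF>. c * f k x i = f k (\<lambda>i. c * x i) i"
            using f by eventually_elim (simp add: bounded_op_scale[OF pos_tc_bounded x])
        qed
        from tendsto_unique[OF nt lim[OF ell2_scale[OF x] True] this] show ?thesis by simp
      qed (simp add: out)
    qed
  qed (use Tx Tn out in \<open>auto simp: fun_eq_iff\<close>)
  have pos: "positive I T" unfolding positive_def
  proof (intro conjI ballI b)
    fix x assume x: "x \<in> ell2 I"
    show "ip I x (T x) \<in> \<real>\<^sub>\<ge>\<^sub>0"
      by (rule tendsto_nonneg_Reals[OF nt ipl[OF x x]])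
        (use f in \<open>eventually_elim, auto intro: positive_ip pos_tc_positive x\<close>)
  qed
  have le: "(\<Sum>i\<in>F. Re (T (ket i) i)) \<le> C" if F: "finite F" "F \<subseteq> I" for F
  proof (rule tendsto_upperbound[OF _ _ nt])
    show "((\<lambda>k. \<Sum>i\<in>F. Re (f k (ket i) i)) \<longlongrightarrow> (\<Sum>i\<in>F. Re (T (ket i) i))) \<FF>"
      using F by (intro tendsto_sum tendsto_Re lim) auto
    show "\<forall>\<^sub>F k in \<FF>. (\<Sum>i\<in>F. Re (f k (ket i) i)) \<le> C"
      using f by eventually_elim (use finite_diag_le_rtr[OF _ F] in force)
  qed
  show "T \<in> pos_tc I" "rtr I T \<le> C" using pos_tcI[OF pos le] by auto
qed

section \<open>The trace under conjugation\<close>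

lemma positive_conjugate:
  assumes "positive I \<rho>" and A: "bounded_op I A" shows "positive I (A \<circ> \<rho> \<circ> adj I A)"
proof -
  have b: "bounded_op I \<rho>" using assms by (simp add: positive_def)
  have "ip I x (A (\<rho> (adj I A x))) = ip I (adj I A x) (\<rho> (adj I A x))" if "x \<in> ell2 I" for x
    using ip_adj_left[OF A that bounded_op_ell2[OF b]] by simp
  then show ?thesis
    using assms bounded_op_adj[OF A] b by (auto simp: positive_def intro!: bounded_op_comp)
qed

text \<open>If \<open>\<rho>\<close> is the rank one operator given by \<open>v\<close>, the trace
  after conjugation by \<open>A m\<close> is \<open>(nrm I (A m v))\<^sup>2\<close>, and the claim
  is \<open>contr\<close> at \<open>v\<close>. The general case is the sum over the Cholesky vectors
  of a compression of \<open>\<rho>\<close>, followed by a limit. The family is treated at once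
  because a bound for each \<open>A m\<close> separately would not bound the sum.\<close>

lemma conjugate_trace_le:
  assumes G: "finite G" and A: "\<And>m. m \<in> G \<Longrightarrow> bounded_op I (A m)"
    and contr: "\<And>x. x \<in> ell2 I \<Longrightarrow> (\<Sum>m\<in>G. (nrm I (A m x))\<^sup>2) \<le> (nrm I x)\<^sup>2"
    and \<rho>: "\<rho> \<in> pos_tc I"
  shows "m \<in> G \<Longrightarrow> A m \<circ> \<rho> \<circ> adj I (A m) \<in> pos_tc I"
    and "(\<Sum>m\<in>G. rtr I (A m \<circ> \<rho> \<circ> adj I (A m))) \<le> rtr I \<rho>"
proof -
  let ?B = "\<lambda>m. A m \<circ> \<rho> \<circ> adj I (A m)"
  note b = pos_tc_bounded[OF \<rho>]
  have main: "(\<Sum>m\<in>G. \<Sum>i\<in>F. Re (?B m (ket i) i)) \<le> rtr I \<rho>" if F: "finite F" "F \<subseteq> I" for F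
  proof -
    \<comment> \<open>With \<open>a m i\<close> the image of a basis vector under the adjoint, a
      diagonal entry of the conjugated operator becomes a value of the form of
      \<open>\<rho>\<close>, to which compression applies.\<close>
    define a where "a m i = adj I (A m) (ket i)" for m i
    have a: "a m i \<in> ell2 I" if "m \<in> G" for m i
      unfolding a_def using bounded_op_adj[OF A[OF that]] by (rule bounded_op_ell2)
    have eq: "Re (?B m (ket i) i) = Re (ip I (a m i) (\<rho> (a m i)))" if "m \<in> G" "i \<in> F" for m i
    proof -
      have i: "i \<in> I" using that F by auto
      have "?B m (ket i) i = ip I (ket i) (A m (\<rho> (a m i)))" by (simp add: ip_ket_left i a_def)
      also have "\<dots> = ip I (a m i) (\<rho> (a m i))"
        unfolding a_def using ip_adj_left[OF A[OF that(1)] ket_ell2[OF i] bounded_op_ell2[OF b]] by simp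
      finally show ?thesis by simp
    qed
    \<comment> \<open>Two finite sets play different roles: \<open>F\<close> selects the part of the
      trace to be bounded and stays fixed, while the set \<open>H\<close> to which
      \<open>\<rho>\<close> is compressed grows in the limit.\<close>
    have "((\<lambda>H. \<Sum>m\<in>G. \<Sum>i\<in>F. Re (ip I (trunc H (a m i)) (\<rho> (trunc H (a m i)))))
        \<longlongrightarrow> (\<Sum>m\<in>G. \<Sum>i\<in>F. Re (ip I (a m i) (\<rho> (a m i))))) (finite_subsets_at_top I)"
      by (intro tendsto_sum tendsto_Re ip_trunc_trunc_tendsto b a)
    moreover have "\<forall>\<^sub>F H in finite_subsets_at_top I.
       (\<Sum>m\<in>G. \<Sum>i\<in>F. Re (ip I (trunc H (a m i)) (\<rho> (trunc H (a m i))))) \<le> rtr I \<rho>"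
    proof (rule eventually_finite_subsets_at_top_weakI)
      fix H assume H: "finite H" "H \<subseteq> I"
      obtain v where v: "\<forall>k. v k \<in> ell2 I"
        and form: "\<forall>x\<in>ell2 I. \<forall>y\<in>ell2 I.
             ip I (trunc H y) (\<rho> (trunc H x)) = (\<Sum>k\<in>H. ip I y (v k) * ip I (v k) x)"
        and tr: "(\<Sum>k\<in>H. (nrm I (v k))\<^sup>2) = (\<Sum>h\<in>H. Re (\<rho> (ket h) h))"
        using positive_finite_rank_decomposition[OF pos_tc_positive[OF \<rho>] H] by blast
      have "Re (ip I (trunc H (a m i)) (\<rho> (trunc H (a m i)))) = (\<Sum>k\<in>H. (cmod (A m (v k) i))\<^sup>2)"
        if mi: "m \<in> G" "i \<in> F" for m i
      proof -
        have i: "i \<in> I" using mi F by auto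
        have "ip I (a m i) (v k) * ip I (v k) (a m i) = of_real ((cmod (A m (v k) i))\<^sup>2)" for k
        proof -
          have "ip I (a m i) (v k) = A m (v k) i"
            unfolding a_def ip_adj_left[OF A[OF mi(1)] ket_ell2[OF i] v[rule_format]] by (rule ip_ket_left[OF i])
          moreover from this have "ip I (v k) (a m i) = cnj (A m (v k) i)"
            using ip_cnj[of I "a m i" "v k"] by simp
          ultimately show ?thesis by (simp only: complex_norm_square)
        qed
        then show ?thesis unfolding form[rule_format, OF a[OF mi(1)] a[OF mi(1)]]
          by (simp only: of_real_sum[symmetric] Re_complex_of_real)
      qed
      then have "(\<Sum>m\<in>G. \<Sum>i\<in>F. Re (ip I (trunc H (a m i)) (\<rho> (trunc H (a m i))))) =
          (\<Sum>m\<in>G. \<Sum>i\<in>F. \<Sum>k\<in>H. (cmod (A m (v k) i))\<^sup>2)"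
        by (simp cong: sum.cong)
      also have "\<dots> = (\<Sum>m\<in>G. \<Sum>k\<in>H. \<Sum>i\<in>F. (cmod (A m (v k) i))\<^sup>2)"
        by (intro sum.cong refl sum.swap)
      also have "\<dots> \<le> (\<Sum>m\<in>G. \<Sum>k\<in>H. (nrm I (A m (v k)))\<^sup>2)"
        by (intro sum_mono sum_le_nrm bounded_op_ell2 A F)
      also have "\<dots> = (\<Sum>k\<in>H. \<Sum>m\<in>G. (nrm I (A m (v k)))\<^sup>2)" by (rule sum.swap)
      also have "\<dots> \<le> (\<Sum>k\<in>H. (nrm I (v k))\<^sup>2)" by (intro sum_mono contr v[rule_format])
      also have "\<dots> \<le> rtr I \<rho>" unfolding tr by (rule finite_diag_le_rtr[OF \<rho> H])
      finally show "(\<Sum>m\<in>G. \<Sum>i\<in>F. Re (ip I (trunc H (a m i)) (\<rho> (trunc H (a m i))))) \<le> rtr I \<rho>" .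
    qed
    ultimately have "(\<Sum>m\<in>G. \<Sum>i\<in>F. Re (ip I (a m i) (\<rho> (a m i)))) \<le> rtr I \<rho>"
      by (rule tendsto_upperbound) simp
    then show ?thesis by (simp only: eq cong: sum.cong)
  qed
  have pos: "positive I (?B m)" if "m \<in> G" for m
    by (rule positive_conjugate[OF pos_tc_positive[OF \<rho>] A[OF that]])
  show B: "?B m \<in> pos_tc I" if m: "m \<in> G" for m
  proof (rule pos_tcI(1)[OF pos[OF m]])
    fix F assume F: "finite F" "F \<subseteq> I"
    have "(\<Sum>i\<in>F. Re (?B m (ket i) i)) \<le> (\<Sum>m\<in>G. \<Sum>i\<in>F. Re (?B m (ket i) i))"
    proof (rule member_le_sum[OF m _ G])
      fix l assume "l \<in> G - {m}"
      then show "0 \<le> (\<Sum>i\<in>F. Re (?B l (ket i) i))"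
        using positive_diag[OF pos] F by (intro sum_nonneg) (auto simp: complex_nonneg_Reals_iff)
    qed
    with main[OF F] show "(\<Sum>i\<in>F. Re (?B m (ket i) i)) \<le> rtr I \<rho>" by linarith
  qed
  have "((\<lambda>i. \<Sum>m\<in>G. Re (?B m (ket i) i)) has_sum (\<Sum>m\<in>G. rtr I (?B m))) I"
    by (rule has_sum_finite_sum[OF pos_tc_trace_has_sum[OF B]])
  then show "(\<Sum>m\<in>G. rtr I (?B m)) \<le> rtr I \<rho>"
  proof (rule has_sum_le_finite_sums)
    fix F assume F: "finite F" "F \<subseteq> I"
    show "(\<Sum>i\<in>F. \<Sum>m\<in>G. Re (?B m (ket i) i)) \<le> rtr I \<rho>"
      using main[OF F] by (subst sum.swap)
  qed
qed

section \<open>Trace class operators as combinations of four positive ones\<close>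

definition tc_comb :: "(nat \<Rightarrow> 'i oper) \<Rightarrow> 'i oper" where
  "tc_comb A = (\<lambda>x i. \<Sum>k<4. \<i> ^ k * A k x i)"

lemma trace_class_iff: "T \<in> trace_class I \<longleftrightarrow> (\<exists>A. (\<forall>k<4. A k \<in> pos_tc I) \<and> T = tc_comb A)"
  by (simp add: trace_class_def tc_comb_def)

lemma sum_less4: "(\<Sum>k<4. f k) = f 0 + f 1 + f 2 + f (3::nat)"
  by (simp add: eval_nat_numeral add.assoc)

lemma pos_tc_trace_class: "\<rho> \<in> pos_tc I \<Longrightarrow> \<rho> \<in> trace_class I"
  unfolding trace_class_iff
  by (intro exI[of _ "\<lambda>k. if k = 0 then \<rho> else 0"]) (auto simp: pos_tc_0 tc_comb_def sum_less4)

lemma trace_class_add: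
  assumes "T \<in> trace_class I" "T' \<in> trace_class I" shows "T + T' \<in> trace_class I"
proof -
  obtain A A' where A: "\<forall>k<4. A k \<in> pos_tc I" "T = tc_comb A" "\<forall>k<4. A' k \<in> pos_tc I" "T' = tc_comb A'"
    using assms unfolding trace_class_iff by blast
  have "T + T' = tc_comb (\<lambda>k. A k + A' k)"
    unfolding A(2,4) by (simp add: tc_comb_def fun_eq_iff sum.distrib distrib_left)
  moreover have "\<forall>k<4. A k + A' k \<in> pos_tc I"
    using A(1,3) pos_tc_add(1)[of "A k" I "A' k" for k] by blast
  ultimately show ?thesis unfolding trace_class_iff by (intro exI[of _ "\<lambda>k. A k + A' k"] conjI)
qed

text \<open>The four parts carry the coefficients \<open>1\<close>, \<open>\<i>\<close>,
  \<open>-1\<close>, \<open>-\<i>\<close>: nonnegative reals scale each part, and multiplication by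
  \<open>\<i>\<close> permutes the parts cyclically. Every scalar is reached from these two
  operations and addition.\<close>

lemma trace_class_scale:
  assumes "T \<in> trace_class I" shows "(\<lambda>x i. c * T x i) \<in> trace_class I"
proof -
  have re: "(\<lambda>x i. of_real r * T x i) \<in> trace_class I" if "T \<in> trace_class I" "0 \<le> r" for r T
  proof -
    obtain A where A: "\<forall>k<4. A k \<in> pos_tc I" "T = tc_comb A"
      using \<open>T \<in> trace_class I\<close> unfolding trace_class_iff by blast
    have "(\<lambda>x i. of_real r * T x i) = tc_comb (\<lambda>k x i. of_real r * A k x i)"
      unfolding A(2) by (auto simp: tc_comb_def fun_eq_iff sum_distrib_left mult_ac)
    then show ?thesis unfolding trace_class_iff
      using A(1) pos_tc_scale(1)[OF _ \<open>0 \<le> r\<close>] by (intro exI[of _ "\<lambda>k x i. of_real r * A k x i"]) auto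
  qed
  have im: "(\<lambda>x i. \<i> * T x i) \<in> trace_class I" if "T \<in> trace_class I" for T
  proof -
    obtain A where A: "\<forall>k<4. A k \<in> pos_tc I" "T = tc_comb A"
      using \<open>T \<in> trace_class I\<close> unfolding trace_class_iff by blast
    have "(\<lambda>x i. \<i> * T x i) = tc_comb (\<lambda>k. if k = 0 then A 3 else A (k - 1))"
      unfolding A(2) by (auto simp: tc_comb_def fun_eq_iff sum_less4 algebra_simps power2_eq_square power3_eq_cube)
    then show ?thesis unfolding trace_class_iff
      using A(1) by (intro exI[of _ "\<lambda>k. if k = 0 then A 3 else A (k - 1)"]) auto
  qed
  have neg: "(\<lambda>x i. - T x i) \<in> trace_class I" if "T \<in> trace_class I" for T
    using im[OF im[OF that]] by (simp add: mult.assoc[symmetric])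
  have real: "(\<lambda>x i. of_real r * T x i) \<in> trace_class I" if "T \<in> trace_class I" for r T
  proof (cases "0 \<le> r")
    case False
    then show ?thesis using re[OF neg[OF that], of "-r"] by simp
  qed (use re that in blast)
  have "(\<lambda>x i. of_real (Re c) * T x i) + (\<lambda>x i. of_real (Im c) * (\<i> * T x i)) \<in> trace_class I"
    by (intro trace_class_add real im assms)
  also have "(\<lambda>x i. of_real (Re c) * T x i) + (\<lambda>x i. of_real (Im c) * (\<i> * T x i)) = (\<lambda>x i. c * T x i)"
    by (auto simp: fun_eq_iff complex_eq_iff algebra_simps)
  finally show ?thesis .
qed

lemma trace_class_bounded:
  assumes "T \<in> trace_class I" shows "bounded_op I T"
proof -
  obtain A where A: "\<forall>k<4. A k \<in> pos_tc I" "T = tc_comb A"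
    using assms unfolding trace_class_iff by blast
  have T: "T = (\<Sum>k<4. (\<lambda>x i. \<i> ^ k * A k x i))"
    unfolding A(2) tc_comb_def by (auto simp: fun_eq_iff sum_apply)
  show ?thesis
    unfolding T using A(1) by (intro bounded_op_sum_ops bounded_op_scaled pos_tc_bounded) auto
qed

text \<open>A decomposition into four parts need not reflect positivity, so finite trace is taken
  from the parts and positivity from the quadratic form.\<close>

lemma trace_class_positive:
  assumes T: "T \<in> trace_class I" and pos: "\<And>x. x \<in> ell2 I \<Longrightarrow> ip I x (T x) \<in> \<real>\<^sub>\<ge>\<^sub>0"
  shows "T \<in> pos_tc I"
proof -
  obtain A where A: "\<forall>k<4. A k \<in> pos_tc I" "T = tc_comb A"
    using assms unfolding trace_class_iff by blast
  have "(\<lambda>i. A k (ket i) i) summable_on I" if "k < 4" for k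
    using A(1) that by (auto simp: pos_tc_def ip_ket_left cong: summable_on_cong)
  then have "(\<lambda>i. \<Sum>k<4. \<i> ^ k * A k (ket i) i) summable_on I"
    unfolding sum_less4 by (intro summable_on_add summable_on_cmult_right) auto
  then have "(\<lambda>i. ip I (ket i) (T (ket i))) summable_on I"
    unfolding A(2) tc_comb_def by (simp add: ip_ket_left cong: summable_on_cong)
  then show ?thesis
    using trace_class_bounded[OF T] pos by (simp add: pos_tc_def positive_def)
qed

section \<open>Quantum operations\<close>

lemma qop_trace_class:
    "quantum_operation I E \<Longrightarrow> T \<in> trace_class I \<Longrightarrow> E T \<in> trace_class I"
  and qop_add:
    "quantum_operation I E \<Longrightarrow> T \<in> trace_class I \<Longrightarrow> T' \<in> trace_class I \<Longrightarrow> E (T + T') = E T + E T'"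
  and qop_scale:
    "quantum_operation I E \<Longrightarrow> T \<in> trace_class I \<Longrightarrow> E (\<lambda>x i. c * T x i) = (\<lambda>x i. c * E T x i)"
  and qop_cp:
    "quantum_operation I E \<Longrightarrow> completely_positive I E"
  and qop_rtr:
    "quantum_operation I E \<Longrightarrow> \<rho> \<in> pos_tc I \<Longrightarrow> rtr I (E \<rho>) \<le> rtr I \<rho>"
  by (auto simp: quantum_operation_def)

lemma completely_positiveD:
  "completely_positive I E \<Longrightarrow> \<forall>i<n. \<forall>j<n. T i j \<in> trace_class I \<Longrightarrow> block_positive I n T \<Longrightarrow>
     block_positive I n (\<lambda>i j. E (T i j))"
  unfolding completely_positive_def by blast

lemma block_positiveD:
  "block_positive I n T \<Longrightarrow> (\<And>i. i < n \<Longrightarrow> y i \<in> ell2 I) \<Longrightarrow>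
     (\<Sum>i<n. \<Sum>j<n. ip I (y i) (T i j (y j))) \<in> \<real>\<^sub>\<ge>\<^sub>0"
  unfolding block_positive_def by blast

lemma qop_pos:
  assumes E: "quantum_operation I E" and \<rho>: "\<rho> \<in> pos_tc I" shows "E \<rho> \<in> pos_tc I"
proof (rule trace_class_positive)
  show "E \<rho> \<in> trace_class I"
    using qop_trace_class[OF E pos_tc_trace_class[OF \<rho>]] .
  fix x assume x: "x \<in> ell2 I"
  \<comment> \<open>Positivity is the case of one by one blocks.\<close>
  have "block_positive I 1 (\<lambda>i j. \<rho>)"
    using \<rho> by (simp add: block_positive_def positive_ip pos_tc_positive)
  then have "block_positive I 1 (\<lambda>i j. E \<rho>)"
    using completely_positiveD[OF qop_cp[OF E], of 1 "\<lambda>i j. \<rho>"]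
      pos_tc_trace_class[OF \<rho>] by blast
  from block_positiveD[OF this, of "\<lambda>_. x"] x
  show "ip I x (E \<rho> x) \<in> \<real>\<^sub>\<ge>\<^sub>0" by simp
qed

lemma trace_class_0: "0 \<in> trace_class I"
  by (rule pos_tc_trace_class[OF pos_tc_0(1)])

lemma trace_class_sum:
  "(\<And>k. k \<in> K \<Longrightarrow> f k \<in> trace_class I) \<Longrightarrow> (\<Sum>k\<in>K. f k) \<in> trace_class I"
  by (induction K rule: infinite_finite_induct) (auto intro: trace_class_add trace_class_0)

lemma trace_class_diff:
  assumes "A \<in> trace_class I" "B \<in> trace_class I" shows "A - B \<in> trace_class I"
proof -
  have "A - B = A + (\<lambda>x i. (-1) * B x i)" by (auto simp: fun_eq_iff)
  then show ?thesis using trace_class_add[OF assms(1) trace_class_scale[OF assms(2), of "-1"]] by (simp only:)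
qed

lemma qop_0: "quantum_operation I E \<Longrightarrow> E 0 = 0"
  using qop_scale[OF _ trace_class_0, of I E 0] by (simp add: zero_fun_def)

lemma qop_diff:
  assumes "quantum_operation I E" "A \<in> trace_class I" "B \<in> trace_class I"
  shows "E (A - B) = E A - E B"
proof -
  have "E ((A - B) + B) = E (A - B) + E B"
    by (rule qop_add[OF assms(1) trace_class_diff[OF assms(2,3)] assms(3)])
  moreover have "(A - B) + B = A" by simp
  ultimately show ?thesis by (simp only: eq_diff_eq)
qed

lemma qop_sum:
  assumes E: "quantum_operation I E" and f: "\<And>k. k \<in> K \<Longrightarrow> f k \<in> trace_class I"
  shows "E (\<Sum>k\<in>K. f k) = (\<Sum>k\<in>K. E (f k))"
  using f
proof (induction K rule: infinite_finite_induct)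
  case (insert k K)
  have "f k \<in> trace_class I" "sum f K \<in> trace_class I" using insert(4) by (auto intro: trace_class_sum)
  from qop_add[OF E this]
  show ?case
    using sum.insert[OF insert(1,2), of f] sum.insert[OF insert(1,2), of "\<lambda>k. E (f k)"] insert.IH insert(4)
    by (simp only:) simp
qed (use qop_0[OF E] in auto)

lemma tc_comb_sum: "tc_comb A = (\<Sum>k<4. (\<lambda>x i. \<i> ^ k * A k x i))"
  by (auto simp: tc_comb_def fun_eq_iff sum_apply)

text \<open>By linearity a quantum operation is determined on the trace class by its values on
  positive operators; limits and sums are computed there and then combined.\<close>

lemma qop_tc_comb:
  assumes E: "quantum_operation I E" and A: "\<forall>k<4. A k \<in> pos_tc I"
  shows "E (tc_comb A) = tc_comb (\<lambda>k. E (A k))"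
proof -
  have "E (\<Sum>k<4. (\<lambda>x i. \<i> ^ k * A k x i)) = (\<Sum>k<4. E (\<lambda>x i. \<i> ^ k * A k x i))"
    by (rule qop_sum[OF E trace_class_scale[OF pos_tc_trace_class]]) (use A in auto)
  also have "\<dots> = (\<Sum>k<4. (\<lambda>x i. \<i> ^ k * E (A k) x i))"
    by (rule sum.cong[OF refl qop_scale[OF E pos_tc_trace_class]]) (use A in auto)
  finally show ?thesis by (simp only: tc_comb_sum)
qed

lemma qop_mono:
  assumes E: "quantum_operation I E" and "A \<in> pos_tc I" "B \<in> pos_tc I" "lowner I A B"
  shows "lowner I (E A) (E B)"
proof -
  have "E (B - A) \<in> pos_tc I" by (rule qop_pos[OF E pos_tc_diff(1)[OF assms(2-4)]])
  then show ?thesis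
    unfolding lowner_def qop_diff[OF E pos_tc_trace_class[OF assms(3)] pos_tc_trace_class[OF assms(2)]]
    by (rule pos_tc_positive)
qed

lemma qop_id: "quantum_operation I (\<lambda>\<rho>. \<rho>)"
  by (simp add: quantum_operation_def completely_positive_def)

lemma qop_zero: "quantum_operation I (\<lambda>\<rho>. 0)"
  by (auto simp: quantum_operation_def completely_positive_def block_positive_def trace_class_0
      pos_tc_0 fun_eq_iff intro: rtr_nonneg)

lemma qop_comp:
  assumes E: "quantum_operation I E" and G: "quantum_operation I G"
  shows "quantum_operation I (G \<circ> E)"
proof -
  have "completely_positive I (G \<circ> E)"
    unfolding completely_positive_def
  proof (intro allI impI)
    fix n T
    assume T: "(\<forall>i<n. \<forall>j<n. T i j \<in> trace_class I) \<and> block_positive I n T"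
    have "block_positive I n (\<lambda>i j. E (T i j))"
      using completely_positiveD[OF qop_cp[OF E], of n T] T by blast
    moreover have "\<forall>i<n. \<forall>j<n. E (T i j) \<in> trace_class I"
      using T qop_trace_class[OF E] by blast
    ultimately have "block_positive I n (\<lambda>i j. G (E (T i j)))"
      by (rule completely_positiveD[OF qop_cp[OF G], rotated])
    then show "block_positive I n (\<lambda>i j. (G \<circ> E) (T i j))" by simp
  qed
  moreover have "rtr I (G (E \<rho>)) \<le> rtr I \<rho>" if "\<rho> \<in> pos_tc I" for \<rho>
    using qop_rtr[OF E that] qop_rtr[OF G qop_pos[OF E that]]
    by linarith
  moreover have "G (E (T + T')) = G (E T) + G (E T')" if "T \<in> trace_class I" "T' \<in> trace_class I" for T T'
    unfolding qop_add[OF E that]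
    by (rule qop_add[OF G qop_trace_class[OF E that(1)] qop_trace_class[OF E that(2)]])
  ultimately show ?thesis
    unfolding quantum_operation_def
    using qop_trace_class[OF E] qop_trace_class[OF G]
      qop_scale[OF E] qop_scale[OF G] by simp
qed

section \<open>Conjugations and weak limits as quantum operations\<close>

lemma conjugate_trace_class:
  assumes A: "bounded_op I A" and contr: "\<And>x. x \<in> ell2 I \<Longrightarrow> nrm I (A x) \<le> nrm I x"
  shows "\<rho> \<in> pos_tc I \<Longrightarrow> A \<circ> \<rho> \<circ> adj I A \<in> pos_tc I"
    and "\<rho> \<in> pos_tc I \<Longrightarrow> rtr I (A \<circ> \<rho> \<circ> adj I A) \<le> rtr I \<rho>"
proof -
  assume \<rho>: "\<rho> \<in> pos_tc I"
  have "(\<Sum>m\<in>{()}. (nrm I (A x))\<^sup>2) \<le> (nrm I x)\<^sup>2" if "x \<in> ell2 I" for x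
    using contr[OF that] by (simp add: power_mono)
  from conjugate_trace_le[of "{()}" I "\<lambda>_. A", OF _ A this \<rho>]
  show "A \<circ> \<rho> \<circ> adj I A \<in> pos_tc I" "rtr I (A \<circ> \<rho> \<circ> adj I A) \<le> rtr I \<rho>" by auto
qed

text \<open>For complete positivity, moving \<open>A\<close> across the inner product turns the
  block form of the images at \<open>y\<close> into the block form of \<open>T\<close> at the
  vectors \<open>adj I A (y i)\<close>.\<close>

lemma qop_conjugate:
  assumes A: "bounded_op I A" and contr: "\<And>x. x \<in> ell2 I \<Longrightarrow> nrm I (A x) \<le> nrm I x"
  shows "quantum_operation I (\<lambda>\<rho>. A \<circ> \<rho> \<circ> adj I A)"
  unfolding quantum_operation_def
proof (intro conjI ballI allI)
  fix T assume "T \<in> trace_class I"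
  then obtain C where C: "\<forall>k<4. C k \<in> pos_tc I" "T = tc_comb C" unfolding trace_class_iff by blast
  have "A (tc_comb C (adj I A x)) = tc_comb (\<lambda>k. A \<circ> C k \<circ> adj I A) x" for x
  proof -
    have "A (\<Sum>k<4. (\<lambda>i. \<i> ^ k * C k (adj I A x) i)) = (\<Sum>k<4. A (\<lambda>i. \<i> ^ k * C k (adj I A x) i))"
      using C by (intro bounded_op_sum[OF A] ell2_scale bounded_op_ell2 pos_tc_bounded) auto
    also have "\<dots> = (\<Sum>k<4. (\<lambda>i. \<i> ^ k * A (C k (adj I A x)) i))"
      using C by (intro sum.cong refl bounded_op_scale[OF A] bounded_op_ell2 pos_tc_bounded) auto
    finally show ?thesis by (simp add: tc_comb_sum sum_apply)
  qed
  then have "A \<circ> T \<circ> adj I A = tc_comb (\<lambda>k. A \<circ> C k \<circ> adj I A)" unfolding C(2) by (simp add: fun_eq_iff)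
  moreover have "\<forall>k<4. A \<circ> C k \<circ> adj I A \<in> pos_tc I" using C(1) conjugate_trace_class(1)[OF assms] by blast
  ultimately show "A \<circ> T \<circ> adj I A \<in> trace_class I"
    unfolding trace_class_iff by (intro exI[of _ "\<lambda>k. A \<circ> C k \<circ> adj I A"] conjI)
next
  fix T T' assume T: "T \<in> trace_class I" "T' \<in> trace_class I"
  show "A \<circ> (T + T') \<circ> adj I A = (A \<circ> T \<circ> adj I A) + (A \<circ> T' \<circ> adj I A)"
  proof
    fix x
    have "(A \<circ> (T + T') \<circ> adj I A) x = A (T (adj I A x) + T' (adj I A x))"
      by (simp only: o_apply plus_fun_apply)
    also have "\<dots> = A (T (adj I A x)) + A (T' (adj I A x))"
      by (rule bounded_op_add[OF A bounded_op_ell2[OF trace_class_bounded[OF T(1)]] bounded_op_ell2[OF trace_class_bounded[OF T(2)]]])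
    finally show "(A \<circ> (T + T') \<circ> adj I A) x = ((A \<circ> T \<circ> adj I A) + (A \<circ> T' \<circ> adj I A)) x"
      by (simp only: o_apply plus_fun_apply)
  qed
next
  fix c T assume T: "T \<in> trace_class I"
  show "A \<circ> (\<lambda>x i. c * T x i) \<circ> adj I A = (\<lambda>x i. c * (A \<circ> T \<circ> adj I A) x i)"
    using bounded_op_scale[OF A bounded_op_ell2[OF trace_class_bounded[OF T]], of c]
    by (intro ext) (simp only: o_apply)
next
  show "completely_positive I (\<lambda>\<rho>. A \<circ> \<rho> \<circ> adj I A)"
    unfolding completely_positive_def
  proof (intro allI impI)
    fix n T
    assume T: "(\<forall>i<n. \<forall>j<n. T i j \<in> trace_class I) \<and> block_positive I n T"
    show "block_positive I n (\<lambda>i j. A \<circ> T i j \<circ> adj I A)"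
      unfolding block_positive_def
    proof (intro allI impI)
      fix y :: "nat \<Rightarrow> 'a \<Rightarrow> complex" assume y: "\<forall>i<n. y i \<in> ell2 I"
      have "(\<Sum>i<n. \<Sum>j<n. ip I (y i) ((A \<circ> T i j \<circ> adj I A) (y j))) =
          (\<Sum>i<n. \<Sum>j<n. ip I (adj I A (y i)) (T i j (adj I A (y j))))"
      proof (intro sum.cong refl)
        fix i j assume "i \<in> {..<n}" "j \<in> {..<n}"
        then have yi: "y i \<in> ell2 I" and Tij: "T i j \<in> trace_class I" using T y by auto
        from ip_adj_left[OF A yi bounded_op_ell2[OF trace_class_bounded[OF Tij]]]
        show "ip I (y i) ((A \<circ> T i j \<circ> adj I A) (y j)) = ip I (adj I A (y i)) (T i j (adj I A (y j)))" by simp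
      qed
      also have "\<dots> \<in> \<real>\<^sub>\<ge>\<^sub>0"
        by (rule block_positiveD[of I n T "\<lambda>i. adj I A (y i)"]) (use T A in \<open>auto intro: bounded_op_adj\<close>)
      finally show "(\<Sum>i<n. \<Sum>j<n. ip I (y i) ((A \<circ> T i j \<circ> adj I A) (y j))) \<in> \<real>\<^sub>\<ge>\<^sub>0" .
    qed
  qed
qed (use conjugate_trace_class(2)[OF assms] in blast)

text \<open>Apart from membership in the trace class, which comes from the decomposition into four
  positive parts, each clause of \<open>quantum_operation\<close> is an equation or a closed
  inequality; for the trace the bound of \<open>pos_tc_weak_limit\<close> is enough. Sums over
  outcomes and suprema of sequences are both instances.\<close>

lemma qop_weak_limit:
  fixes I :: "'i set"
  assumes nt: "\<FF> \<noteq> bot" and f: "\<forall>\<^sub>F k in \<FF>. quantum_operation I (f k)"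
    and lim: "\<And>T x i. T \<in> trace_class I \<Longrightarrow> x \<in> ell2 I \<Longrightarrow> i \<in> I \<Longrightarrow> ((\<lambda>k. f k T x i) \<longlongrightarrow> E T x i) \<FF>"
    and out: "\<And>T x i. T \<in> trace_class I \<Longrightarrow> x \<notin> ell2 I \<or> i \<notin> I \<Longrightarrow> E T x i = 0"
  shows "quantum_operation I E"
proof -
  have pos: "E \<rho> \<in> pos_tc I" "rtr I (E \<rho>) \<le> rtr I \<rho>"
    "\<And>x y. x \<in> ell2 I \<Longrightarrow> y \<in> ell2 I \<Longrightarrow> ((\<lambda>k. ip I y (f k \<rho> x)) \<longlongrightarrow> ip I y (E \<rho> x)) \<FF>"
    if \<rho>: "\<rho> \<in> pos_tc I" for \<rho>
  proof -
    note t = pos_tc_trace_class[OF \<rho>]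
    have "\<forall>\<^sub>F k in \<FF>. f k \<rho> \<in> pos_tc I \<and> rtr I (f k \<rho>) \<le> rtr I \<rho>"
      using f
    proof eventually_elim
      case (elim k)
      show ?case by (rule conjI[OF qop_pos[OF elim \<rho>] qop_rtr[OF elim \<rho>]])
    qed
    note wl = pos_tc_weak_limit[OF nt this lim[OF t] out[OF t]]
    show "E \<rho> \<in> pos_tc I" "rtr I (E \<rho>) \<le> rtr I \<rho>" by (rule wl; assumption)+
    show "((\<lambda>k. ip I y (f k \<rho> x)) \<longlongrightarrow> ip I y (E \<rho> x)) \<FF>" if "x \<in> ell2 I" "y \<in> ell2 I" for x y
      by (rule wl(3)[OF _ _ _ that])
  qed
  \<comment> \<open>Equations for \<open>E\<close> are checked coordinate by coordinate, by
    uniqueness of limits; outside the space both sides are 0.\<close>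
  have eqI: "E T x i = z"
    if T: "T \<in> trace_class I" and "x \<notin> ell2 I \<or> i \<notin> I \<Longrightarrow> z = 0"
      and "x \<in> ell2 I \<Longrightarrow> i \<in> I \<Longrightarrow> (g \<longlongrightarrow> z) \<FF>" "\<forall>\<^sub>F k in \<FF>. g k = f k T x i" for T x i z g
  proof (cases "x \<in> ell2 I \<and> i \<in> I")
    case True
    then have "((\<lambda>k. f k T x i) \<longlongrightarrow> z) \<FF>" using that(3,4) by (blast intro: Lim_transform_eventually)
    then show ?thesis using tendsto_unique[OF nt lim[OF T]] True by blast
  next
    case False
    then show ?thesis using that(2) out[OF T] by auto
  qed
  have comb: "E (tc_comb A) = tc_comb (\<lambda>k. E (A k))" if A: "\<forall>k<4. A k \<in> pos_tc I" for A
  proof (intro ext)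
    fix x i
    show "E (tc_comb A) x i = tc_comb (\<lambda>k. E (A k)) x i"
    proof (rule eqI)
      show "tc_comb A \<in> trace_class I" using A unfolding trace_class_iff by blast
      show "tc_comb (\<lambda>k. E (A k)) x i = 0" if "x \<notin> ell2 I \<or> i \<notin> I"
        using out[OF pos_tc_trace_class that] A by (simp add: tc_comb_def)
      show "((\<lambda>k. tc_comb (\<lambda>l. f k (A l)) x i) \<longlongrightarrow> tc_comb (\<lambda>l. E (A l)) x i) \<FF>" if "x \<in> ell2 I" "i \<in> I"
        unfolding tc_comb_def using A that by (intro tendsto_sum tendsto_mult_left lim pos_tc_trace_class) auto
      show "\<forall>\<^sub>F k in \<FF>. tc_comb (\<lambda>l. f k (A l)) x i = f k (tc_comb A) x i"
        using f by eventually_elim (simp add: qop_tc_comb[OF _ A])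
    qed
  qed
  have tc: "E T \<in> trace_class I" if T: "T \<in> trace_class I" for T
  proof -
    obtain A where A: "\<forall>k<4. A k \<in> pos_tc I" "T = tc_comb A" using T unfolding trace_class_iff by blast
    have "\<forall>k<4. E (A k) \<in> pos_tc I" using A(1) pos(1) by blast
    then show ?thesis unfolding trace_class_iff A(2) comb[OF A(1)] by (intro exI[of _ "\<lambda>k. E (A k)"] conjI refl)
  qed
  \<comment> \<open>Complete positivity needs convergence of inner products. For positive operators
    it follows from the trace bound, for \<open>T\<close> by combining the four parts.\<close>
  have ipl: "((\<lambda>k. ip I y (f k T x)) \<longlongrightarrow> ip I y (E T x)) \<FF>"
    if T: "T \<in> trace_class I" and x: "x \<in> ell2 I" and y: "y \<in> ell2 I" for T x y
  proof -
    obtain A where A: "\<forall>k<4. A k \<in> pos_tc I" "T = tc_comb A" using T unfolding trace_class_iff by blast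
    have ipc: "ip I y (tc_comb B x) = (\<Sum>l<4. \<i> ^ l * ip I y (B l x))" if "\<forall>l<4. B l \<in> pos_tc I" for B
    proof -
      have "tc_comb B x = (\<Sum>l<4. (\<lambda>i. \<i> ^ l * B l x i))" by (simp add: tc_comb_sum sum_apply)
      moreover have "ip I y (\<Sum>l<4. (\<lambda>i. \<i> ^ l * B l x i)) = (\<Sum>l<4. ip I y (\<lambda>i. \<i> ^ l * B l x i))"
        using that by (intro ip_sum_right[OF y] ell2_scale bounded_op_ell2 pos_tc_bounded) auto
      ultimately show ?thesis by (simp only: ip_scale_right)
    qed
    have "((\<lambda>k. \<Sum>l<4. \<i> ^ l * ip I y (f k (A l) x)) \<longlongrightarrow> (\<Sum>l<4. \<i> ^ l * ip I y (E (A l) x))) \<FF>"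
      using A by (intro tendsto_sum tendsto_mult_left pos(3) x y) auto
    moreover have "\<forall>\<^sub>F k in \<FF>. (\<Sum>l<4. \<i> ^ l * ip I y (f k (A l) x)) = ip I y (f k T x)"
      using f
    proof eventually_elim
      case (elim k)
      have "\<forall>l<4. f k (A l) \<in> pos_tc I" using A(1) qop_pos[OF elim] by blast
      from ipc[OF this] show ?case unfolding A(2) qop_tc_comb[OF elim A(1)] by simp
    qed
    moreover have "\<forall>l<4. E (A l) \<in> pos_tc I" using A(1) pos(1) by blast
    from ipc[OF this] have "(\<Sum>l<4. \<i> ^ l * ip I y (E (A l) x)) = ip I y (E T x)"
      unfolding A(2) comb[OF A(1)] by simp
    ultimately show ?thesis by (simp add: Lim_transform_eventually)
  qed
  show ?thesis unfolding quantum_operation_def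
  proof (intro conjI ballI allI)
    fix T T' assume T: "T \<in> trace_class I" "T' \<in> trace_class I"
    have "E (T + T') x i = E T x i + E T' x i" for x i
    proof (rule eqI[OF trace_class_add[OF T]])
      show "E T x i + E T' x i = 0" if "x \<notin> ell2 I \<or> i \<notin> I" using out[OF _ that] T by simp
      show "((\<lambda>k. f k T x i + f k T' x i) \<longlongrightarrow> E T x i + E T' x i) \<FF>" if "x \<in> ell2 I" "i \<in> I"
        by (intro tendsto_add lim T that)
      show "\<forall>\<^sub>F k in \<FF>. f k T x i + f k T' x i = f k (T + T') x i"
        using f by eventually_elim (simp add: qop_add[OF _ T])
    qed
    then show "E (T + T') = E T + E T'" by (intro ext) (simp only: plus_fun_apply)
  next
    fix c T assume T: "T \<in> trace_class I"
    show "E (\<lambda>x i. c * T x i) = (\<lambda>x i. c * E T x i)"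
    proof (intro ext, rule eqI[OF trace_class_scale[OF T]])
      fix x i
      show "c * E T x i = 0" if "x \<notin> ell2 I \<or> i \<notin> I" using out[OF T that] by simp
      show "((\<lambda>k. c * f k T x i) \<longlongrightarrow> c * E T x i) \<FF>" if "x \<in> ell2 I" "i \<in> I"
        by (intro tendsto_mult_left lim T that)
      show "\<forall>\<^sub>F k in \<FF>. c * f k T x i = f k (\<lambda>x i. c * T x i) x i"
        using f by eventually_elim (simp add: qop_scale[OF _ T])
    qed
  next
    show "completely_positive I E"
      unfolding completely_positive_def
    proof (intro allI impI)
      fix n T
      assume T: "(\<forall>i<n. \<forall>j<n. T i j \<in> trace_class I) \<and> block_positive I n T"
      show "block_positive I n (\<lambda>i j. E (T i j))"
        unfolding block_positive_def
      proof (intro allI impI)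
        fix y :: "nat \<Rightarrow> 'i \<Rightarrow> complex" assume y: "\<forall>i<n. y i \<in> ell2 I"
        have "((\<lambda>k. \<Sum>i<n. \<Sum>j<n. ip I (y i) (f k (T i j) (y j))) \<longlongrightarrow>
            (\<Sum>i<n. \<Sum>j<n. ip I (y i) (E (T i j) (y j)))) \<FF>"
          using T y by (intro tendsto_sum ipl) auto
        then show "(\<Sum>i<n. \<Sum>j<n. ip I (y i) (E (T i j) (y j))) \<in> \<real>\<^sub>\<ge>\<^sub>0"
        proof (rule tendsto_nonneg_Reals[OF nt])
          show "\<forall>\<^sub>F k in \<FF>. (\<Sum>i<n. \<Sum>j<n. ip I (y i) (f k (T i j) (y j))) \<in> \<real>\<^sub>\<ge>\<^sub>0"
            using f
          proof eventually_elim
            case (elim k)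
            have "block_positive I n (\<lambda>i j. f k (T i j))"
              using completely_positiveD[OF qop_cp[OF elim], of n T] T by blast
            then show ?case by (rule block_positiveD) (use y in blast)
          qed
        qed
      qed
    qed
  qed (use tc pos(2) in blast)+
qed

section \<open>Sums and suprema of quantum operations\<close>

lemma sum_apply2: "(\<Sum>k\<in>K. f k) x i = (\<Sum>k\<in>K. f k x i)"
  by (simp add: sum_apply)

lemma pos_family_rtr_summable:
  assumes f: "\<And>k. k \<in> J \<Longrightarrow> f k \<in> pos_tc I"
    and C: "\<And>G. finite G \<Longrightarrow> G \<subseteq> J \<Longrightarrow> (\<Sum>k\<in>G. rtr I (f k)) \<le> C"
  shows "(\<lambda>k. rtr I (f k)) summable_on J"
  by (rule nonneg_bdd_above_summable_on) (auto intro!: bdd_aboveI[of _ C] C rtr_nonneg f)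

text \<open>\<open>infsum\<close> is 0 for a family that is not summable, so convergence in
  \<open>opsum\<close> has to be secured: each entry is bounded by the trace of its operator times
  \<open>nrm I x\<close>, which gives absolute convergence.\<close>

lemma pos_family_summable:
  assumes f: "\<And>k. k \<in> J \<Longrightarrow> f k \<in> pos_tc I"
    and C: "\<And>G. finite G \<Longrightarrow> G \<subseteq> J \<Longrightarrow> (\<Sum>k\<in>G. rtr I (f k)) \<le> C"
    and x: "x \<in> ell2 I"
  shows "(\<lambda>k. f k x i) summable_on J"
proof -
  have le: "norm (f k x i) \<le> rtr I (f k) * nrm I x" if k: "k \<in> J" for k
  proof -
    have "cmod (f k x i) \<le> nrm I (f k x)"
      by (rule coord_le_nrm[OF bounded_op_ell2[OF pos_tc_bounded[OF f[OF k]]]])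
    also have "\<dots> \<le> rtr I (f k) * nrm I x" by (rule pos_tc_nrm_bound[OF f[OF k] x])
    finally show ?thesis .
  qed
  have "(\<Sum>k\<in>G. norm (f k x i)) \<le> C * nrm I x" if G: "finite G" "G \<subseteq> J" for G
  proof -
    have "(\<Sum>k\<in>G. norm (f k x i)) \<le> (\<Sum>k\<in>G. rtr I (f k)) * nrm I x"
      using G le by (auto simp: sum_distrib_right intro!: sum_mono)
    also have "\<dots> \<le> C * nrm I x" by (intro mult_right_mono C G nrm_nonneg)
    finally show ?thesis .
  qed
  then have "(\<lambda>k. norm (f k x i)) summable_on J"
    by (intro nonneg_bdd_above_summable_on) (auto intro!: bdd_aboveI[of _ "C * nrm I x"])
  then show ?thesis by (rule abs_summable_summable)
qed

lemma opsum_outside: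
  assumes "\<And>k. k \<in> J \<Longrightarrow> bounded_op I (f k)" "x \<notin> ell2 I \<or> i \<notin> I"
  shows "opsum J f x i = 0"
  unfolding opsum_def
proof (rule infsum_0)
  fix k assume k: "k \<in> J"
  show "f k x i = 0"
    using assms(2) bounded_op_outside[OF assms(1)[OF k]] ell2_outside[OF bounded_op_ell2[OF assms(1)[OF k]]]
    by auto
qed

lemma opsum_pos_tc_le:
  assumes f: "\<And>k. k \<in> J \<Longrightarrow> f k \<in> pos_tc I"
    and C: "\<And>G. finite G \<Longrightarrow> G \<subseteq> J \<Longrightarrow> (\<Sum>k\<in>G. rtr I (f k)) \<le> C"
  shows "opsum J f \<in> pos_tc I" and "rtr I (opsum J f) \<le> C"
proof -
  have ev: "\<forall>\<^sub>F G in finite_subsets_at_top J. (\<Sum>k\<in>G. f k) \<in> pos_tc I \<and> rtr I (\<Sum>k\<in>G. f k) \<le> C"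
  proof (rule eventually_finite_subsets_at_top_weakI)
    fix G assume G: "finite G" "G \<subseteq> J"
    have "(\<Sum>k\<in>G. f k) \<in> pos_tc I \<and> rtr I (\<Sum>k\<in>G. f k) = (\<Sum>k\<in>G. rtr I (f k))"
      by (rule pos_tc_sum) (use G f in auto)
    then show "(\<Sum>k\<in>G. f k) \<in> pos_tc I \<and> rtr I (\<Sum>k\<in>G. f k) \<le> C" using C[OF G] by simp
  qed
  have lim: "((\<lambda>G. (\<Sum>k\<in>G. f k) x i) \<longlongrightarrow> opsum J f x i) (finite_subsets_at_top J)"
    if "x \<in> ell2 I" "i \<in> I" for x i
    unfolding sum_apply2 opsum_def by (rule infsum_tendsto[OF pos_family_summable[OF f C that(1)]])
  have out: "opsum J f x i = 0" if "x \<notin> ell2 I \<or> i \<notin> I" for x i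
    by (rule opsum_outside[OF pos_tc_bounded[OF f] that])
  show "opsum J f \<in> pos_tc I" "rtr I (opsum J f) \<le> C"
    using pos_tc_weak_limit(1,2)[OF finite_subsets_at_top_neq_bot ev lim out] by auto
qed

text \<open>The weak limit alone gives only an upper bound on the trace of the sum. For the converse
  a finite part \<open>G\<close> is split off: the rest is again a sum of positive operators, so its
  trace is nonnegative. Thus no trace is lost in this limit.\<close>

lemma opsum_rtr_has_sum:
  assumes f: "\<And>k. k \<in> J \<Longrightarrow> f k \<in> pos_tc I"
    and C: "\<And>G. finite G \<Longrightarrow> G \<subseteq> J \<Longrightarrow> (\<Sum>k\<in>G. rtr I (f k)) \<le> C"
  shows "((\<lambda>k. rtr I (f k)) has_sum rtr I (opsum J f)) J"
proof -
  note s = pos_family_rtr_summable[OF f C]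
  have "rtr I (opsum J f) \<le> (\<Sum>\<^sub>\<infinity>k\<in>J. rtr I (f k))"
    by (rule opsum_pos_tc_le(2)[OF f]) (auto intro!: finite_sum_le_infsum s rtr_nonneg f)
  moreover have "(\<Sum>\<^sub>\<infinity>k\<in>J. rtr I (f k)) \<le> rtr I (opsum J f)"
  proof (rule infsum_le_finite_sums[OF s])
    fix G assume G: "finite G" "G \<subseteq> J"
    have fG: "f k \<in> pos_tc I" if "k \<in> G" for k using that G f by auto
    have fD: "f k \<in> pos_tc I" if "k \<in> J - G" for k using that f by auto
    have D: "opsum (J - G) f \<in> pos_tc I"
      by (rule opsum_pos_tc_le(1)[OF fD, where C = C]) (auto intro: C)
    have S: "(\<Sum>k\<in>G. f k) \<in> pos_tc I" "rtr I (\<Sum>k\<in>G. f k) = (\<Sum>k\<in>G. rtr I (f k))"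
      using pos_tc_sum[where K = G and f = f, OF fG] by auto
    have "opsum J f = (\<Sum>k\<in>G. f k) + opsum (J - G) f"
    proof (intro ext)
      fix x i
      show "opsum J f x i = ((\<Sum>k\<in>G. f k) + opsum (J - G) f) x i"
      proof (cases "x \<in> ell2 I")
        case True
        note sx = pos_family_summable[where J = J and f = f and i = i, OF f C True]
        have "opsum J f x i = (\<Sum>\<^sub>\<infinity>k\<in>G \<union> (J - G). f k x i)"
          using G by (simp add: opsum_def Un_absorb1)
        also have "\<dots> = (\<Sum>\<^sub>\<infinity>k\<in>G. f k x i) + (\<Sum>\<^sub>\<infinity>k\<in>J - G. f k x i)"
          by (rule infsum_Un_disjoint) (use G sx in \<open>auto intro: summable_on_subset_banach\<close>)
        finally show ?thesis using G by (simp add: opsum_def sum_apply2)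
      next
        case False
        have "opsum J f x i = 0" by (rule opsum_outside[OF pos_tc_bounded[OF f]]) (use False in auto)
        moreover have "opsum (J - G) f x i = 0" by (rule opsum_outside[OF pos_tc_bounded[OF fD]]) (use False in auto)
        moreover have "(\<Sum>k\<in>G. f k) x = 0" by (rule bounded_op_outside[OF pos_tc_bounded[OF S(1)] False])
        ultimately show ?thesis by simp
      qed
    qed
    then have "rtr I (opsum J f) = (\<Sum>k\<in>G. rtr I (f k)) + rtr I (opsum (J - G) f)"
      using pos_tc_add(2)[OF S(1) D] S(2) by simp
    then show "(\<Sum>k\<in>G. rtr I (f k)) \<le> rtr I (opsum J f)" using rtr_nonneg[OF D] by simp
  qed
  ultimately show ?thesis using s by (simp add: has_sum_iff)
qed

text \<open>The differences \<open>h k\<close> are positive with traces bounded by those of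
  \<open>g k\<close>, so the difference of the sums is itself a convergent sum of positive
  operators.\<close>

lemma opsum_mono:
  assumes f: "\<And>k. k \<in> J \<Longrightarrow> f k \<in> pos_tc I" and g: "\<And>k. k \<in> J \<Longrightarrow> g k \<in> pos_tc I"
    and le: "\<And>k. k \<in> J \<Longrightarrow> lowner I (f k) (g k)"
    and C: "\<And>G. finite G \<Longrightarrow> G \<subseteq> J \<Longrightarrow> (\<Sum>k\<in>G. rtr I (g k)) \<le> C"
  shows "lowner I (opsum J f) (opsum J g)"
proof -
  define h where "h k = g k - f k" for k
  have h: "h k \<in> pos_tc I" and hr: "rtr I (h k) = rtr I (g k) - rtr I (f k)" if "k \<in> J" for k
    unfolding h_def using pos_tc_diff[OF f[OF that] g[OF that] le[OF that]] by auto
  have Cf: "(\<Sum>k\<in>G. rtr I (f k)) \<le> C" if G: "finite G" "G \<subseteq> J" for G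
  proof -
    have "(\<Sum>k\<in>G. rtr I (f k)) \<le> (\<Sum>k\<in>G. rtr I (g k))"
      using G by (intro sum_mono lowner_rtr_mono f g le) auto
    then show ?thesis using C[OF G] by simp
  qed
  have Ch: "(\<Sum>k\<in>G. rtr I (h k)) \<le> C" if G: "finite G" "G \<subseteq> J" for G
  proof -
    have "(\<Sum>k\<in>G. rtr I (h k)) \<le> (\<Sum>k\<in>G. rtr I (g k))"
      using G rtr_nonneg[OF f] by (intro sum_mono) (auto simp: hr)
    then show ?thesis using C[OF G] by simp
  qed
  have "opsum J g - opsum J f = opsum J h"
  proof (intro ext)
    fix x i
    show "(opsum J g - opsum J f) x i = opsum J h x i"
    proof (cases "x \<in> ell2 I")
      case True
      have "opsum J f x i + opsum J h x i = (\<Sum>\<^sub>\<infinity>k\<in>J. f k x i + h k x i)"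
        unfolding opsum_def
        by (rule infsum_add[symmetric, OF pos_family_summable[OF f Cf True] pos_family_summable[OF h Ch True]])
      also have "\<dots> = opsum J g x i" by (simp add: opsum_def h_def)
      finally show ?thesis by (simp add: algebra_simps)
    next
      case False
      then have x: "x \<notin> ell2 I \<or> i \<notin> I" by blast
      have "opsum J f x i = 0" by (rule opsum_outside[OF pos_tc_bounded[OF f] x])
      moreover have "opsum J g x i = 0" by (rule opsum_outside[OF pos_tc_bounded[OF g] x])
      moreover have "opsum J h x i = 0" by (rule opsum_outside[OF pos_tc_bounded[OF h] x])
      ultimately show ?thesis by simp
    qed
  qed
  then show ?thesis unfolding lowner_def using pos_tc_positive[OF opsum_pos_tc_le(1)[OF h Ch]] by simp
qed

section \<open>Instruments and dominated convergence\<close>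

text \<open>A quantum instrument in the subnormalised sense. The trace condition is put on finite
  subfamilies because it is what makes the infinite sum converge.\<close>

definition instrument :: "'i set \<Rightarrow> 'k set \<Rightarrow> ('k \<Rightarrow> 'i superop) \<Rightarrow> bool" where
  "instrument I J E \<longleftrightarrow> (\<forall>k\<in>J. quantum_operation I (E k)) \<and>
     (\<forall>\<rho>\<in>pos_tc I. \<forall>G. finite G \<and> G \<subseteq> J \<longrightarrow> (\<Sum>k\<in>G. rtr I (E k \<rho>)) \<le> rtr I \<rho>)"

lemma instrument_qop: "instrument I J E \<Longrightarrow> k \<in> J \<Longrightarrow> quantum_operation I (E k)"
  and instrument_rtr:
    "instrument I J E \<Longrightarrow> \<rho> \<in> pos_tc I \<Longrightarrow> finite G \<Longrightarrow> G \<subseteq> J \<Longrightarrow> (\<Sum>k\<in>G. rtr I (E k \<rho>)) \<le> rtr I \<rho>"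
  by (auto simp: instrument_def)

lemma sum_nonneg_Reals: "(\<And>k. k \<in> K \<Longrightarrow> f k \<in> \<real>\<^sub>\<ge>\<^sub>0) \<Longrightarrow> (\<Sum>k\<in>K. f k) \<in> (\<real>\<^sub>\<ge>\<^sub>0 :: complex set)"
  by (induction K rule: infinite_finite_induct) auto

lemma qop_finite_sum:
  fixes I :: "'i set"
  assumes E: "\<And>k. k \<in> G \<Longrightarrow> quantum_operation I (E k)"
    and le: "\<And>\<rho>. \<rho> \<in> pos_tc I \<Longrightarrow> (\<Sum>k\<in>G. rtr I (E k \<rho>)) \<le> rtr I \<rho>"
  shows "quantum_operation I (\<lambda>\<rho>. \<Sum>k\<in>G. E k \<rho>)"
  unfolding quantum_operation_def
proof (intro conjI ballI allI)
  fix T assume T: "T \<in> trace_class I"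
  show "(\<Sum>k\<in>G. E k T) \<in> trace_class I"
    by (rule trace_class_sum[OF qop_trace_class[OF E T]])
  fix T' assume T': "T' \<in> trace_class I"
  have "(\<Sum>k\<in>G. E k (T + T')) = (\<Sum>k\<in>G. E k T + E k T')"
    by (rule sum.cong[OF refl qop_add[OF E T T']])
  then show "(\<Sum>k\<in>G. E k (T + T')) = (\<Sum>k\<in>G. E k T) + (\<Sum>k\<in>G. E k T')"
    by (simp only: sum.distrib)
next
  fix c T assume T: "T \<in> trace_class I"
  have "(\<Sum>k\<in>G. E k (\<lambda>x i. c * T x i)) = (\<Sum>k\<in>G. (\<lambda>x i. c * E k T x i))"
    by (rule sum.cong[OF refl qop_scale[OF E T]])
  then show "(\<Sum>k\<in>G. E k (\<lambda>x i. c * T x i)) = (\<lambda>x i. c * (\<Sum>k\<in>G. E k T) x i)"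
    by (simp only: fun_eq_iff sum_apply2 sum_distrib_left) simp
next
  fix \<rho> assume \<rho>: "\<rho> \<in> pos_tc I"
  show "rtr I (\<Sum>k\<in>G. E k \<rho>) \<le> rtr I \<rho>"
    using pos_tc_sum[where K = G and f = "\<lambda>k. E k \<rho>", OF qop_pos[OF E \<rho>]] le[OF \<rho>] by simp
next
  show "completely_positive I (\<lambda>\<rho>. \<Sum>k\<in>G. E k \<rho>)"
    unfolding completely_positive_def
  proof (intro allI impI)
    fix n T
    assume T: "(\<forall>i<n. \<forall>j<n. T i j \<in> trace_class I) \<and> block_positive I n T"
    show "block_positive I n (\<lambda>i j. \<Sum>k\<in>G. E k (T i j))"
      unfolding block_positive_def
    proof (intro allI impI)
      fix y :: "nat \<Rightarrow> 'i \<Rightarrow> complex" assume y: "\<forall>i<n. y i \<in> ell2 I"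
      have "(\<Sum>i<n. \<Sum>j<n. ip I (y i) ((\<Sum>k\<in>G. E k (T i j)) (y j))) =
          (\<Sum>i<n. \<Sum>j<n. \<Sum>k\<in>G. ip I (y i) (E k (T i j) (y j)))"
      proof (intro sum.cong refl)
        fix i j assume "i \<in> {..<n}" "j \<in> {..<n}"
        then have yi: "y i \<in> ell2 I" and Tij: "T i j \<in> trace_class I" using T y by auto
        have eq: "(\<Sum>k\<in>G. E k (T i j)) (y j) = (\<Sum>k\<in>G. E k (T i j) (y j))" by (rule sum_apply)
        show "ip I (y i) ((\<Sum>k\<in>G. E k (T i j)) (y j)) = (\<Sum>k\<in>G. ip I (y i) (E k (T i j) (y j)))"
          unfolding eq
          by (rule ip_sum_right[OF yi bounded_op_ell2[OF trace_class_bounded[OF qop_trace_class[OF E Tij]]]])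
      qed
      also have "\<dots> = (\<Sum>i<n. \<Sum>k\<in>G. \<Sum>j<n. ip I (y i) (E k (T i j) (y j)))"
        by (intro sum.cong refl sum.swap)
      also have "\<dots> = (\<Sum>k\<in>G. \<Sum>i<n. \<Sum>j<n. ip I (y i) (E k (T i j) (y j)))"
        by (rule sum.swap)
      also have "\<dots> \<in> \<real>\<^sub>\<ge>\<^sub>0"
      proof (rule sum_nonneg_Reals)
        fix k assume k: "k \<in> G"
        have "block_positive I n (\<lambda>i j. E k (T i j))"
          using completely_positiveD[OF qop_cp[OF E[OF k]], of n T] T by blast
        then show "(\<Sum>i<n. \<Sum>j<n. ip I (y i) (E k (T i j) (y j))) \<in> \<real>\<^sub>\<ge>\<^sub>0"
          by (rule block_positiveD) (use y in blast)
      qed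
      finally show "(\<Sum>i<n. \<Sum>j<n. ip I (y i) ((\<Sum>k\<in>G. E k (T i j)) (y j))) \<in> \<real>\<^sub>\<ge>\<^sub>0" .
    qed
  qed
qed

text \<open>Finite partial sums are quantum operations, and their coordinates converge: on positive
  operators by the trace bound, on all trace class operators by combining four parts.\<close>

lemma qop_opsum:
  assumes E: "instrument I J E"
  shows "quantum_operation I (\<lambda>\<rho>. opsum J (\<lambda>k. E k \<rho>))"
proof (rule qop_weak_limit[OF finite_subsets_at_top_neq_bot])
  show "\<forall>\<^sub>F G in finite_subsets_at_top J. quantum_operation I (\<lambda>\<rho>. \<Sum>k\<in>G. E k \<rho>)"
  proof (rule eventually_finite_subsets_at_top_weakI)
    fix G assume G: "finite G" "G \<subseteq> J"
    show "quantum_operation I (\<lambda>\<rho>. \<Sum>k\<in>G. E k \<rho>)"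
      by (rule qop_finite_sum) (use G instrument_qop[OF E] instrument_rtr[OF E] in auto)
  qed
next
  fix T x i assume T: "T \<in> trace_class I" and x: "x \<in> ell2 I" and "i \<in> I"
  obtain A where A: "\<forall>k<4. A k \<in> pos_tc I" "T = tc_comb A" using T unfolding trace_class_iff by blast
  have "(\<lambda>k. E k (A l) x i) summable_on J" if "l < 4" for l
    using that A(1) qop_pos[OF instrument_qop[OF E]] instrument_rtr[OF E]
    by (intro pos_family_summable[OF _ _ x, where C = "rtr I (A l)"]) auto
  then have "(\<lambda>k. \<Sum>l<4. \<i> ^ l * E k (A l) x i) summable_on J"
    unfolding sum_less4 by (intro summable_on_add summable_on_cmult_right) auto
  moreover have "(\<Sum>l<4. \<i> ^ l * E k (A l) x i) = E k T x i" if "k \<in> J" for k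
    unfolding A(2) qop_tc_comb[OF instrument_qop[OF E that] A(1)] by (simp add: tc_comb_def)
  ultimately have "(\<lambda>k. E k T x i) summable_on J"
    using summable_on_cong[of J "\<lambda>k. \<Sum>l<4. \<i> ^ l * E k (A l) x i" "\<lambda>k. E k T x i"] by blast
  then show "((\<lambda>G. (\<Sum>k\<in>G. E k T) x i) \<longlongrightarrow> opsum J (\<lambda>k. E k T) x i) (finite_subsets_at_top J)"
    unfolding sum_apply2 opsum_def by (rule infsum_tendsto)
next
  fix T x i assume T: "T \<in> trace_class I" and xi: "x \<notin> ell2 I \<or> i \<notin> I"
  show "opsum J (\<lambda>k. E k T) x i = 0"
    by (rule opsum_outside[OF trace_class_bounded[OF qop_trace_class[OF instrument_qop[OF E] T]] xi])
qed

lemma instrument_opsum_rtr: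
  assumes E: "instrument I J E" and \<rho>: "\<rho> \<in> pos_tc I"
  shows "((\<lambda>k. rtr I (E k \<rho>)) has_sum rtr I (opsum J (\<lambda>k. E k \<rho>))) J"
  by (rule opsum_rtr_has_sum[OF qop_pos[OF instrument_qop[OF E] \<rho>] instrument_rtr[OF E \<rho>]])

lemma instrument_opsum_mono:
  assumes E: "instrument I J E" and G: "instrument I J G" and \<rho>: "\<rho> \<in> pos_tc I"
    and le: "\<And>k. k \<in> J \<Longrightarrow> lowner I (E k \<rho>) (G k \<rho>)"
  shows "lowner I (opsum J (\<lambda>k. E k \<rho>)) (opsum J (\<lambda>k. G k \<rho>))"
  by (rule opsum_mono[OF qop_pos[OF instrument_qop[OF E] \<rho>]
        qop_pos[OF instrument_qop[OF G] \<rho>] le instrument_rtr[OF G \<rho>]])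

text \<open>The limit family is itself the dominating one, so \<open>s n \<le> l\<close> is
  immediate. For the lower bound, a finite subfamily of \<open>t\<close> already exceeds any
  \<open>a < l\<close>, and on it the convergence is that of a finite sum.\<close>

lemma has_sum_dominated_convergence:
  fixes t :: "'k \<Rightarrow> real"
  assumes tn: "\<And>n. (tn n has_sum s n) J" and t: "(t has_sum l) J"
    and nonneg: "\<And>n k. k \<in> J \<Longrightarrow> 0 \<le> tn n k" and le: "\<And>n k. k \<in> J \<Longrightarrow> tn n k \<le> t k"
    and lim: "\<And>k. k \<in> J \<Longrightarrow> ((\<lambda>n. tn n k) \<longlongrightarrow> t k) \<FF>"
  shows "(s \<longlongrightarrow> l) \<FF>"
proof (rule order_tendstoI)
  fix a assume "a < l"
  have "\<forall>\<^sub>F G in finite_subsets_at_top J. sum t G > a"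
    using t \<open>a < l\<close> unfolding has_sum_def by (rule order_tendstoD(1))
  then have "\<forall>\<^sub>F G in finite_subsets_at_top J. sum t G > a \<and> finite G \<and> G \<subseteq> J"
    by (rule eventually_conj) (rule eventually_finite_subsets_at_top_weakI, simp)
  then obtain G where G: "sum t G > a" "finite G" "G \<subseteq> J"
    using eventually_happens'[OF finite_subsets_at_top_neq_bot] by blast
  have "((\<lambda>n. sum (tn n) G) \<longlongrightarrow> sum t G) \<FF>" using G by (intro tendsto_sum lim) auto
  then have "\<forall>\<^sub>F n in \<FF>. a < sum (tn n) G" using G(1) by (rule order_tendstoD(1))
  then show "\<forall>\<^sub>F n in \<FF>. a < s n"
  proof eventually_elim
    case (elim n)
    have "sum (tn n) G \<le> s n" using G nonneg by (intro finite_sum_le_has_sum[OF tn]) auto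
    with elim show ?case by simp
  qed
next
  fix a assume "l < a"
  have "s n \<le> l" for n by (rule has_sum_mono[OF tn t le])
  then show "\<forall>\<^sub>F n in \<FF>. s n < a" using \<open>l < a\<close> by (intro always_eventually allI) (rule le_less_trans)
qed

section \<open>The order of quantum operations and suprema of increasing sequences\<close>

text \<open>The order tests only partial density operators; an operator of larger trace is divided
  by its trace, and linearity undoes the scaling.\<close>

lemma superop_le_pos_tc:
  assumes E: "quantum_operation I E" and G: "quantum_operation I G" and le: "superop_le I E G"
    and \<rho>: "\<rho> \<in> pos_tc I"
  shows "lowner I (E \<rho>) (G \<rho>)"
proof (cases "rtr I \<rho> \<le> 1")
  case True
  then show ?thesis using le \<rho> by (auto simp: superop_le_def pdo_def)
next
  case False
  define c where "c = 1 / rtr I \<rho>"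
  have c: "0 < c" using False by (simp add: c_def)
  let ?\<sigma> = "\<lambda>x i. of_real c * \<rho> x i"
  have "?\<sigma> \<in> pdo I" using pos_tc_scale[OF \<rho>, of c] c False by (simp add: pdo_def) (simp add: c_def)
  then have "positive I (G ?\<sigma> - E ?\<sigma>)" using le by (auto simp: superop_le_def lowner_def)
  then have "positive I (\<lambda>x i. of_real (1 / c) * (G ?\<sigma> - E ?\<sigma>) x i)"
    by (rule positive_scale) (use c in simp)
  also have "(\<lambda>x i. of_real (1 / c) * (G ?\<sigma> - E ?\<sigma>) x i) = G \<rho> - E \<rho>"
    unfolding qop_scale[OF E pos_tc_trace_class[OF \<rho>]]
      qop_scale[OF G pos_tc_trace_class[OF \<rho>]]
    using c by (auto simp: fun_eq_iff field_simps)
  finally show ?thesis unfolding lowner_def .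
qed

lemma lowner_ipD:
  assumes "bounded_op I A" "bounded_op I B" "lowner I A B" "x \<in> ell2 I"
  shows "ip I x (B x) - ip I x (A x) \<in> \<real>\<^sub>\<ge>\<^sub>0"
  using positive_ip[of I "B - A", OF _ assms(4)] assms(3)
  by (simp add: lowner_def ip_minus_right[OF assms(4) bounded_op_ell2[OF assms(2)] bounded_op_ell2[OF assms(1)]])

lemma lowner_ipI:
  assumes "bounded_op I A" "bounded_op I B" "\<And>x. x \<in> ell2 I \<Longrightarrow> ip I x (B x) - ip I x (A x) \<in> \<real>\<^sub>\<ge>\<^sub>0"
  shows "lowner I A B"
  using assms(3) bounded_op_diff[OF assms(2,1)]
  by (simp add: lowner_def positive_def ip_minus_right bounded_op_ell2[OF assms(2)] bounded_op_ell2[OF assms(1)])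

text \<open>The traces increase and are bounded, hence Cauchy; since the trace of a positive
  difference bounds its norm, all coordinates are Cauchy as well. The limit is a quantum operation,
  and its comparison with upper bounds is a limit of quadratic forms.\<close>

lemma increasing_quantum_operations_limit:
  assumes f: "\<And>n. quantum_operation I (f n)"
    and inc: "\<And>n \<rho>. \<rho> \<in> pos_tc I \<Longrightarrow> lowner I (f n \<rho>) (f (Suc n) \<rho>)"
  shows "\<exists>E. is_qlub I f E \<and> (\<forall>\<rho>\<in>pos_tc I. (\<lambda>n. rtr I (f n \<rho>)) \<longlonglongrightarrow> rtr I (E \<rho>))"
proof -
  have le: "lowner I (f m \<rho>) (f n \<rho>)" if "\<rho> \<in> pos_tc I" "m \<le> n" for \<rho> m n
    using that(2) by (induction n rule: dec_induct) (auto intro: lowner_refl lowner_trans inc[OF that(1)])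
  have fpos: "f n \<rho> \<in> pos_tc I" and frtr: "rtr I (f n \<rho>) \<le> rtr I \<rho>" if "\<rho> \<in> pos_tc I" for n \<rho>
    using qop_pos[OF f that] qop_rtr[OF f that] by auto
  have conv: "convergent (\<lambda>n. rtr I (f n \<rho>))" if \<rho>: "\<rho> \<in> pos_tc I" for \<rho>
  proof (rule Bseq_monoseq_convergent)
    show "Bseq (\<lambda>n. rtr I (f n \<rho>))"
      using rtr_nonneg[OF fpos[OF \<rho>]] frtr[OF \<rho>] by (intro BseqI'[of _ "rtr I \<rho>"]) auto
    show "monoseq (\<lambda>n. rtr I (f n \<rho>))"
      unfolding monoseq_def using lowner_rtr_mono[OF fpos[OF \<rho>] fpos[OF \<rho>] le[OF \<rho>]] by blast
  qed
  have cpos: "convergent (\<lambda>n. f n \<rho> x i)" if \<rho>: "\<rho> \<in> pos_tc I" and x: "x \<in> ell2 I" for \<rho> x i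
  proof (rule Cauchy_convergent, rule metric_CauchyI)
    fix e :: real assume e: "e > 0"
    have "Cauchy (\<lambda>n. rtr I (f n \<rho>) * nrm I x)"
      by (rule convergent_Cauchy, rule convergent_mult[OF conv[OF \<rho>] convergent_const])
    from metric_CauchyD[OF this e]
    obtain N where N: "\<And>m n. m \<ge> N \<Longrightarrow> n \<ge> N \<Longrightarrow> dist (rtr I (f m \<rho>) * nrm I x) (rtr I (f n \<rho>) * nrm I x) < e"
      by blast
    have *: "dist (f m \<rho> x i) (f n \<rho> x i) < e" if mn: "N \<le> m" "m \<le> n" for m n
    proof -
      note d = pos_tc_diff[OF fpos[OF \<rho>] fpos[OF \<rho>] le[OF \<rho> mn(2)]]
      have "cmod ((f n \<rho> - f m \<rho>) x i) \<le> nrm I ((f n \<rho> - f m \<rho>) x)"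
        by (rule coord_le_nrm[OF bounded_op_ell2[OF pos_tc_bounded[OF d(1)]]])
      also have "\<dots> \<le> (rtr I (f n \<rho>) - rtr I (f m \<rho>)) * nrm I x"
        using pos_tc_nrm_bound[OF d(1) x] unfolding d(2) .
      also have "\<dots> \<le> dist (rtr I (f m \<rho>) * nrm I x) (rtr I (f n \<rho>) * nrm I x)"
        by (simp add: dist_real_def left_diff_distrib)
      also have "\<dots> < e" using N[of m n] mn by simp
      finally show ?thesis by (simp add: dist_norm norm_minus_commute)
    qed
    then show "\<exists>M. \<forall>m\<ge>M. \<forall>n\<ge>M. dist (f m \<rho> x i) (f n \<rho> x i) < e"
      by (metis dist_commute nle_le)
  qed
  \<comment> \<open>\<open>lim\<close> is meaningful on trace class operators, where convergence
    follows from the four positive parts; elsewhere the value is arbitrary.\<close>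
  define E where "E T x i = lim (\<lambda>n. f n T x i)" for T x i
  have lim: "(\<lambda>n. f n T x i) \<longlonglongrightarrow> E T x i" if T: "T \<in> trace_class I" and x: "x \<in> ell2 I" for T x i
  proof -
    obtain A where A: "\<forall>k<4. A k \<in> pos_tc I" "T = tc_comb A" using T unfolding trace_class_iff by blast
    have "convergent (\<lambda>n. \<Sum>l<4. \<i> ^ l * f n (A l) x i)"
      using A(1) x by (intro convergent_sum convergent_mult convergent_const cpos) auto
    moreover have "(\<lambda>n. \<Sum>l<4. \<i> ^ l * f n (A l) x i) = (\<lambda>n. f n T x i)"
      unfolding A(2) qop_tc_comb[OF f A(1)] by (simp add: tc_comb_def)
    ultimately show ?thesis unfolding E_def by (simp add: convergent_LIMSEQ_iff)
  qed
  have out: "E T x i = 0" if T: "T \<in> trace_class I" and xi: "x \<notin> ell2 I \<or> i \<notin> I" for T x i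
  proof -
    have "f n T x i = 0" for n
      using xi bounded_op_outside[OF trace_class_bounded[OF qop_trace_class[OF f T]]]
        ell2_outside[OF bounded_op_ell2[OF trace_class_bounded[OF qop_trace_class[OF f T]]]] by auto
    then show ?thesis by (simp add: E_def)
  qed
  have E: "quantum_operation I E"
    by (rule qop_weak_limit[where f = f, OF sequentially_bot always_eventually lim out])
      (use f in blast)
  have ipl: "(\<lambda>n. ip I x (f n \<rho> x)) \<longlonglongrightarrow> ip I x (E \<rho> x)" if \<rho>: "\<rho> \<in> pos_tc I" and x: "x \<in> ell2 I" for \<rho> x
  proof -
    note t = pos_tc_trace_class[OF \<rho>]
    have ev: "\<forall>\<^sub>F n in sequentially. f n \<rho> \<in> pos_tc I \<and> rtr I (f n \<rho>) \<le> rtr I \<rho>"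
      using fpos[OF \<rho>] frtr[OF \<rho>] by simp
    show ?thesis by (rule pos_tc_weak_limit(3)[OF sequentially_bot ev lim[OF t] out[OF t] x x])
  qed
  have Epos: "E \<rho> \<in> pos_tc I" if "\<rho> \<in> pos_tc I" for \<rho> by (rule qop_pos[OF E that])
  have fE: "lowner I (f m \<rho>) (E \<rho>)" if \<rho>: "\<rho> \<in> pos_tc I" for m \<rho>
  proof (rule lowner_ipI[OF pos_tc_bounded[OF fpos[OF \<rho>]] pos_tc_bounded[OF Epos[OF \<rho>]]])
    fix x assume x: "x \<in> ell2 I"
    have "\<forall>\<^sub>F n in sequentially. ip I x (f n \<rho> x) - ip I x (f m \<rho> x) \<in> \<real>\<^sub>\<ge>\<^sub>0"
      using eventually_ge_at_top[of m]
      by eventually_elim (rule lowner_ipD[OF pos_tc_bounded[OF fpos[OF \<rho>]] pos_tc_bounded[OF fpos[OF \<rho>]] le[OF \<rho>] x])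
    then show "ip I x (E \<rho> x) - ip I x (f m \<rho> x) \<in> \<real>\<^sub>\<ge>\<^sub>0"
      by (rule tendsto_nonneg_Reals[OF sequentially_bot tendsto_diff[OF ipl[OF \<rho> x] tendsto_const]])
  qed
  \<comment> \<open>The weak limit gives one inequality. The other holds because \<open>E\<close>
    dominates every \<open>f n\<close>, so no trace is lost although the entries are only known to
    converge weakly.\<close>
  have rlim: "(\<lambda>n. rtr I (f n \<rho>)) \<longlonglongrightarrow> rtr I (E \<rho>)" if \<rho>: "\<rho> \<in> pos_tc I" for \<rho>
  proof -
    note t = pos_tc_trace_class[OF \<rho>]
    obtain l where l: "(\<lambda>n. rtr I (f n \<rho>)) \<longlonglongrightarrow> l" using conv[OF \<rho>] by (auto simp: convergent_def)
    have mono: "incseq (\<lambda>n. rtr I (f n \<rho>))"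
      by (rule incseq_SucI) (rule lowner_rtr_mono[OF fpos[OF \<rho>] fpos[OF \<rho>] inc[OF \<rho>]])
    have ev: "\<forall>\<^sub>F n in sequentially. f n \<rho> \<in> pos_tc I \<and> rtr I (f n \<rho>) \<le> l"
      using fpos[OF \<rho>] incseq_le[OF mono l] by simp
    have "rtr I (E \<rho>) \<le> l"
      by (rule pos_tc_weak_limit(2)[OF sequentially_bot ev lim[OF t] out[OF t]])
    moreover have "l \<le> rtr I (E \<rho>)"
      by (rule LIMSEQ_le_const2[OF l]) (intro exI allI impI, rule lowner_rtr_mono[OF fpos[OF \<rho>] Epos[OF \<rho>] fE[OF \<rho>]])
    ultimately show ?thesis using l by simp
  qed
  have "is_qlub I f E"
    unfolding is_qlub_def
  proof (intro conjI allI impI E)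
    show "superop_le I (f n) E" for n using fE by (auto simp: superop_le_def pdo_def)
    fix G assume G: "quantum_operation I G \<and> (\<forall>n. superop_le I (f n) G)"
    show "superop_le I E G" unfolding superop_le_def
    proof
      fix \<rho> assume "\<rho> \<in> pdo I"
      then have \<rho>: "\<rho> \<in> pos_tc I" by (simp add: pdo_def)
      have Gpos: "G \<rho> \<in> pos_tc I" using qop_pos[OF _ \<rho>] G by blast
      have fG: "lowner I (f n \<rho>) (G \<rho>)" for n using superop_le_pos_tc[OF f _ _ \<rho>] G by blast
      show "lowner I (E \<rho>) (G \<rho>)"
      proof (rule lowner_ipI[OF pos_tc_bounded[OF Epos[OF \<rho>]] pos_tc_bounded[OF Gpos]])
        fix x assume x: "x \<in> ell2 I"
        show "ip I x (G \<rho> x) - ip I x (E \<rho> x) \<in> \<real>\<^sub>\<ge>\<^sub>0"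
          by (rule tendsto_nonneg_Reals[OF sequentially_bot tendsto_diff[OF tendsto_const ipl[OF \<rho> x]]])
            (intro always_eventually allI lowner_ipD[OF pos_tc_bounded[OF fpos[OF \<rho>]] pos_tc_bounded[OF Gpos] fG x])
      qed
    qed
  qed
  with rlim show ?thesis by blast
qed

lemma is_qlub_unique:
  assumes "is_qlub I f E" "is_qlub I f G" "\<rho> \<in> pos_tc I" shows "E \<rho> = G \<rho>"
proof -
  have E: "quantum_operation I E" and G: "quantum_operation I G" and le: "superop_le I E G" "superop_le I G E"
    using assms(1,2) by (auto simp: is_qlub_def)
  note pos = qop_pos[OF E assms(3)] qop_pos[OF G assms(3)]
  show ?thesis
    by (rule lowner_rtr_eq[OF pos superop_le_pos_tc[OF E G le(1) assms(3)]
          lowner_rtr_mono[OF pos(2,1) superop_le_pos_tc[OF G E le(2) assms(3)]]])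
qed

text \<open>\<open>qlub\<close> may select a map other than the constructed limit. Uniqueness on
  \<open>pos_tc I\<close> carries the convergence of traces over to it.\<close>

lemma qlub_increasing:
  assumes f: "\<And>n. quantum_operation I (f n)"
    and inc: "\<And>n \<rho>. \<rho> \<in> pos_tc I \<Longrightarrow> lowner I (f n \<rho>) (f (Suc n) \<rho>)"
  shows "is_qlub I f (qlub I f)"
    and "\<rho> \<in> pos_tc I \<Longrightarrow> (\<lambda>n. rtr I (f n \<rho>)) \<longlonglongrightarrow> rtr I (qlub I f \<rho>)"
proof -
  obtain E where E: "is_qlub I f E"
    and lim: "\<forall>\<rho>\<in>pos_tc I. (\<lambda>n. rtr I (f n \<rho>)) \<longlonglongrightarrow> rtr I (E \<rho>)"
    using increasing_quantum_operations_limit[where f = f, OF f inc] by blast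
  show q: "is_qlub I f (qlub I f)" unfolding qlub_def using E by (rule someI[where P = "is_qlub I f"])
  show "(\<lambda>n. rtr I (f n \<rho>)) \<longlonglongrightarrow> rtr I (qlub I f \<rho>)" if "\<rho> \<in> pos_tc I"
    using bspec[OF lim that] is_qlub_unique[OF E q that] by simp
qed

section \<open>Operators on registers\<close>

lemma reg_Nil: "reg B [] = {[]}"
  by (simp add: reg_def)

lemma reg_Cons: "bs \<in> reg B (q # qs) \<longleftrightarrow> (\<exists>b cs. bs = b # cs \<and> b \<in> B q \<and> cs \<in> reg B qs)"
  by (auto simp: reg_def set_Cons_def)

lemma reg_length: "bs \<in> reg B qs \<Longrightarrow> length bs = length qs"
  by (induction qs arbitrary: bs) (auto simp: reg_Nil reg_Cons)

lemma update_Nil [simp]: "update \<sigma> [] bs = \<sigma>"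
  by (simp add: update_def)

lemma update_Cons [simp]: "update \<sigma> (q # qs) (b # bs) = (update \<sigma> qs bs)(q := b)"
  by (auto simp: update_def fun_eq_iff)

lemma update_notin: "q \<notin> set qs \<Longrightarrow> update \<sigma> qs bs q = \<sigma> q"
  by (auto simp: update_def split: option.splits dest!: map_of_SomeD set_zip_leftD)

lemma map_update: "distinct qs \<Longrightarrow> length bs = length qs \<Longrightarrow> map (update \<sigma> qs bs) qs = bs"
  by (induction qs arbitrary: bs) (auto simp: length_Suc_conv)

lemma map_update_disjoint: "set qs \<inter> set rs = {} \<Longrightarrow> map (update \<sigma> rs bs) qs = map \<sigma> qs"
  by (intro map_cong refl update_notin) auto

lemma update_self [simp]: "update \<sigma> qs (map \<sigma> qs) = \<sigma>"
  by (induction qs) auto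

lemma update_in: "length bs = length qs \<Longrightarrow> q \<in> set qs \<Longrightarrow> update \<sigma> qs bs q = update \<tau> qs bs q"
  by (induction qs arbitrary: bs) (auto simp: length_Suc_conv)

lemma update_update:
  "length cs = length qs \<Longrightarrow> update (update \<sigma> qs bs) qs cs = update \<sigma> qs cs"
  by (rule ext, case_tac "x \<in> set qs") (auto simp: update_notin intro: update_in)

lemma update_commute:
  assumes "set qs \<inter> set rs = {}"
  shows "update (update \<sigma> qs bs) rs cs = update (update \<sigma> rs cs) qs bs"
proof
  fix q
  show "update (update \<sigma> qs bs) rs cs q = update (update \<sigma> rs cs) qs bs q"
  proof (cases "q \<in> set qs")
    case True
    then have "q \<notin> set rs" using assms by auto
    then have "update (update \<sigma> qs bs) rs cs q = update \<sigma> qs bs q" by (rule update_notin)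
    also have "\<dots> = update (update \<sigma> rs cs) qs bs q"
      using update_notin[OF \<open>q \<notin> set rs\<close>, of \<sigma> cs] by (simp add: update_def split: option.splits)
    finally show ?thesis .
  next
    case False
    have "update (update \<sigma> rs cs) qs bs q = update \<sigma> rs cs q" using False by (rule update_notin)
    also have "\<dots> = update (update \<sigma> qs bs) rs cs q"
      using update_notin[OF False, of \<sigma> bs] by (simp add: update_def split: option.splits)
    finally show ?thesis by simp
  qed
qed

lemma update_mem:
  assumes "composite_basis B S" "\<sigma> \<in> S" "bs \<in> reg B qs" shows "update \<sigma> qs bs \<in> S"
  using assms(3)
proof (induction qs arbitrary: bs)
  case (Cons q qs)
  then obtain b cs where "bs = b # cs" "b \<in> B q" "cs \<in> reg B qs" by (auto simp: reg_Cons)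
  moreover from this have "(update \<sigma> qs cs)(q := b) \<in> S"
    using Cons.IH[of cs] assms(1) unfolding composite_basis_def by blast
  ultimately show ?case by (simp only: update_Cons)
qed (use assms in \<open>simp add: reg_Nil\<close>)

lemma map_mem_reg: "composite_basis B S \<Longrightarrow> \<sigma> \<in> S \<Longrightarrow> map \<sigma> qs \<in> reg B qs"
  by (induction qs) (auto simp: reg_Nil reg_Cons composite_basis_def)

section \<open>Slices, and extensions of register operators\<close>

text \<open>The vector that \<open>extend\<close> hands to the register operator. It depends on
  \<open>\<sigma>\<close> only outside \<open>qs\<close>, so the slices present the whole space as a
  direct sum of copies of the register space.\<close>

definition slice :: "('v \<Rightarrow> 'b set) \<Rightarrow> 'v list \<Rightarrow> ('v \<Rightarrow> 'b) \<Rightarrow> ('v \<Rightarrow> 'b) vect \<Rightarrow> 'b list vect" where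
  "slice B qs \<sigma> x = (\<lambda>bs. if bs \<in> reg B qs then x (update \<sigma> qs bs) else 0)"

lemma extend_apply:
  "x \<in> ell2 S \<Longrightarrow> \<sigma> \<in> S \<Longrightarrow> extend B S qs A x \<sigma> = A (slice B qs \<sigma> x) (map \<sigma> qs)"
  by (simp add: extend_def slice_def)

lemma extend_outside: "x \<notin> ell2 S \<or> \<sigma> \<notin> S \<Longrightarrow> extend B S qs A x \<sigma> = 0"
  by (auto simp: extend_def)

lemma slice_add: "slice B qs \<sigma> (x + y) = slice B qs \<sigma> x + slice B qs \<sigma> y"
  by (auto simp: slice_def fun_eq_iff)

lemma slice_scale: "slice B qs \<sigma> (\<lambda>i. c * x i) = (\<lambda>i. c * slice B qs \<sigma> x i)"
  by (auto simp: slice_def fun_eq_iff)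

lemma slice_update:
  "bs \<in> reg B qs \<Longrightarrow> slice B qs (update \<sigma> qs bs) x = slice B qs \<sigma> x"
  by (auto simp: slice_def fun_eq_iff update_update reg_length)

text \<open>Configurations that agree outside \<open>qs\<close> give the same slice, so each class
  is represented by the member whose register part is that of a fixed \<open>r\<close>. Different
  representatives have slices over disjoint sets of configurations, and the squared norms add up to
  at most that of \<open>x\<close>.\<close>

lemma slice_sum_le:
  assumes cb: "composite_basis B S" and d: "distinct qs" and x: "x \<in> ell2 S" and r: "r \<in> S"
    and H: "finite H" "H \<subseteq> (\<lambda>\<sigma>. update \<sigma> qs (map r qs)) ` S" and K: "finite K" "K \<subseteq> reg B qs"
  shows "(\<Sum>\<sigma>\<in>H. \<Sum>bs\<in>K. (cmod (slice B qs \<sigma> x bs))\<^sup>2) \<le> (nrm S x)\<^sup>2"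
proof -
  let ?u = "\<lambda>(\<sigma>, bs). update \<sigma> qs bs"
  have HS: "H \<subseteq> S" using H(2) update_mem[OF cb _ map_mem_reg[OF cb r]] by auto
  have base: "update \<sigma> qs (map r qs) = \<sigma>" if "\<sigma> \<in> H" for \<sigma>
    using that H(2) by (auto simp: update_update)
  have inj: "inj_on ?u (H \<times> K)"
  proof (rule inj_onI, clarify)
    fix \<sigma> bs \<tau> cs assume a: "\<sigma> \<in> H" "bs \<in> K" "\<tau> \<in> H" "cs \<in> K" "update \<sigma> qs bs = update \<tau> qs cs"
    have l: "length bs = length qs" "length cs = length qs" using a K reg_length by blast+
    have "bs = map (update \<sigma> qs bs) qs" "cs = map (update \<tau> qs cs) qs" 
      by (rule map_update[OF d l(1), symmetric], rule map_update[OF d l(2), symmetric])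
    then have "bs = cs" using a(5) by simp
    have "\<sigma> = update (update \<sigma> qs bs) qs (map r qs)" using base[OF a(1)] by (simp add: update_update)
    also have "\<dots> = \<tau>" unfolding a(5) using base[OF a(3)] by (simp add: update_update)
    finally show "\<sigma> = \<tau> \<and> bs = cs" using \<open>bs = cs\<close> by simp
  qed
  have "(\<Sum>\<sigma>\<in>H. \<Sum>bs\<in>K. (cmod (slice B qs \<sigma> x bs))\<^sup>2) = (\<Sum>p\<in>H \<times> K. (cmod (x (?u p)))\<^sup>2)"
    unfolding sum.cartesian_product using K(2) by (intro sum.cong) (auto simp: slice_def)
  also have "\<dots> = (\<Sum>\<sigma>\<in>?u ` (H \<times> K). (cmod (x \<sigma>))\<^sup>2)"
    by (simp add: sum.reindex[OF inj] o_def)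
  also have "\<dots> \<le> (nrm S x)\<^sup>2"
  proof (rule sum_le_nrm[OF x])
    show "finite (?u ` (H \<times> K))" using H K by auto
    show "?u ` (H \<times> K) \<subseteq> S" using HS K by (auto intro!: update_mem[OF cb])
  qed
  finally show ?thesis .
qed

lemma slice_ell2:
  assumes cb: "composite_basis B S" and d: "distinct qs" and x: "x \<in> ell2 S" and \<sigma>: "\<sigma> \<in> S"
  shows "slice B qs \<sigma> x \<in> ell2 (reg B qs)"
proof (rule ell2_boundI)
  fix K assume K: "finite K" "K \<subseteq> reg B qs"
  show "(\<Sum>bs\<in>K. (cmod (slice B qs \<sigma> x bs))\<^sup>2) \<le> (nrm S x)\<^sup>2"
    using slice_sum_le[OF cb d x \<sigma> _ _ K, of "{\<sigma>}"] \<sigma> by (force simp: image_iff)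
qed (simp add: slice_def)

lemma slice_nrm_sum_le:
  assumes cb: "composite_basis B S" and d: "distinct qs" and x: "x \<in> ell2 S" and r: "r \<in> S"
    and H: "finite H" "H \<subseteq> (\<lambda>\<sigma>. update \<sigma> qs (map r qs)) ` S"
  shows "(\<Sum>\<sigma>\<in>H. (nrm (reg B qs) (slice B qs \<sigma> x))\<^sup>2) \<le> (nrm S x)\<^sup>2"
proof (rule has_sum_le_finite_sums)
  have "((\<lambda>bs. (cmod (slice B qs \<sigma> x bs))\<^sup>2) has_sum (nrm (reg B qs) (slice B qs \<sigma> x))\<^sup>2) (reg B qs)"
    if "\<sigma> \<in> H" for \<sigma>
  proof -
    have "\<sigma> \<in> S" using that H(2) update_mem[OF cb _ map_mem_reg[OF cb r]] by auto
    then show ?thesis using ell2_summable[OF slice_ell2[OF cb d x]] by (simp add: nrm_sq)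
  qed
  then show "((\<lambda>bs. \<Sum>\<sigma>\<in>H. (cmod (slice B qs \<sigma> x bs))\<^sup>2) has_sum
      (\<Sum>\<sigma>\<in>H. (nrm (reg B qs) (slice B qs \<sigma> x))\<^sup>2)) (reg B qs)"
    by (rule has_sum_finite_sum)
  fix K assume K: "finite K" "K \<subseteq> reg B qs"
  show "(\<Sum>bs\<in>K. \<Sum>\<sigma>\<in>H. (cmod (slice B qs \<sigma> x bs))\<^sup>2) \<le> (nrm S x)\<^sup>2"
    using slice_sum_le[OF cb d x r H K] by (subst sum.swap)
qed

text \<open>In each summand of the direct sum of slices an extended operator acts as the register
  operator, so a joint bound for a family on the register passes to the extensions with the same
  constant. One operator with \<open>C = K\<^sup>2\<close> gives boundedness; \<open>C = 1\<close>
  gives contractions and Kraus families.\<close>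

lemma extend_family:
  assumes cb: "composite_basis B S" and d: "distinct qs" and x: "x \<in> ell2 S"
    and G: "finite G" and A: "\<And>m y. m \<in> G \<Longrightarrow> y \<in> ell2 (reg B qs) \<Longrightarrow> A m y \<in> ell2 (reg B qs)"
    and C: "0 \<le> C" "\<And>y. y \<in> ell2 (reg B qs) \<Longrightarrow> (\<Sum>m\<in>G. (nrm (reg B qs) (A m y))\<^sup>2) \<le> C * (nrm (reg B qs) y)\<^sup>2"
  shows "m \<in> G \<Longrightarrow> extend B S qs (A m) x \<in> ell2 S"
    and "(\<Sum>m\<in>G. (nrm S (extend B S qs (A m) x))\<^sup>2) \<le> C * (nrm S x)\<^sup>2"
proof -
  let ?X = "\<lambda>m. extend B S qs (A m) x"
  obtain r where r: "r \<in> S" using cb by (auto simp: composite_basis_def)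
  define base where "base \<sigma> = update \<sigma> qs (map r qs)" for \<sigma>
  have baseS: "base \<sigma> \<in> S" if "\<sigma> \<in> S" for \<sigma>
    unfolding base_def by (rule update_mem[OF cb that map_mem_reg[OF cb r]])
  have main: "(\<Sum>m\<in>G. \<Sum>\<sigma>\<in>F. (cmod (?X m \<sigma>))\<^sup>2) \<le> C * (nrm S x)\<^sup>2" if F: "finite F" "F \<subseteq> S" for F
  proof -
    define H where "H = base ` F"
    define K where "K = (\<lambda>\<sigma>. map \<sigma> qs) ` F"
    define h where "h m = (\<lambda>(\<sigma>, bs). (cmod (A m (slice B qs \<sigma> x) bs))\<^sup>2)" for m
    have H: "finite H" "H \<subseteq> (\<lambda>\<sigma>. update \<sigma> qs (map r qs)) ` S" "H \<subseteq> S"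
    proof -
      show "finite H" using F by (simp add: H_def)
      show "H \<subseteq> (\<lambda>\<sigma>. update \<sigma> qs (map r qs)) ` S"
        unfolding H_def base_def by (rule image_mono[OF F(2)])
      show "H \<subseteq> S" using F(2) baseS by (auto simp: H_def)
    qed
    have K: "finite K" "K \<subseteq> reg B qs"
      using F by (auto simp: K_def intro!: map_mem_reg[OF cb])
    \<comment> \<open>A configuration is recovered from its representative and its register part;
      the sum over \<open>F\<close> thus embeds into one over the product
      \<open>H \<times> K\<close>.\<close>
    have inj: "inj_on (\<lambda>\<sigma>. (base \<sigma>, map \<sigma> qs)) F"
    proof (rule inj_onI)
      fix \<sigma> \<tau> assume "(base \<sigma>, map \<sigma> qs) = (base \<tau>, map \<tau> qs)"
      then have e: "base \<sigma> = base \<tau>" "map \<sigma> qs = map \<tau> qs" by (simp_all only: prod.inject)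
      have "\<sigma> = update (base \<sigma>) qs (map \<sigma> qs)" by (simp add: base_def update_update)
      also have "\<dots> = update (base \<tau>) qs (map \<tau> qs)" by (simp only: e)
      also have "\<dots> = \<tau>" by (simp add: base_def update_update)
      finally show "\<sigma> = \<tau>" .
    qed
    have 1: "(\<Sum>\<sigma>\<in>F. (cmod (?X m \<sigma>))\<^sup>2) \<le> (\<Sum>\<sigma>\<in>H. (nrm (reg B qs) (A m (slice B qs \<sigma> x)))\<^sup>2)"
      if m: "m \<in> G" for m
    proof -
      have "(\<Sum>\<sigma>\<in>F. (cmod (?X m \<sigma>))\<^sup>2) = (\<Sum>\<sigma>\<in>F. h m (base \<sigma>, map \<sigma> qs))"
      proof (rule sum.cong[OF refl])
        fix \<sigma> assume "\<sigma> \<in> F"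
        then have "\<sigma> \<in> S" using F by auto
        moreover have "slice B qs (base \<sigma>) x = slice B qs \<sigma> x"
          unfolding base_def by (rule slice_update[OF map_mem_reg[OF cb r]])
        ultimately show "(cmod (?X m \<sigma>))\<^sup>2 = h m (base \<sigma>, map \<sigma> qs)"
          using x by (simp add: extend_apply h_def)
      qed
      also have "\<dots> = (\<Sum>p\<in>(\<lambda>\<sigma>. (base \<sigma>, map \<sigma> qs)) ` F. h m p)"
        by (simp add: sum.reindex[OF inj] o_def)
      also have "\<dots> \<le> (\<Sum>p\<in>H \<times> K. h m p)"
        using H K by (intro sum_mono2) (auto simp: H_def K_def h_def)
      also have "\<dots> = (\<Sum>\<sigma>\<in>H. \<Sum>bs\<in>K. (cmod (A m (slice B qs \<sigma> x) bs))\<^sup>2)"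
        by (simp add: sum.cartesian_product h_def)
      also have "\<dots> \<le> (\<Sum>\<sigma>\<in>H. (nrm (reg B qs) (A m (slice B qs \<sigma> x)))\<^sup>2)"
        using H(3) by (intro sum_mono sum_le_nrm A[OF m] slice_ell2[OF cb d x] K) auto
      finally show ?thesis .
    qed
    have "(\<Sum>m\<in>G. \<Sum>\<sigma>\<in>F. (cmod (?X m \<sigma>))\<^sup>2) \<le> (\<Sum>m\<in>G. \<Sum>\<sigma>\<in>H. (nrm (reg B qs) (A m (slice B qs \<sigma> x)))\<^sup>2)"
      by (rule sum_mono[OF 1])
    also have "\<dots> = (\<Sum>\<sigma>\<in>H. \<Sum>m\<in>G. (nrm (reg B qs) (A m (slice B qs \<sigma> x)))\<^sup>2)" by (rule sum.swap)
    also have "\<dots> \<le> (\<Sum>\<sigma>\<in>H. C * (nrm (reg B qs) (slice B qs \<sigma> x))\<^sup>2)"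
      using H(3) by (intro sum_mono C(2) slice_ell2[OF cb d x]) auto
    also have "\<dots> \<le> C * (nrm S x)\<^sup>2"
      unfolding sum_distrib_left[symmetric]
      by (rule mult_left_mono[OF slice_nrm_sum_le[OF cb d x r H(1,2)] C(1)])
    finally show ?thesis .
  qed
  show X: "?X m \<in> ell2 S" if m: "m \<in> G" for m
  proof (rule ell2_boundI)
    fix F assume F: "finite F" "F \<subseteq> S"
    have "(\<Sum>\<sigma>\<in>F. (cmod (?X m \<sigma>))\<^sup>2) \<le> (\<Sum>m\<in>G. \<Sum>\<sigma>\<in>F. (cmod (?X m \<sigma>))\<^sup>2)"
      by (rule member_le_sum[OF m _ G]) (auto intro: sum_nonneg)
    with main[OF F] show "(\<Sum>\<sigma>\<in>F. (cmod (?X m \<sigma>))\<^sup>2) \<le> C * (nrm S x)\<^sup>2" by linarith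
  qed (simp add: extend_outside)
  have "((\<lambda>\<sigma>. \<Sum>m\<in>G. (cmod (?X m \<sigma>))\<^sup>2) has_sum (\<Sum>m\<in>G. (nrm S (?X m))\<^sup>2)) S"
    by (rule has_sum_finite_sum) (use ell2_summable[OF X] in \<open>simp add: nrm_sq\<close>)
  then show "(\<Sum>m\<in>G. (nrm S (?X m))\<^sup>2) \<le> C * (nrm S x)\<^sup>2"
  proof (rule has_sum_le_finite_sums)
    fix F assume F: "finite F" "F \<subseteq> S"
    show "(\<Sum>\<sigma>\<in>F. \<Sum>m\<in>G. (cmod (?X m \<sigma>))\<^sup>2) \<le> C * (nrm S x)\<^sup>2"
      using main[OF F] by (subst sum.swap)
  qed
qed

lemma bounded_op_extend:
  assumes cb: "composite_basis B S" and d: "distinct qs" and A: "bounded_op (reg B qs) A"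
  shows "bounded_op S (extend B S qs A)"
proof -
  obtain K where K: "K \<ge> 0" "\<And>x. x \<in> ell2 (reg B qs) \<Longrightarrow> nrm (reg B qs) (A x) \<le> K * nrm (reg B qs) x"
    using bounded_op_bound[OF A] by auto
  have K2: "(\<Sum>m\<in>{()}. (nrm (reg B qs) (A y))\<^sup>2) \<le> K\<^sup>2 * (nrm (reg B qs) y)\<^sup>2" if "y \<in> ell2 (reg B qs)" for y
    using power_mono[OF K(2)[OF that] nrm_nonneg, of 2] by (simp add: power_mult_distrib)
  have f: "extend B S qs A x \<in> ell2 S" "(nrm S (extend B S qs A x))\<^sup>2 \<le> K\<^sup>2 * (nrm S x)\<^sup>2" if "x \<in> ell2 S" for x
    using extend_family[OF cb d that, of "{()}" "\<lambda>_. A", OF _ bounded_op_ell2[OF A] _ K2] by auto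
  have n: "nrm S (extend B S qs A x) \<le> K * nrm S x" if "x \<in> ell2 S" for x
    by (rule power2_le_imp_le) (use f(2)[OF that] K in \<open>auto simp: power_mult_distrib\<close>)
  show ?thesis unfolding bounded_op_def
  proof (intro conjI ballI allI impI)
    fix x y assume xy: "x \<in> ell2 S" "y \<in> ell2 S"
    show "extend B S qs A (x + y) = extend B S qs A x + extend B S qs A y"
    proof
      fix \<sigma>
      show "extend B S qs A (x + y) \<sigma> = (extend B S qs A x + extend B S qs A y) \<sigma>"
      proof (cases "\<sigma> \<in> S")
        case True
        have "A (slice B qs \<sigma> x + slice B qs \<sigma> y) = A (slice B qs \<sigma> x) + A (slice B qs \<sigma> y)"
          by (rule bounded_op_add[OF A slice_ell2[OF cb d xy(1) True] slice_ell2[OF cb d xy(2) True]])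
        then show ?thesis
          unfolding plus_fun_apply[of "extend B S qs A x"] extend_apply[OF ell2_add[OF xy] True]
            extend_apply[OF xy(1) True] extend_apply[OF xy(2) True] slice_add by simp
      qed (simp add: extend_outside)
    qed
  next
    fix c x assume x: "x \<in> ell2 S"
    show "extend B S qs A (\<lambda>i. c * x i) = (\<lambda>i. c * extend B S qs A x i)"
    proof
      fix \<sigma>
      show "extend B S qs A (\<lambda>i. c * x i) \<sigma> = c * extend B S qs A x \<sigma>"
      proof (cases "\<sigma> \<in> S")
        case True
        then show ?thesis
          unfolding extend_apply[OF ell2_scale[OF x] True] extend_apply[OF x True] slice_scale
          by (simp add: bounded_op_scale[OF A slice_ell2[OF cb d x True]])
      qed (simp add: extend_outside)
    qed
  next
    fix x assume "x \<notin> ell2 S"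
    then show "extend B S qs A x = 0" by (simp add: fun_eq_iff extend_outside)
  qed (use f n in auto)
qed

lemma slice_extend:
  assumes cb: "composite_basis B S" and d: "distinct qs" and A: "bounded_op (reg B qs) A"
    and x: "x \<in> ell2 S" and \<sigma>: "\<sigma> \<in> S"
  shows "slice B qs \<sigma> (extend B S qs A x) = A (slice B qs \<sigma> x)"
proof
  fix bs
  show "slice B qs \<sigma> (extend B S qs A x) bs = A (slice B qs \<sigma> x) bs"
  proof (cases "bs \<in> reg B qs")
    case True
    then show ?thesis
      unfolding slice_def[of B qs \<sigma> "extend B S qs A x"]
      by (simp add: extend_apply[OF x update_mem[OF cb \<sigma> True]] slice_update map_update[OF d] reg_length)
  next
    case False
    then show ?thesis
      using ell2_outside[OF bounded_op_ell2[OF A] False] by (simp add: slice_def)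
  qed
qed

lemma bounded_op_outer:
  assumes "\<phi> \<in> ell2 I" "\<omega> \<in> ell2 I" shows "bounded_op I (outer I \<phi> \<omega>)"
proof -
  have eq: "outer I \<phi> \<omega> x = (\<lambda>i. ip I \<omega> x * \<phi> i)" if "x \<in> ell2 I" for x
    using that by (auto simp: outer_def)
  have b1: "nrm I (outer I \<phi> \<omega> x) \<le> (nrm I \<omega> * nrm I \<phi>) * nrm I x" if "x \<in> ell2 I" for x
    using mult_right_mono[OF ip_bound[OF assms(2) that] nrm_nonneg[of I \<phi>]]
    unfolding eq[OF that] nrm_scale by (simp only: mult_ac)
  have b2: "outer I \<phi> \<omega> (x + y) = outer I \<phi> \<omega> x + outer I \<phi> \<omega> y" if "x \<in> ell2 I" "y \<in> ell2 I" for x y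
    unfolding eq[OF ell2_add[OF that]] eq[OF that(1)] eq[OF that(2)] ip_add_right[OF assms(2) that]
    by (auto simp: distrib_right)
  have b3: "outer I \<phi> \<omega> x \<in> ell2 I" if "x \<in> ell2 I" for x
    unfolding eq[OF that] by (rule ell2_scale[OF assms(1)])
  have b4: "outer I \<phi> \<omega> x = 0" if "x \<notin> ell2 I" for x
    using that by (simp add: outer_def fun_eq_iff)
  have b5: "outer I \<phi> \<omega> (\<lambda>i. c * x i) = (\<lambda>i. c * outer I \<phi> \<omega> x i)" if "x \<in> ell2 I" for c x
    unfolding eq[OF that] eq[OF ell2_scale[OF that]] ip_scale_right by (simp only: mult.assoc)
  show ?thesis
    unfolding bounded_op_def
    by (intro conjI ballI allI impI exI[of _ "nrm I \<omega> * nrm I \<phi>"]) (rule b1 b2 b3 b4 b5; assumption)+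
qed

lemma nrm_outer: "x \<in> ell2 I \<Longrightarrow> nrm I (outer I \<phi> \<omega> x) = cmod (ip I \<omega> x) * nrm I \<phi>"
proof -
  assume x: "x \<in> ell2 I"
  then have "outer I \<phi> \<omega> x = (\<lambda>i. ip I \<omega> x * \<phi> i)" by (auto simp: outer_def)
  then show ?thesis by (simp add: nrm_scale)
qed

text \<open>The clause for initialisation has the reversed outer product where a conjugation has an
  adjoint; this identifies the two. The column of the extension at \<open>\<sigma>\<close> lives on
  the configurations that agree with \<open>\<sigma>\<close> outside \<open>qs\<close>, and these
  are parametrised by the register basis, so the inner product over \<open>S\<close> becomes one
  over the register.\<close>

lemma adj_extend_outer:
  assumes cb: "composite_basis B S" and d: "distinct qs"
    and \<phi>: "\<phi> \<in> ell2 (reg B qs)" and \<omega>: "\<omega> \<in> ell2 (reg B qs)"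
  shows "adj S (extend B S qs (outer (reg B qs) \<phi> \<omega>)) = extend B S qs (outer (reg B qs) \<omega> \<phi>)"
proof (intro ext)
  fix x \<sigma>
  let ?R = "reg B qs"
  show "adj S (extend B S qs (outer ?R \<phi> \<omega>)) x \<sigma> = extend B S qs (outer ?R \<omega> \<phi>) x \<sigma>"
  proof (cases "x \<in> ell2 S \<and> \<sigma> \<in> S")
    case True
    then have x: "x \<in> ell2 S" and \<sigma>: "\<sigma> \<in> S" by auto
    note s = map_mem_reg[OF cb \<sigma>, of qs]
    have v: "extend B S qs (outer ?R \<phi> \<omega>) (ket \<sigma>) \<tau> =
        (if update \<tau> qs (map \<sigma> qs) = \<sigma> then \<phi> (map \<tau> qs) * cnj (\<omega> (map \<sigma> qs)) else 0)" if \<tau>: "\<tau> \<in> S" for \<tau>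
    proof -
      have "slice B qs \<tau> (ket \<sigma>) = (if update \<tau> qs (map \<sigma> qs) = \<sigma> then ket (map \<sigma> qs) else 0)"
      proof
        fix bs
        have "update \<tau> qs bs = \<sigma> \<longleftrightarrow> update \<tau> qs (map \<sigma> qs) = \<sigma> \<and> bs = map \<sigma> qs" if "bs \<in> ?R"
          using map_update[OF d reg_length[OF that]] by metis
        then show "slice B qs \<tau> (ket \<sigma>) bs = (if update \<tau> qs (map \<sigma> qs) = \<sigma> then ket (map \<sigma> qs) else 0) bs"
          using s by (auto simp: slice_def ket_def)
      qed
      then show ?thesis
        using slice_ell2[OF cb d ket_ell2[OF \<sigma>] \<tau>] s
        by (auto simp: extend_apply[OF ket_ell2[OF \<sigma>] \<tau>] outer_def ip_ket_right)
    qed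
    have bij: "bij_betw (update \<sigma> qs) ?R {\<tau> \<in> S. update \<tau> qs (map \<sigma> qs) = \<sigma>}"
    proof (rule bij_betw_byWitness[where f' = "\<lambda>\<tau>. map \<tau> qs"])
      show "\<forall>bs\<in>?R. map (update \<sigma> qs bs) qs = bs" using map_update[OF d] reg_length by blast
      show "\<forall>\<tau>\<in>{\<tau> \<in> S. update \<tau> qs (map \<sigma> qs) = \<sigma>}. update \<sigma> qs (map \<tau> qs) = \<tau>"
      proof clarify
        fix \<tau> assume e: "update \<tau> qs (map \<sigma> qs) = \<sigma>"
        have "update (update \<tau> qs (map \<sigma> qs)) qs (map \<tau> qs) = \<tau>" by (simp add: update_update)
        then show "update \<sigma> qs (map \<tau> qs) = \<tau>" unfolding e .
      qed
      show "update \<sigma> qs ` ?R \<subseteq> {\<tau> \<in> S. update \<tau> qs (map \<sigma> qs) = \<sigma>}"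
        using update_mem[OF cb \<sigma>] by (auto simp: update_update)
      show "(\<lambda>\<tau>. map \<tau> qs) ` {\<tau> \<in> S. update \<tau> qs (map \<sigma> qs) = \<sigma>} \<subseteq> ?R"
        using map_mem_reg[OF cb] by auto
    qed
    have "adj S (extend B S qs (outer ?R \<phi> \<omega>)) x \<sigma> =
        (\<Sum>\<^sub>\<infinity>\<tau>\<in>S. cnj (extend B S qs (outer ?R \<phi> \<omega>) (ket \<sigma>) \<tau>) * x \<tau>)"
      using x \<sigma> by (simp add: adj_def ip_def)
    also have "\<dots> = (\<Sum>\<^sub>\<infinity>\<tau>\<in>{\<tau> \<in> S. update \<tau> qs (map \<sigma> qs) = \<sigma>}. cnj (\<phi> (map \<tau> qs)) * \<omega> (map \<sigma> qs) * x \<tau>)"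
      by (rule infsum_cong_neutral) (auto simp: v)
    also have "\<dots> = (\<Sum>\<^sub>\<infinity>bs\<in>?R. cnj (\<phi> (map (update \<sigma> qs bs) qs)) * \<omega> (map \<sigma> qs) * x (update \<sigma> qs bs))"
      by (rule infsum_reindex_bij_betw[OF bij, symmetric])
    also have "\<dots> = (\<Sum>\<^sub>\<infinity>bs\<in>?R. \<omega> (map \<sigma> qs) * (cnj (\<phi> bs) * slice B qs \<sigma> x bs))"
      by (rule infsum_cong) (simp add: slice_def map_update[OF d] reg_length)
    also have "\<dots> = \<omega> (map \<sigma> qs) * ip ?R \<phi> (slice B qs \<sigma> x)"
      by (simp add: ip_def infsum_cmult_right')
    also have "\<dots> = extend B S qs (outer ?R \<omega> \<phi>) x \<sigma>"
      by (simp add: extend_apply[OF x \<sigma>] outer_def slice_ell2[OF cb d x \<sigma>])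
    finally show ?thesis .
  next
    case False
    then show ?thesis by (auto simp: adj_def extend_def)
  qed
qed

section \<open>Circuits and measurements\<close>

abbreviation contraction :: "'i set \<Rightarrow> 'i oper \<Rightarrow> bool" where
  "contraction I A \<equiv> (\<forall>x\<in>ell2 I. nrm I (A x) \<le> nrm I x)"

text \<open>On a finite register the inner product in \<open>?P\<close> is a finite sum over basis
  values \<open>c\<close>, so \<open>A\<close> passes through by linearity; disjointness lets the
  two updates commute.\<close>

lemma extend_outer_commute:
  assumes cb: "composite_basis B S" and d: "distinct qs" "distinct rs" and dis: "set qs \<inter> set rs = {}"
    and fin: "finite (reg B qs)" and \<phi>: "\<phi> \<in> ell2 (reg B qs)" and \<omega>: "\<omega> \<in> ell2 (reg B qs)"
    and A: "bounded_op (reg B rs) A" and x: "x \<in> ell2 S"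
  shows "extend B S rs A (extend B S qs (outer (reg B qs) \<phi> \<omega>) x) =
    extend B S qs (outer (reg B qs) \<phi> \<omega>) (extend B S rs A x)"
proof
  fix \<sigma>
  let ?P = "extend B S qs (outer (reg B qs) \<phi> \<omega>)"
  have Px: "?P x \<in> ell2 S"
    by (rule bounded_op_ell2[OF bounded_op_extend[OF cb d(1) bounded_op_outer[OF \<phi> \<omega>]]])
  have Ax: "extend B S rs A x \<in> ell2 S" by (rule bounded_op_ell2[OF bounded_op_extend[OF cb d(2) A]])
  have dis': "set rs \<inter> set qs = {}" using dis by auto
  have P: "?P y \<tau> = (\<Sum>c\<in>reg B qs. \<phi> (map \<tau> qs) * cnj (\<omega> c) * y (update \<tau> qs c))"
    if "y \<in> ell2 S" "\<tau> \<in> S" for y \<tau>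
    using slice_ell2[OF cb d(1) that] fin
    by (simp add: extend_apply[OF that] outer_def ip_def slice_def sum_distrib_left mult.assoc)
  show "extend B S rs A (?P x) \<sigma> = ?P (extend B S rs A x) \<sigma>"
  proof (cases "\<sigma> \<in> S")
    case True
    let ?k = "\<lambda>c. \<phi> (map \<sigma> qs) * cnj (\<omega> c)"
    let ?s = "\<lambda>c. slice B rs (update \<sigma> qs c) x"
    have s: "?s c \<in> ell2 (reg B rs)" if "c \<in> reg B qs" for c
      by (rule slice_ell2[OF cb d(2) x update_mem[OF cb True that]])
    have sl: "slice B rs \<sigma> (?P x) = (\<Sum>c\<in>reg B qs. (\<lambda>bs. ?k c * ?s c bs))"
    proof
      fix bs
      show "slice B rs \<sigma> (?P x) bs = (\<Sum>c\<in>reg B qs. (\<lambda>bs. ?k c * ?s c bs)) bs"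
        using P[OF x update_mem[OF cb True, of bs rs]]
        by (simp add: slice_def sum_apply update_commute[OF dis'] map_update_disjoint[OF dis])
    qed
    have "A (slice B rs \<sigma> (?P x)) = (\<Sum>c\<in>reg B qs. A (\<lambda>bs. ?k c * ?s c bs))"
      unfolding sl by (rule bounded_op_sum[OF A ell2_scale[OF s]])
    also have "\<dots> = (\<Sum>c\<in>reg B qs. (\<lambda>bs. ?k c * A (?s c) bs))"
      by (rule sum.cong[OF refl bounded_op_scale[OF A s]])
    finally have "extend B S rs A (?P x) \<sigma> = (\<Sum>c\<in>reg B qs. ?k c * A (?s c) (map \<sigma> rs))"
      by (simp add: extend_apply[OF Px True] sum_apply)
    also have "\<dots> = ?P (extend B S rs A x) \<sigma>"
      unfolding P[OF Ax True]
      by (rule sum.cong[OF refl])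
        (simp add: extend_apply[OF x update_mem[OF cb True]] map_update_disjoint[OF dis'])
    finally show ?thesis .
  qed (simp add: extend_outside)
qed

section \<open>Finite orthonormal bases\<close>

text \<open>Parseval: expand one of the two arguments of \<open>ip I x x\<close> in the
  basis.\<close>

lemma orthonormal_basis_sum_sq:
  assumes ob: "orthonormal_basis I d \<psi>" and x: "x \<in> ell2 I"
  shows "(\<Sum>i=1..d. (cmod (ip I (\<psi> i) x))\<^sup>2) = (nrm I x)\<^sup>2"
proof -
  have \<psi>: "\<psi> i \<in> ell2 I" if "i \<in> {1..d}" for i using ob that by (simp add: orthonormal_basis_def)
  have e: "x = (\<Sum>i=1..d. (\<lambda>b. ip I (\<psi> i) x * \<psi> i b))" using ob x unfolding orthonormal_basis_def by blast
  have "ip I x x = ip I x (\<Sum>i=1..d. (\<lambda>b. ip I (\<psi> i) x * \<psi> i b))" using e by simp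
  also have "\<dots> = (\<Sum>i=1..d. ip I x (\<lambda>b. ip I (\<psi> i) x * \<psi> i b))"
    by (rule ip_sum_right[OF x ell2_scale[OF \<psi>]])
  also have "\<dots> = (\<Sum>i=1..d. of_real ((cmod (ip I (\<psi> i) x))\<^sup>2))"
  proof (rule sum.cong[OF refl])
    fix i
    have "ip I x (\<psi> i) = cnj (ip I (\<psi> i) x)" by (simp add: ip_cnj)
    then show "ip I x (\<lambda>b. ip I (\<psi> i) x * \<psi> i b) = of_real ((cmod (ip I (\<psi> i) x))\<^sup>2)"
      unfolding ip_scale_right by (simp only: complex_norm_square)
  qed
  finally have "complex_of_real ((nrm I x)\<^sup>2) = of_real (\<Sum>i=1..d. (cmod (ip I (\<psi> i) x))\<^sup>2)"
    by (simp only: ip_self[OF x] of_real_sum)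
  then show ?thesis by (simp only: of_real_eq_iff)
qed

lemma orthonormal_basis_nrm:
  assumes ob: "orthonormal_basis I d \<psi>" and i: "i \<in> {1..d}" shows "nrm I (\<psi> i) = 1"
proof -
  have "\<psi> i \<in> ell2 I" "ip I (\<psi> i) (\<psi> i) = 1" using ob i by (auto simp: orthonormal_basis_def)
  then have "complex_of_real ((nrm I (\<psi> i))\<^sup>2) = of_real 1" by (simp only: ip_self of_real_1)
  then have "(nrm I (\<psi> i))\<^sup>2 = 1\<^sup>2" by (simp only: of_real_eq_iff power_one)
  then show ?thesis by (rule power2_eq_imp_eq) auto
qed

text \<open>Double counting of the weights of \<open>d + 1\<close> vectors \<open>ket b\<close>: by
  Parseval each has total weight 1, while each of the \<open>d\<close> vectors
  \<open>\<psi> i\<close> contributes at most its squared norm 1. Commutation with the branch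
  projections of a quantum case statement rests on this finiteness.\<close>

lemma orthonormal_basis_finite:
  assumes ob: "orthonormal_basis I d \<psi>" shows "finite I"
proof (rule ccontr)
  assume "infinite I"
  then obtain F where F: "finite F" "F \<subseteq> I" "card F = Suc d"
    using infinite_arbitrarily_large by blast
  have "real (card F) = (\<Sum>b\<in>F. \<Sum>i=1..d. (cmod (ip I (\<psi> i) (ket b)))\<^sup>2)"
  proof -
    have "(\<Sum>i=1..d. (cmod (ip I (\<psi> i) (ket b)))\<^sup>2) = 1" if "b \<in> F" for b
    proof -
      have "b \<in> I" using that F by auto
      then show ?thesis using orthonormal_basis_sum_sq[OF ob, of "ket b"] by simp
    qed
    then show ?thesis by simp
  qed
  also have "\<dots> = (\<Sum>i=1..d. \<Sum>b\<in>F. (cmod (ip I (\<psi> i) (ket b)))\<^sup>2)" by (rule sum.swap)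
  also have "\<dots> \<le> (\<Sum>i=1..d. 1)"
  proof (rule sum_mono)
    fix i assume i: "i \<in> {1..d}"
    have \<psi>: "\<psi> i \<in> ell2 I" using ob i by (simp add: orthonormal_basis_def)
    have "(\<Sum>b\<in>F. (cmod (ip I (\<psi> i) (ket b)))\<^sup>2) = (\<Sum>b\<in>F. (cmod (\<psi> i b))\<^sup>2)"
    proof (rule sum.cong[OF refl])
      fix b assume "b \<in> F"
      then have "b \<in> I" using F by auto
      then show "(cmod (ip I (\<psi> i) (ket b)))\<^sup>2 = (cmod (\<psi> i b))\<^sup>2" by (simp add: ip_ket_right)
    qed
    also have "\<dots> \<le> (nrm I (\<psi> i))\<^sup>2" by (rule sum_le_nrm[OF \<psi> F(1,2)])
    finally show "(\<Sum>b\<in>F. (cmod (ip I (\<psi> i) (ket b)))\<^sup>2) \<le> 1" by (simp add: orthonormal_basis_nrm[OF ob i])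
  qed
  finally show False using F(3) by simp
qed

lemma unitary_contraction:
  assumes U: "unitary I U" and x: "x \<in> ell2 I" shows "nrm I (U x) = nrm I x"
proof -
  have b: "bounded_op I U" using U by (simp add: unitary_def)
  have "adj I U (U x) = x" using U x by (auto simp: unitary_def fun_eq_iff idop_def)
  then have "ip I (U x) (U x) = ip I x x" using ip_adj_left[OF b bounded_op_ell2[OF b] x, of x] by simp
  then have "(nrm I (U x))\<^sup>2 = (nrm I x)\<^sup>2"
    unfolding ip_self[OF x] ip_self[OF bounded_op_ell2[OF b]] by (simp only: of_real_eq_iff)
  then show ?thesis by (rule power2_eq_imp_eq) auto
qed

lemma pythagoras:
  assumes f: "\<And>k. k \<in> K \<Longrightarrow> f k \<in> ell2 I" and orth: "\<And>k l. k \<in> K \<Longrightarrow> l \<in> K \<Longrightarrow> k \<noteq> l \<Longrightarrow> ip I (f k) (f l) = 0"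
    and fin: "finite K"
  shows "(nrm I (\<Sum>k\<in>K. f k))\<^sup>2 = (\<Sum>k\<in>K. (nrm I (f k))\<^sup>2)"
proof -
  note s = ell2_sum[of K f I, OF f]
  have "ip I (\<Sum>k\<in>K. f k) (\<Sum>k\<in>K. f k) = (\<Sum>k\<in>K. ip I (f k) (\<Sum>k\<in>K. f k))"
    by (rule ip_sum_left[OF s f])
  also have "\<dots> = (\<Sum>k\<in>K. \<Sum>l\<in>K. ip I (f k) (f l))"
    by (rule sum.cong[OF refl ip_sum_right[OF f f]])
  also have "\<dots> = (\<Sum>k\<in>K. \<Sum>l\<in>K. if l = k then ip I (f k) (f k) else 0)"
    using orth by (intro sum.cong refl) auto
  also have "\<dots> = (\<Sum>k\<in>K. of_real ((nrm I (f k))\<^sup>2))"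
    using fin f by (intro sum.cong refl) (simp add: ip_self)
  finally have "complex_of_real ((nrm I (\<Sum>k\<in>K. f k))\<^sup>2) = of_real (\<Sum>k\<in>K. (nrm I (f k))\<^sup>2)"
    by (simp only: ip_self[OF s] of_real_sum)
  then show ?thesis by (simp only: of_real_eq_iff)
qed

section \<open>Circuits are contractions\<close>

lemma extend_contraction:
  assumes cb: "composite_basis B S" and d: "distinct qs" and A: "bounded_op (reg B qs) A"
    and c: "contraction (reg B qs) A"
  shows "contraction S (extend B S qs A)"
proof
  fix x assume x: "x \<in> ell2 S"
  have K: "(\<Sum>m\<in>{()}. (nrm (reg B qs) (A y))\<^sup>2) \<le> 1 * (nrm (reg B qs) y)\<^sup>2" if "y \<in> ell2 (reg B qs)" for y
    using power_mono[OF c[rule_format, OF that] nrm_nonneg, of 2] by simp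
  have "(nrm S (extend B S qs A x))\<^sup>2 \<le> (nrm S x)\<^sup>2"
    using extend_family(2)[OF cb d x, of "{()}" "\<lambda>_. A", OF _ bounded_op_ell2[OF A] _ K] by simp
  then show "nrm S (extend B S qs A x) \<le> nrm S x" by (rule power2_le_imp_le) simp
qed

lemma bounded_op_projection:
  assumes cb: "composite_basis B S" and d: "distinct qs" and ob: "orthonormal_basis (reg B qs) n \<psi>"
    and i: "i \<in> {1..n}"
  shows "bounded_op S (extend B S qs (outer (reg B qs) (\<psi> i) (\<psi> i)))"
proof -
  have \<psi>: "\<psi> i \<in> ell2 (reg B qs)" using ob i by (simp add: orthonormal_basis_def)
  show ?thesis by (rule bounded_op_extend[OF cb d bounded_op_outer[OF \<psi> \<psi>]])
qed

lemma bounded_op_csem: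
  assumes cb: "composite_basis B S"
  shows "wf_circuit B \<U> C \<Longrightarrow> bounded_op S (csem B S C)"
proof (induction C)
  case CSkip
  show ?case by (simp add: bounded_op_idop)
next
  case (Gate U qs)
  then show ?case by (simp add: bounded_op_extend[OF cb] unitary_def)
next
  case (CSeq C D)
  then have "bounded_op S (csem B S D)" "bounded_op S (csem B S C)" by auto
  then show ?case unfolding csem.simps by (rule bounded_op_comp)
next
  case (QIf qs d \<psi> C)
  have "bounded_op S (extend B S qs (outer (reg B qs) (\<psi> i) (\<psi> i)) \<circ> csem B S (C i))" if i: "i \<in> {1..d}" for i
    by (rule bounded_op_comp[OF bounded_op_projection[OF cb _ _ i]]) (use QIf i in auto)
  then show ?case unfolding csem.simps by (rule bounded_op_sum_ops)
qed

text \<open>In a quantum case statement the projection on the guard follows the branch; commuting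
  lets it act first, on the input that the branch then contracts. Nested case statements are covered
  because their own projections, on disjoint registers, commute as well.\<close>

lemma csem_extend_outer_commute:
  assumes cb: "composite_basis B S" and d: "distinct qs" and fin: "finite (reg B qs)"
    and \<phi>: "\<phi> \<in> ell2 (reg B qs)" and \<omega>: "\<omega> \<in> ell2 (reg B qs)"
  shows "wf_circuit B \<U> C \<Longrightarrow> set qs \<inter> cvars C = {} \<Longrightarrow> x \<in> ell2 S \<Longrightarrow>
    csem B S C (extend B S qs (outer (reg B qs) \<phi> \<omega>) x) =
    extend B S qs (outer (reg B qs) \<phi> \<omega>) (csem B S C x)"
proof (induction C arbitrary: x)
  case CSkip
  note bE = bounded_op_extend[OF cb d bounded_op_outer[OF \<phi> \<omega>]]
  show ?case using bounded_op_ell2[OF bE] CSkip by (simp add: idop_def)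
next
  case (Gate U rs)
  then show ?case using extend_outer_commute[OF cb d _ _ fin \<phi> \<omega>] by (simp add: unitary_def)
next
  case (CSeq C D)
  have "set qs \<inter> cvars C = {}" "set qs \<inter> cvars D = {}" using CSeq.prems by auto
  then show ?case
    using CSeq.IH(1)[of x] CSeq.IH(2)[of "csem B S C x"] CSeq.prems
      bounded_op_ell2[OF bounded_op_csem[OF cb, of \<U> C]] by simp
next
  case (QIf rs n \<psi> C)
  let ?E = "extend B S qs (outer (reg B qs) \<phi> \<omega>)"
  let ?P = "\<lambda>i. extend B S rs (outer (reg B rs) (\<psi> i) (\<psi> i))"
  have rs: "distinct rs" "orthonormal_basis (reg B rs) n \<psi>" "set qs \<inter> set rs = {}" using QIf.prems by auto
  have wf: "wf_circuit B \<U> (C i)" "set qs \<inter> cvars (C i) = {}" if "i \<in> {1..n}" for i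
    using QIf.prems that by auto
  have Cx: "csem B S (C i) x \<in> ell2 S" if "i \<in> {1..n}" for i
    by (rule bounded_op_ell2[OF bounded_op_csem[OF cb wf(1)[OF that]]])
  have PCx: "?P i (csem B S (C i) x) \<in> ell2 S" if "i \<in> {1..n}" for i
    by (rule bounded_op_ell2[OF bounded_op_projection[OF cb rs(1,2) that]])
  have "csem B S (QIf rs n \<psi> C) (?E x) = (\<Sum>i=1..n. ?P i (csem B S (C i) (?E x)))"
    by (simp add: sum_apply)
  also have "\<dots> = (\<Sum>i=1..n. ?E (?P i (csem B S (C i) x)))"
  proof (rule sum.cong[OF refl])
    fix i assume i: "i \<in> {1..n}"
    have \<psi>: "\<psi> i \<in> ell2 (reg B rs)" using rs(2) i by (simp add: orthonormal_basis_def)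
    have "csem B S (C i) (?E x) = ?E (csem B S (C i) x)"
      by (rule QIf.IH[OF _ wf(1)[OF i] wf(2)[OF i] QIf.prems(3)]) simp
    then show "?P i (csem B S (C i) (?E x)) = ?E (?P i (csem B S (C i) x))"
      using extend_outer_commute[OF cb d rs(1,3) fin \<phi> \<omega> bounded_op_outer[OF \<psi> \<psi>] Cx[OF i]] by simp
  qed
  also have "\<dots> = ?E (\<Sum>i=1..n. ?P i (csem B S (C i) x))"
    by (rule bounded_op_sum[OF bounded_op_extend[OF cb d bounded_op_outer[OF \<phi> \<omega>]] PCx, symmetric])
  also have "(\<Sum>i=1..n. ?P i (csem B S (C i) x)) = csem B S (QIf rs n \<psi> C) x"
    by (simp add: sum_apply)
  finally show ?case .
qed

text \<open>In a quantum case statement the branch projections have orthogonal ranges, so the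
  squared norms of the branches add; each branch contracts the projected input, and the projections
  of \<open>x\<close> have total squared norm at most that of \<open>x\<close> by Parseval on the
  slices.\<close>

lemma csem_contraction:
  assumes cb: "composite_basis B S"
  shows "wf_circuit B \<U> C \<Longrightarrow> contraction S (csem B S C)"
proof (induction C)
  case CSkip
  show ?case by (simp add: idop_def)
next
  case (Gate U qs)
  then have d: "distinct qs" and U: "unitary (reg B qs) U" by auto
  have "contraction (reg B qs) U" using unitary_contraction[OF U] by simp
  then show ?case using extend_contraction[OF cb d _ ] U by (simp add: unitary_def)
next
  case (CSeq C D)
  show ?case
  proof
    fix x assume x: "x \<in> ell2 S"
    have "csem B S C x \<in> ell2 S" by (rule bounded_op_ell2[OF bounded_op_csem[OF cb]]) (use CSeq in auto)
    then have "nrm S (csem B S D (csem B S C x)) \<le> nrm S (csem B S C x)" "nrm S (csem B S C x) \<le> nrm S x"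
      using CSeq x by auto
    then show "nrm S (csem B S (CSeq C D) x) \<le> nrm S x" by simp
  qed
next
  case (QIf qs n \<psi> C)
  let ?R = "reg B qs"
  let ?P = "\<lambda>i. extend B S qs (outer ?R (\<psi> i) (\<psi> i))"
  have qs: "distinct qs" "orthonormal_basis ?R n \<psi>" using QIf.prems by auto
  have wf: "wf_circuit B \<U> (C i)" "set qs \<inter> cvars (C i) = {}" if "i \<in> {1..n}" for i
    using QIf.prems that by auto
  have \<psi>: "\<psi> i \<in> ell2 ?R" if "i \<in> {1..n}" for i using qs(2) that by (simp add: orthonormal_basis_def)
  note bP = bounded_op_projection[OF cb qs]
  show ?case
  proof
    fix x assume x: "x \<in> ell2 S"
    define u where "u i = csem B S (C i) x" for i
    have u: "u i \<in> ell2 S" if "i \<in> {1..n}" for i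
      unfolding u_def by (rule bounded_op_ell2[OF bounded_op_csem[OF cb wf(1)[OF that]]])
    \<comment> \<open>The extended projection is its own adjoint, and the product of two different
      ones vanishes on every slice.\<close>
    have orth: "ip S (?P i (u i)) (?P j (u j)) = 0" if ij: "i \<in> {1..n}" "j \<in> {1..n}" "i \<noteq> j" for i j
    proof -
      have "?P i (?P j (u j)) = 0"
      proof
        fix \<sigma>
        show "?P i (?P j (u j)) \<sigma> = 0 \<sigma>"
        proof (cases "\<sigma> \<in> S")
          case True
          have "ip ?R (\<psi> i) (\<lambda>b. ip ?R (\<psi> j) (slice B qs \<sigma> (u j)) * \<psi> j b) = 0"
            unfolding ip_scale_right using qs(2) ij by (simp add: orthonormal_basis_def)
          moreover have "outer ?R (\<psi> j) (\<psi> j) (slice B qs \<sigma> (u j)) = (\<lambda>b. ip ?R (\<psi> j) (slice B qs \<sigma> (u j)) * \<psi> j b)"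
            using slice_ell2[OF cb qs(1) u[OF ij(2)] True] by (auto simp: outer_def)
          ultimately have "outer ?R (\<psi> i) (\<psi> i) (outer ?R (\<psi> j) (\<psi> j) (slice B qs \<sigma> (u j))) = (\<lambda>_. 0)"
            by (auto simp: outer_def[of ?R "\<psi> i"])
          then show ?thesis
            unfolding extend_apply[OF bounded_op_ell2[OF bP[OF ij(2)]] True]
              slice_extend[OF cb qs(1) bounded_op_outer[OF \<psi>[OF ij(2)] \<psi>[OF ij(2)]] u[OF ij(2)] True]
            by simp
        qed (simp add: extend_outside)
      qed
      then have "ip S (u i) (?P i (?P j (u j))) = 0" by simp
      then show ?thesis
        using ip_adj_left[OF bP[OF ij(1)] u[OF ij(1)] bounded_op_ell2[OF bP[OF ij(2)]]]
        unfolding adj_extend_outer[OF cb qs(1) \<psi>[OF ij(1)] \<psi>[OF ij(1)]] by simp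
    qed
    have "(nrm S (\<Sum>i=1..n. ?P i (u i)))\<^sup>2 = (\<Sum>i=1..n. (nrm S (?P i (u i)))\<^sup>2)"
      by (rule pythagoras[OF bounded_op_ell2[OF bP] orth]) auto
    also have "\<dots> \<le> (\<Sum>i=1..n. (nrm S (?P i x))\<^sup>2)"
    proof (rule sum_mono)
      fix i assume i: "i \<in> {1..n}"
      have "?P i (u i) = csem B S (C i) (?P i x)"
        unfolding u_def
        by (rule csem_extend_outer_commute[OF cb qs(1) orthonormal_basis_finite[OF qs(2)] \<psi>[OF i] \<psi>[OF i] wf(1)[OF i] wf(2)[OF i] x, symmetric])
      moreover have "nrm S (csem B S (C i) (?P i x)) \<le> nrm S (?P i x)"
        using QIf.IH[of "C i"] wf(1)[OF i] bounded_op_ell2[OF bP[OF i]] by simp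
      ultimately show "(nrm S (?P i (u i)))\<^sup>2 \<le> (nrm S (?P i x))\<^sup>2" by (simp add: power_mono)
    qed
    also have "\<dots> \<le> 1 * (nrm S x)\<^sup>2"
    proof (rule extend_family(2)[OF cb qs(1) x])
      show "outer ?R (\<psi> m) (\<psi> m) y \<in> ell2 ?R" if "m \<in> {1..n}" for m y
        by (rule bounded_op_ell2[OF bounded_op_outer[OF \<psi>[OF that] \<psi>[OF that]]])
      show "(\<Sum>m=1..n. (nrm ?R (outer ?R (\<psi> m) (\<psi> m) y))\<^sup>2) \<le> 1 * (nrm ?R y)\<^sup>2" if y: "y \<in> ell2 ?R" for y
        using orthonormal_basis_sum_sq[OF qs(2) y] by (simp add: nrm_outer[OF y] orthonormal_basis_nrm[OF qs(2)])
    qed auto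
    finally have "(nrm S (\<Sum>i=1..n. ?P i (u i)))\<^sup>2 \<le> (nrm S x)\<^sup>2" by simp
    then have "nrm S (\<Sum>i=1..n. ?P i (u i)) \<le> nrm S x" by (rule power2_le_imp_le) simp
    moreover have "csem B S (QIf qs n \<psi> C) x = (\<Sum>i=1..n. ?P i (u i))" by (simp add: sum_apply u_def)
    ultimately show "nrm S (csem B S (QIf qs n \<psi> C) x) \<le> nrm S x" by simp
  qed
qed

section \<open>Measurements\<close>

text \<open>The completeness relation is given coordinate by coordinate. For a truncated vector
  \<open>y\<close> only finitely many coordinates enter the inner product, so the relation can be
  paired with \<open>y\<close> and yields the sum of \<open>(nrm I (M m y))\<^sup>2\<close> over the
  outcomes; general vectors follow by continuity of each \<open>M m\<close>.\<close>

lemma measurement_contractive: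
  assumes M: "measurement I J M" and G: "finite G" "G \<subseteq> J" and x: "x \<in> ell2 I"
  shows "(\<Sum>m\<in>G. (nrm I (M m x))\<^sup>2) \<le> (nrm I x)\<^sup>2"
proof -
  have b: "bounded_op I (M m)" if "m \<in> J" for m using M that by (simp add: measurement_def)
  have fin: "(\<Sum>m\<in>G. (nrm I (M m (trunc F x)))\<^sup>2) \<le> (nrm I x)\<^sup>2" if F: "finite F" "F \<subseteq> I" for F
  proof -
    let ?y = "trunc F x"
    have y: "?y \<in> ell2 I" using x by simp
    have hs: "((\<lambda>m. \<Sum>i\<in>F. cnj (x i) * adj I (M m) (M m ?y) i) has_sum (\<Sum>i\<in>F. cnj (x i) * ?y i)) J"
      using M y F by (intro has_sum_finite_sum has_sum_cmult_right) (auto simp: measurement_def)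
    have "(\<Sum>i\<in>F. cnj (x i) * adj I (M m) (M m ?y) i) = of_real ((nrm I (M m ?y))\<^sup>2)" if m: "m \<in> J" for m
    proof -
      note Mm = bounded_op_ell2[OF b[OF m], of ?y]
      have "(\<Sum>i\<in>F. cnj (x i) * adj I (M m) (M m ?y) i) = ip I ?y (adj I (M m) (M m ?y))"
        by (simp add: ip_trunc_left[OF F])
      also have "\<dots> = ip I (M m ?y) (M m ?y)" by (rule ip_adj_right[OF b[OF m] y Mm])
      finally show ?thesis by (simp only: ip_self[OF Mm])
    qed
    then have "((\<lambda>m. complex_of_real ((nrm I (M m ?y))\<^sup>2)) has_sum (\<Sum>i\<in>F. cnj (x i) * ?y i)) J"
      using hs has_sum_cong[of J "\<lambda>m. \<Sum>i\<in>F. cnj (x i) * adj I (M m) (M m ?y) i"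
          "\<lambda>m. complex_of_real ((nrm I (M m ?y))\<^sup>2)"] by blast
    moreover have "(\<Sum>i\<in>F. cnj (x i) * ?y i) = of_real ((nrm I ?y)\<^sup>2)"
      using ip_trunc_left[OF F, of x ?y] ip_self[OF y] by simp
    ultimately have "((\<lambda>m. complex_of_real ((nrm I (M m ?y))\<^sup>2)) has_sum of_real ((nrm I ?y)\<^sup>2)) J" by simp
    then have "((\<lambda>m. (nrm I (M m ?y))\<^sup>2) has_sum (nrm I ?y)\<^sup>2) J"
      by (simp only: has_sum_of_real_iff)
    then have "(\<Sum>m\<in>G. (nrm I (M m ?y))\<^sup>2) \<le> (nrm I ?y)\<^sup>2"
      using G by (intro finite_sum_le_has_sum) auto
    also have "\<dots> \<le> (nrm I x)\<^sup>2" by (rule power_mono[OF nrm_trunc_le[OF x] nrm_nonneg])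
    finally show ?thesis .
  qed
  have lim: "((\<lambda>F. nrm I (M m (trunc F x))) \<longlongrightarrow> nrm I (M m x)) (finite_subsets_at_top I)" if m: "m \<in> G" for m
  proof -
    have bm: "bounded_op I (M m)" using b m G by auto
    have l0: "((\<lambda>F. nrm I (M m x - M m (trunc F x))) \<longlongrightarrow> 0) (finite_subsets_at_top I)"
      by (rule bounded_op_norm_limit[OF bm _ x trunc_tendsto[OF x]]) (use x in simp)
    have "\<bar>nrm I (M m (trunc F x)) - nrm I (M m x)\<bar> \<le> nrm I (M m x - M m (trunc F x))" for F
    proof -
      let ?a = "M m x" and ?b = "M m (trunc F x)"
      have ab: "?a \<in> ell2 I" "?b \<in> ell2 I" using bm by auto
      have "?a = (?a - ?b) + ?b" "?b = ?a - (?a - ?b)" by simp_all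
      then have "nrm I ?a \<le> nrm I (?a - ?b) + nrm I ?b" "nrm I ?b \<le> nrm I ?a + nrm I (?a - ?b)"
        using nrm_triangle[OF ell2_minus[OF ab] ab(2)] nrm_minus_triangle[OF ab(1) ell2_minus[OF ab]] by simp_all
      then show ?thesis by linarith
    qed
    then have "\<forall>\<^sub>F F in finite_subsets_at_top I.
        norm (nrm I (M m (trunc F x)) - nrm I (M m x)) \<le> nrm I (M m x - M m (trunc F x))"
      by (intro always_eventually allI) (simp only: real_norm_def)
    then have "((\<lambda>F. nrm I (M m (trunc F x)) - nrm I (M m x)) \<longlongrightarrow> 0) (finite_subsets_at_top I)"
      by (rule Lim_null_comparison[OF _ l0])
    then show ?thesis by (rule LIM_zero_cancel)
  qed
  have "((\<lambda>F. \<Sum>m\<in>G. (nrm I (M m (trunc F x)))\<^sup>2) \<longlongrightarrow> (\<Sum>m\<in>G. (nrm I (M m x))\<^sup>2)) (finite_subsets_at_top I)"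
    by (intro tendsto_sum tendsto_power lim)
  moreover have "\<forall>\<^sub>F F in finite_subsets_at_top I. (\<Sum>m\<in>G. (nrm I (M m (trunc F x)))\<^sup>2) \<le> (nrm I x)\<^sup>2"
    by (rule eventually_finite_subsets_at_top_weakI) (rule fin)
  ultimately show ?thesis by (rule tendsto_upperbound) simp
qed

section \<open>Semantics of schemes\<close>

definition conjugation :: "'i set \<Rightarrow> 'i oper \<Rightarrow> 'i superop" where
  "conjugation I A = (\<lambda>\<rho>. A \<circ> \<rho> \<circ> adj I A)"

text \<open>The condition that the operators \<open>A m\<close>, each followed by its adjoint, sum
  to at most the identity, expressed by norms and finite subfamilies so that no infinite operator
  sum occurs.\<close>

definition kraus :: "'i set \<Rightarrow> 'k set \<Rightarrow> ('k \<Rightarrow> 'i oper) \<Rightarrow> bool" where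
  "kraus I J A \<longleftrightarrow> (\<forall>m\<in>J. bounded_op I (A m)) \<and>
     (\<forall>G x. finite G \<and> G \<subseteq> J \<and> x \<in> ell2 I \<longrightarrow> (\<Sum>m\<in>G. (nrm I (A m x))\<^sup>2) \<le> (nrm I x)\<^sup>2)"

text \<open>Being quantum operations is part of the relation: an induction over programs for the
  order then also shows that meanings are quantum operations.\<close>

definition below :: "'i set \<Rightarrow> 'i superop \<Rightarrow> 'i superop \<Rightarrow> bool" where
  "below I E G \<longleftrightarrow> quantum_operation I E \<and> quantum_operation I G \<and> (\<forall>\<rho>\<in>pos_tc I. lowner I (E \<rho>) (G \<rho>))"

text \<open>Since \<open>f n \<le> E\<close>, convergence of the traces is convergence of \<open>f n \<rho>\<close> to \<open>E \<rho>\<close> in trace norm.\<close>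

definition approximates :: "'i set \<Rightarrow> (nat \<Rightarrow> 'i superop) \<Rightarrow> 'i superop \<Rightarrow> bool" where
  "approximates I f E \<longleftrightarrow> (\<forall>n. below I (f n) E) \<and>
     (\<forall>\<rho>\<in>pos_tc I. (\<lambda>n. rtr I (f n \<rho>)) \<longlonglongrightarrow> rtr I (E \<rho>))"

section \<open>Instruments from Kraus families and from loops\<close>

lemma kraus_qop:
  assumes "kraus I J A" "m \<in> J" shows "quantum_operation I (conjugation I (A m))"
  unfolding conjugation_def
proof (rule qop_conjugate)
  show "bounded_op I (A m)" using assms by (simp add: kraus_def)
  fix x assume "x \<in> ell2 I"
  then have "(\<Sum>m\<in>{m}. (nrm I (A m x))\<^sup>2) \<le> (nrm I x)\<^sup>2"
    using assms unfolding kraus_def by blast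
  then show "nrm I (A m x) \<le> nrm I x" by (intro power2_le_imp_le[OF _ nrm_nonneg]) simp
qed

lemma kraus_rtr:
  assumes "kraus I J A" "finite G" "G \<subseteq> J" "\<rho> \<in> pos_tc I"
  shows "(\<Sum>m\<in>G. rtr I (conjugation I (A m) \<rho>)) \<le> rtr I \<rho>"
  unfolding conjugation_def
  by (rule conjugate_trace_le(2)[OF assms(2) _ _ assms(4)]) (use assms in \<open>auto simp: kraus_def\<close>)

lemma kraus_instrument:
  assumes A: "kraus I J A" and Q: "\<And>m. m \<in> J \<Longrightarrow> quantum_operation I (Q m)"
  shows "instrument I J (\<lambda>m. Q m \<circ> conjugation I (A m))"
  unfolding instrument_def
proof (intro conjI ballI allI impI)
  show "quantum_operation I (Q m \<circ> conjugation I (A m))" if "m \<in> J" for m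
    by (rule qop_comp[OF kraus_qop[OF A that] Q[OF that]])
  fix \<rho> G assume \<rho>: "\<rho> \<in> pos_tc I" and G: "finite G \<and> G \<subseteq> J"
  have "(\<Sum>m\<in>G. rtr I ((Q m \<circ> conjugation I (A m)) \<rho>)) \<le> (\<Sum>m\<in>G. rtr I (conjugation I (A m) \<rho>))"
  proof (rule sum_mono)
    fix m assume "m \<in> G"
    then have m: "m \<in> J" using G by auto
    show "rtr I ((Q m \<circ> conjugation I (A m)) \<rho>) \<le> rtr I (conjugation I (A m) \<rho>)"
      using qop_rtr[OF Q[OF m] qop_pos[OF kraus_qop[OF A m] \<rho>]] by simp
  qed
  also have "\<dots> \<le> rtr I \<rho>" using kraus_rtr[OF A _ _ \<rho>] G by blast
  finally show "(\<Sum>m\<in>G. rtr I ((Q m \<circ> conjugation I (A m)) \<rho>)) \<le> rtr I \<rho>" .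
qed

lemma qop_funpow:
  assumes "quantum_operation I E" shows "quantum_operation I (E ^^ n)"
proof (induction n)
  case 0
  show ?case unfolding funpow.simps id_def by (rule qop_id)
next
  case (Suc n)
  then show ?case unfolding funpow.simps by (rule qop_comp[OF _ assms])
qed

text \<open>Invariant over the rounds: the trace that has left the loop before round
  \<open>N\<close> plus the trace still inside is at most the initial trace. A finite set of rounds
  is then covered by an initial segment.\<close>

lemma while_instrument:
  fixes A :: "nat \<Rightarrow> 'i oper"
  assumes A: "kraus I {0, 1} A" and P: "quantum_operation I P"
  shows "instrument I (UNIV :: nat set) (\<lambda>n. conjugation I (A 0) \<circ> ((P \<circ> conjugation I (A 1)) ^^ n))"
proof -
  let ?E = "\<lambda>m. conjugation I (A m)"
  let ?T = "P \<circ> ?E 1"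
  have E: "quantum_operation I (?E 0)" "quantum_operation I (?E 1)" using kraus_qop[OF A] by auto
  have T: "quantum_operation I ?T" by (rule qop_comp[OF E(2) P])
  note Tn = qop_funpow[OF T]
  have *: "(\<Sum>n<N. rtr I (?E 0 ((?T ^^ n) \<rho>))) + rtr I ((?T ^^ N) \<rho>) \<le> rtr I \<rho>" if \<rho>: "\<rho> \<in> pos_tc I" for N \<rho>
  proof (induction N)
    case (Suc N)
    let ?s = "(?T ^^ N) \<rho>"
    have s: "?s \<in> pos_tc I" by (rule qop_pos[OF Tn \<rho>])
    have "rtr I (?E 0 ?s) + rtr I (?E 1 ?s) \<le> rtr I ?s"
      using kraus_rtr[OF A _ _ s, of "{0, 1}"] by simp
    moreover have "rtr I (P (?E 1 ?s)) \<le> rtr I (?E 1 ?s)"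
      by (rule qop_rtr[OF P qop_pos[OF E(2) s]])
    moreover have "rtr I ((?T ^^ Suc N) \<rho>) = rtr I (P (?E 1 ?s))" by (simp only: funpow.simps o_apply)
    moreover have "(\<Sum>n<Suc N. rtr I (?E 0 ((?T ^^ n) \<rho>))) = (\<Sum>n<N. rtr I (?E 0 ((?T ^^ n) \<rho>))) + rtr I (?E 0 ?s)"
      by (rule sum.lessThan_Suc)
    ultimately show ?case using Suc by linarith
  qed simp
  show ?thesis unfolding instrument_def
  proof (intro conjI ballI allI impI)
    show "quantum_operation I (?E 0 \<circ> (?T ^^ n))" for n by (rule qop_comp[OF Tn E(1)])
    fix \<rho> and G :: "nat set" assume \<rho>: "\<rho> \<in> pos_tc I" and G: "finite G \<and> G \<subseteq> UNIV"
    obtain N where N: "G \<subseteq> {..<N}" using G finite_nat_iff_bounded by blast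
    have pos: "?E 0 ((?T ^^ n) \<rho>) \<in> pos_tc I" for n
      by (rule qop_pos[OF E(1) qop_pos[OF Tn \<rho>]])
    have "(\<Sum>n\<in>G. rtr I (?E 0 ((?T ^^ n) \<rho>))) \<le> (\<Sum>n<N. rtr I (?E 0 ((?T ^^ n) \<rho>)))"
      by (rule sum_mono2[OF _ N]) (simp_all only: finite_lessThan rtr_nonneg[OF pos])
    also have "\<dots> \<le> rtr I \<rho>" using *[OF \<rho>, of N] rtr_nonneg[OF qop_pos[OF Tn \<rho>], of N] by linarith
    finally show "(\<Sum>n\<in>G. rtr I ((?E 0 \<circ> (?T ^^ n)) \<rho>)) \<le> rtr I \<rho>" by (simp only: o_apply)
  qed
qed

section \<open>Monotonicity and continuity of composition and sums\<close>

lemma below_refl: "quantum_operation I E \<Longrightarrow> below I E E"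
  by (simp add: below_def lowner_refl)

lemma below_qop: "below I E G \<Longrightarrow> quantum_operation I E" "below I E G \<Longrightarrow> quantum_operation I G"
  and below_lowner: "below I E G \<Longrightarrow> \<rho> \<in> pos_tc I \<Longrightarrow> lowner I (E \<rho>) (G \<rho>)"
  by (auto simp: below_def)

lemma below_rtr:
  assumes "below I E G" "\<rho> \<in> pos_tc I" shows "rtr I (E \<rho>) \<le> rtr I (G \<rho>)"
  by (rule lowner_rtr_mono[OF qop_pos[OF below_qop(1)[OF assms(1)] assms(2)]
        qop_pos[OF below_qop(2)[OF assms(1)] assms(2)] below_lowner[OF assms]])

lemma below_comp:
  assumes P: "below I P P'" and Q: "below I Q Q'" shows "below I (Q \<circ> P) (Q' \<circ> P')"
  unfolding below_def
proof (intro conjI ballI)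
  show "quantum_operation I (Q \<circ> P)" "quantum_operation I (Q' \<circ> P')"
    using below_qop[OF P] below_qop[OF Q] by (auto intro: qop_comp)
  fix \<rho> assume \<rho>: "\<rho> \<in> pos_tc I"
  note pos = qop_pos[OF below_qop(1)[OF P] \<rho>] qop_pos[OF below_qop(2)[OF P] \<rho>]
  from lowner_trans[OF below_lowner[OF Q pos(1)] qop_mono[OF below_qop(2)[OF Q] pos below_lowner[OF P \<rho>]]]
  show "lowner I ((Q \<circ> P) \<rho>) ((Q' \<circ> P') \<rho>)" by simp
qed

lemma below_opsum:
  assumes E: "instrument I J E" and G: "instrument I J G" and le: "\<And>k. k \<in> J \<Longrightarrow> below I (E k) (G k)"
  shows "below I (\<lambda>\<rho>. opsum J (\<lambda>k. E k \<rho>)) (\<lambda>\<rho>. opsum J (\<lambda>k. G k \<rho>))"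
  unfolding below_def
proof (intro conjI ballI)
  show "quantum_operation I (\<lambda>\<rho>. opsum J (\<lambda>k. E k \<rho>))" by (rule qop_opsum[OF E])
  show "quantum_operation I (\<lambda>\<rho>. opsum J (\<lambda>k. G k \<rho>))" by (rule qop_opsum[OF G])
  fix \<rho> assume \<rho>: "\<rho> \<in> pos_tc I"
  show "lowner I (opsum J (\<lambda>k. E k \<rho>)) (opsum J (\<lambda>k. G k \<rho>))"
  proof (rule instrument_opsum_mono[OF E G \<rho>])
    show "lowner I (E k \<rho>) (G k \<rho>)" if "k \<in> J" for k by (rule below_lowner[OF le[OF that] \<rho>])
  qed
qed

lemma below_zero:
  assumes E: "quantum_operation I E" shows "below I (\<lambda>\<rho>. 0) E"
  unfolding below_def
proof (intro conjI ballI qop_zero E)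
  fix \<rho> assume "\<rho> \<in> pos_tc I"
  then show "lowner I 0 (E \<rho>)"
    by (rule lowner_0_left[OF pos_tc_positive[OF qop_pos[OF E]]])
qed

lemma approximates_below: "approximates I f E \<Longrightarrow> below I (f n) E"
  and approximates_rtr: "approximates I f E \<Longrightarrow> \<rho> \<in> pos_tc I \<Longrightarrow> (\<lambda>n. rtr I (f n \<rho>)) \<longlonglongrightarrow> rtr I (E \<rho>)"
  by (auto simp: approximates_def)

lemma approximates_const: "quantum_operation I E \<Longrightarrow> approximates I (\<lambda>n. E) E"
  by (simp add: approximates_def below_refl)

text \<open>Replacing \<open>P \<rho>\<close> by \<open>f n \<rho>\<close> under \<open>g n\<close>
  changes the trace by at most \<open>rtr I (P \<rho>) - rtr I (f n \<rho>)\<close>, because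
  \<open>g n\<close> does not increase the trace of the positive difference. The estimate is the
  same for every quantum operation in place of \<open>g n\<close>, so both limits can be taken
  together.\<close>

lemma approximates_comp:
  assumes f: "approximates I f P" and g: "approximates I g Q"
  shows "approximates I (\<lambda>n. g n \<circ> f n) (Q \<circ> P)"
  unfolding approximates_def
proof (intro conjI allI ballI)
  note bf = approximates_below[OF f] and bg = approximates_below[OF g]
  show b: "below I (g n \<circ> f n) (Q \<circ> P)" for n by (rule below_comp[OF bf bg])
  fix \<rho> assume \<rho>: "\<rho> \<in> pos_tc I"
  have P\<rho>: "P \<rho> \<in> pos_tc I" by (rule qop_pos[OF below_qop(2)[OF bf] \<rho>])
  have f\<rho>: "f n \<rho> \<in> pos_tc I" for n by (rule qop_pos[OF below_qop(1)[OF bf] \<rho>])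
  have lower: "rtr I (g n (P \<rho>)) - (rtr I (P \<rho>) - rtr I (f n \<rho>)) \<le> rtr I ((g n \<circ> f n) \<rho>)" for n
  proof -
    note gn = below_qop(1)[OF bg, of n]
    note d = pos_tc_diff[OF f\<rho> P\<rho> below_lowner[OF bf \<rho>], of n]
    note le = qop_mono[OF gn f\<rho> P\<rho> below_lowner[OF bf \<rho>], of n]
    have "rtr I (g n (P \<rho>)) - rtr I (g n (f n \<rho>)) = rtr I (g n (P \<rho>) - g n (f n \<rho>))"
      by (rule pos_tc_diff(2)[OF qop_pos[OF gn f\<rho>] qop_pos[OF gn P\<rho>] le, symmetric])
    also have "\<dots> = rtr I (g n (P \<rho> - f n \<rho>))"
      by (simp only: qop_diff[OF gn pos_tc_trace_class[OF P\<rho>] pos_tc_trace_class[OF f\<rho>]])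
    also have "\<dots> \<le> rtr I (P \<rho>) - rtr I (f n \<rho>)"
      using qop_rtr[OF gn d(1)] by (simp only: d(2))
    finally show ?thesis by simp
  qed
  have "(\<lambda>n. rtr I (g n (P \<rho>)) - (rtr I (P \<rho>) - rtr I (f n \<rho>))) \<longlonglongrightarrow> rtr I (Q (P \<rho>)) - (rtr I (P \<rho>) - rtr I (P \<rho>))"
    by (intro tendsto_diff tendsto_const approximates_rtr[OF g P\<rho>] approximates_rtr[OF f \<rho>])
  then have lim: "(\<lambda>n. rtr I (g n (P \<rho>)) - (rtr I (P \<rho>) - rtr I (f n \<rho>))) \<longlonglongrightarrow> rtr I ((Q \<circ> P) \<rho>)" by simp
  show "(\<lambda>n. rtr I ((g n \<circ> f n) \<rho>)) \<longlonglongrightarrow> rtr I ((Q \<circ> P) \<rho>)"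
    by (rule tendsto_sandwich[OF always_eventually always_eventually lim tendsto_const])
      (use lower below_rtr[OF b \<rho>] in blast)+
qed

lemma approximates_funpow:
  assumes f: "approximates I f E" shows "approximates I (\<lambda>n. f n ^^ k) (E ^^ k)"
proof (induction k)
  case 0
  show ?case unfolding funpow.simps id_def by (rule approximates_const[OF qop_id])
next
  case (Suc k)
  then show ?case unfolding funpow.simps by (rule approximates_comp[OF _ f])
qed

text \<open>The operations \<open>E k\<close> dominate termwise, and their traces at
  \<open>\<rho>\<close> are summable because they form an instrument.\<close>

lemma approximates_opsum:
  assumes f: "\<And>n. instrument I J (f n)" and E: "instrument I J E"
    and ap: "\<And>k. k \<in> J \<Longrightarrow> approximates I (\<lambda>n. f n k) (E k)"
  shows "approximates I (\<lambda>n \<rho>. opsum J (\<lambda>k. f n k \<rho>)) (\<lambda>\<rho>. opsum J (\<lambda>k. E k \<rho>))"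
  unfolding approximates_def
proof (intro conjI allI ballI)
  show "below I (\<lambda>\<rho>. opsum J (\<lambda>k. f n k \<rho>)) (\<lambda>\<rho>. opsum J (\<lambda>k. E k \<rho>))" for n
    by (rule below_opsum[OF f E approximates_below[OF ap]])
  fix \<rho> assume \<rho>: "\<rho> \<in> pos_tc I"
  show "(\<lambda>n. rtr I (opsum J (\<lambda>k. f n k \<rho>))) \<longlonglongrightarrow> rtr I (opsum J (\<lambda>k. E k \<rho>))"
  proof (rule has_sum_dominated_convergence)
    show "((\<lambda>k. rtr I (f n k \<rho>)) has_sum rtr I (opsum J (\<lambda>k. f n k \<rho>))) J" for n
      by (rule instrument_opsum_rtr[OF f \<rho>])
    show "((\<lambda>k. rtr I (E k \<rho>)) has_sum rtr I (opsum J (\<lambda>k. E k \<rho>))) J"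
      by (rule instrument_opsum_rtr[OF E \<rho>])
    fix n k assume k: "k \<in> J"
    show "0 \<le> rtr I (f n k \<rho>)" by (rule rtr_nonneg[OF qop_pos[OF instrument_qop[OF f k] \<rho>]])
    show "rtr I (f n k \<rho>) \<le> rtr I (E k \<rho>)" by (rule below_rtr[OF approximates_below[OF ap[OF k]] \<rho>])
  next
    show "(\<lambda>n. rtr I (f n k \<rho>)) \<longlonglongrightarrow> rtr I (E k \<rho>)" if k: "k \<in> J" for k
      by (rule approximates_rtr[OF ap[OF k] \<rho>])
  qed
qed

section \<open>The clauses of the semantics\<close>

lemma kraus_extend:
  assumes cb: "composite_basis B S" and d: "distinct qs" and A: "kraus (reg B qs) J A"
  shows "kraus S J (\<lambda>m. extend B S qs (A m))"
  unfolding kraus_def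
proof (intro conjI ballI allI impI)
  have b: "bounded_op (reg B qs) (A m)" if "m \<in> J" for m using A that by (simp add: kraus_def)
  show "bounded_op S (extend B S qs (A m))" if "m \<in> J" for m by (rule bounded_op_extend[OF cb d b[OF that]])
  fix G x assume G: "finite G \<and> G \<subseteq> J \<and> x \<in> ell2 S"
  have "(\<Sum>m\<in>G. (nrm S (extend B S qs (A m) x))\<^sup>2) \<le> 1 * (nrm S x)\<^sup>2"
  proof (rule extend_family(2)[OF cb d])
    show "A m y \<in> ell2 (reg B qs)" if "m \<in> G" for m y
      by (rule bounded_op_ell2[OF b]) (use G that in auto)
    show "(\<Sum>m\<in>G. (nrm (reg B qs) (A m y))\<^sup>2) \<le> 1 * (nrm (reg B qs) y)\<^sup>2" if "y \<in> ell2 (reg B qs)" for y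
      using A G that by (simp add: kraus_def)
  qed (use G in auto)
  then show "(\<Sum>m\<in>G. (nrm S (extend B S qs (A m) x))\<^sup>2) \<le> (nrm S x)\<^sup>2" by simp
qed

lemma kraus_measurement: "measurement I J M \<Longrightarrow> kraus I J M"
  using measurement_contractive[of I J M] by (simp add: kraus_def measurement_def)

text \<open>As \<open>\<psi>\<close> is a unit vector, the norms of the images are the moduli of the
  coordinates of \<open>y\<close>.\<close>

lemma kraus_initialisation:
  assumes \<psi>: "\<psi> \<in> ell2 I" and n1: "nrm I \<psi> = 1"
  shows "kraus I I (\<lambda>n. outer I \<psi> (ket n))"
  unfolding kraus_def
proof (intro conjI ballI allI impI bounded_op_outer[OF \<psi> ket_ell2])
  fix G y assume G: "finite G \<and> G \<subseteq> I \<and> y \<in> ell2 I"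
  then have "(\<Sum>n\<in>G. (nrm I (outer I \<psi> (ket n) y))\<^sup>2) = (\<Sum>n\<in>G. (cmod (y n))\<^sup>2)"
    by (intro sum.cong refl) (auto simp: nrm_outer n1 ip_ket_left subset_iff)
  also have "\<dots> \<le> (nrm I y)\<^sup>2" by (rule sum_le_nrm) (use G in auto)
  finally show "(\<Sum>n\<in>G. (nrm I (outer I \<psi> (ket n) y))\<^sup>2) \<le> (nrm I y)\<^sup>2" .
qed

text \<open>The identity is composed in to match \<open>kraus_instrument\<close>, so that
  initialisation is a sum over conjugations like a conditional.\<close>

lemma sem_Init:
  assumes cb: "composite_basis B S" and d: "distinct qs" and \<psi>: "\<psi> \<in> ell2 (reg B qs)"
  shows "sem B S \<eta> (Init qs \<psi>) = (\<lambda>\<rho>. opsum (reg B qs) (\<lambda>n.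
    ((\<lambda>\<rho>. \<rho>) \<circ> conjugation S (extend B S qs (outer (reg B qs) \<psi> (ket n)))) \<rho>))"
proof
  fix \<rho>
  show "sem B S \<eta> (Init qs \<psi>) \<rho> = opsum (reg B qs) (\<lambda>n.
    ((\<lambda>\<rho>. \<rho>) \<circ> conjugation S (extend B S qs (outer (reg B qs) \<psi> (ket n)))) \<rho>)"
    unfolding sem.simps opsum_def o_apply conjugation_def
    by (intro ext infsum_cong) (simp only: adj_extend_outer[OF cb d \<psi> ket_ell2])
qed

lemma sem_Cond:
  "sem B S \<eta> (Cond qs J M P) =
    (\<lambda>\<rho>. opsum J (\<lambda>m. (sem B S \<eta> (P m) \<circ> conjugation S (extend B S qs (M m))) \<rho>))"
  by (simp add: conjugation_def)

lemma sem_While: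
  "sem B S \<eta> (While qs M P) = (\<lambda>\<rho>. opsum UNIV (\<lambda>n.
     (conjugation S (extend B S qs (M 0)) \<circ>
       ((sem B S \<eta> P \<circ> conjugation S (extend B S qs (M 1))) ^^ n)) \<rho>))"
  by (simp only: sem.simps Let_def conjugation_def)

lemma quantum_operation_Init:
  assumes cb: "composite_basis B S" and "wf_expr B \<U> ok (Init qs \<psi>)"
  shows "quantum_operation S (sem B S \<eta> (Init qs \<psi>))"
proof -
  have w: "distinct qs" "\<psi> \<in> ell2 (reg B qs)" "nrm (reg B qs) \<psi> = 1" using assms by auto
  show ?thesis unfolding sem_Init[OF cb w(1,2)]
    by (rule qop_opsum[OF kraus_instrument[OF kraus_extend[OF cb w(1) kraus_initialisation[OF w(2,3)]] qop_id]])
qed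

lemma quantum_operation_Circ:
  assumes cb: "composite_basis B S" and "wf_expr B \<U> ok (Circ C)"
  shows "quantum_operation S (sem B S \<eta> (Circ C))"
  unfolding sem.simps
  by (rule qop_conjugate[OF bounded_op_csem[OF cb, of \<U>]])
    (use assms csem_contraction[OF cb, of \<U> C] in auto)

text \<open>Structural induction with a sequence of interpretations in place of one. Applied to the
  approximations it is continuity of the scheme; applied to constant sequences it shows that
  meanings are quantum operations. Circuits and initialisations contain no identifier, so their
  sequences are constant.\<close>

lemma sem_approximates:
  assumes cb: "composite_basis B S" and \<eta>: "\<And>x. ok x \<Longrightarrow> approximates S (\<lambda>n. f n x) (\<eta> x)"
  shows "wf_expr B \<U> ok P \<Longrightarrow> approximates S (\<lambda>n. sem B S (f n) P) (sem B S \<eta> P)"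
proof (induction P)
  case Skip
  show ?case unfolding sem.simps by (rule approximates_const[OF qop_id])
next
  case Abort
  show ?case unfolding sem.simps by (rule approximates_const[OF qop_zero])
next
  case (Init qs \<psi>)
  from approximates_const[OF quantum_operation_Init[OF cb Init, of \<eta>]] show ?case by (simp only: sem.simps)
next
  case (Circ C)
  from approximates_const[OF quantum_operation_Circ[OF cb Circ, of \<eta>]] show ?case by (simp only: sem.simps)
next
  case (Seq P Q)
  then have "approximates S (\<lambda>n. sem B S (f n) P) (sem B S \<eta> P)"
    "approximates S (\<lambda>n. sem B S (f n) Q) (sem B S \<eta> Q)" by auto
  then show ?case unfolding sem.simps by (rule approximates_comp)
next
  case (Cond qs J M P)
  then have d: "distinct qs" and M: "measurement (reg B qs) J M"
    and P: "\<And>m. m \<in> J \<Longrightarrow> approximates S (\<lambda>n. sem B S (f n) (P m)) (sem B S \<eta> (P m))" by auto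
  note k = kraus_extend[OF cb d kraus_measurement[OF M]]
  show ?case unfolding sem_Cond
  proof (rule approximates_opsum)
    fix m assume m: "m \<in> J"
    show "approximates S (\<lambda>n. sem B S (f n) (P m) \<circ> conjugation S (extend B S qs (M m)))
        (sem B S \<eta> (P m) \<circ> conjugation S (extend B S qs (M m)))"
      by (rule approximates_comp[OF approximates_const[OF kraus_qop[OF k m]] P[OF m]])
  qed (rule kraus_instrument[OF k]; rule below_qop[OF approximates_below[OF P]]; assumption)+
next
  case (While qs M P)
  then have d: "distinct qs" and M: "measurement (reg B qs) {0, 1} M"
    and P: "approximates S (\<lambda>n. sem B S (f n) P) (sem B S \<eta> P)" by auto
  note k = kraus_extend[OF cb d kraus_measurement[OF M]]
  have E: "approximates S (\<lambda>n. conjugation S (extend B S qs (M m))) (conjugation S (extend B S qs (M m)))"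
    if "m \<in> {0, 1}" for m
    by (rule approximates_const[OF kraus_qop[OF k that]])
  show ?case unfolding sem_While
    by (rule approximates_opsum[OF while_instrument[OF k below_qop(1)[OF approximates_below[OF P]]]
          while_instrument[OF k below_qop(2)[OF approximates_below[OF P]]]])
      (intro approximates_comp[OF approximates_funpow[OF approximates_comp[OF E P]] E], auto)
next
  case (Ident x)
  then show ?case using \<eta> by simp
qed

text \<open>An inequality is the approximation that is constant from the second term on.\<close>

lemma sem_below:
  assumes cb: "composite_basis B S" and \<eta>: "\<And>x. ok x \<Longrightarrow> below S (\<eta> x) (\<eta>' x)" and P: "wf_expr B \<U> ok P"
  shows "below S (sem B S \<eta> P) (sem B S \<eta>' P)"
proof -
  define f where "f n = (if n = 0 then \<eta> else \<eta>')" for n :: nat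
  have "approximates S (\<lambda>n. f n x) (\<eta>' x)" if "ok x" for x
  proof -
    have "f n x = \<eta>' x" if "n \<noteq> 0" for n using that by (simp add: f_def)
    moreover have "below S (f n x) (\<eta>' x)" for n
      using \<eta>[OF \<open>ok x\<close>] below_refl[OF below_qop(2)[OF \<eta>[OF \<open>ok x\<close>]]] by (simp add: f_def)
    ultimately show ?thesis
      unfolding approximates_def
      by (auto intro!: tendsto_eventually eventually_sequentiallyI[of 1])
  qed
  from approximates_below[OF sem_approximates[OF cb this P], where n = 0] show ?thesis by (simp add: f_def)
qed

section \<open>Recursion as iteration of a functional\<close>

text \<open>The meaning of \<open>F(P)\<close> is a functional of the meaning of \<open>P\<close>,
  so unfolding a recursion becomes iterating one map on quantum operations.\<close>

lemma sem_subst: "sem B S \<eta> (subst F P) = sem B S (\<lambda>_. sem B S \<eta> P) F"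
  by (induction F) simp_all

text \<open>The approximations are the iterates of that functional from the zero map, hence
  increasing by monotonicity. This is what makes \<open>qlub\<close> a genuine least upper bound
  with convergent traces.\<close>

lemma mu_sem_approximates:
  assumes cb: "composite_basis B S" and F: "wf_scheme B \<U> F"
  shows "is_qlub S (\<lambda>n. sem B S (\<lambda>_ _. 0) (approx F n)) (mu_sem B S F)"
    and "approximates S (\<lambda>n. sem B S (\<lambda>_ _. 0) (approx F n)) (mu_sem B S F)"
proof -
  define f where "f n = sem B S (\<lambda>_ _. 0) (approx F n)" for n
  have f0: "f 0 = (\<lambda>\<rho>. 0)" by (simp add: f_def)
  have fSuc: "f (Suc n) = sem B S (\<lambda>_. f n) F" for n by (simp add: f_def sem_subst)
  have wf: "wf_expr B \<U> (\<lambda>_. True) F" using F by (simp add: wf_scheme_def)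
  have q: "quantum_operation S (f n)" for n
  proof (induction n)
    case 0
    show ?case unfolding f0 by (rule qop_zero)
  next
    case (Suc n)
    show ?case unfolding fSuc
      by (rule below_qop(1)[OF sem_below[where ok = "\<lambda>_. True", OF cb below_refl[OF Suc] wf]])
  qed
  have inc: "below S (f n) (f (Suc n))" for n
  proof (induction n)
    case 0
    show ?case unfolding f0 by (rule below_zero[OF q])
  next
    case (Suc n)
    from sem_below[where ok = "\<lambda>_. True", OF cb Suc wf] show ?case unfolding fSuc[symmetric] .
  qed
  have mu: "mu_sem B S F = qlub S f" by (simp add: mu_sem_def f_def[abs_def])
  note lub = qlub_increasing[of S f, OF q below_lowner[OF inc]]
  show l: "is_qlub S (\<lambda>n. sem B S (\<lambda>_ _. 0) (approx F n)) (mu_sem B S F)"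
    using lub(1) unfolding mu f_def .
  have "approximates S f (mu_sem B S F)"
    unfolding approximates_def
  proof (intro conjI allI ballI)
    have qm: "quantum_operation S (mu_sem B S F)" using l by (simp add: is_qlub_def)
    show "below S (f n) (mu_sem B S F)" for n
      unfolding below_def
    proof (intro conjI ballI q qm)
      fix \<rho> assume \<rho>: "\<rho> \<in> pos_tc S"
      have "superop_le S (f n) (mu_sem B S F)" using l by (simp add: is_qlub_def f_def)
      from superop_le_pos_tc[OF q qm this \<rho>] show "lowner S (f n \<rho>) (mu_sem B S F \<rho>)" .
    qed
    fix \<rho> assume "\<rho> \<in> pos_tc S"
    from lub(2)[OF _ this] show "(\<lambda>n. rtr S (f n \<rho>)) \<longlonglongrightarrow> rtr S (mu_sem B S F \<rho>)" unfolding mu .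
  qed
  then show "approximates S (\<lambda>n. sem B S (\<lambda>_ _. 0) (approx F n)) (mu_sem B S F)" unfolding f_def .
qed

lemma below_imp_superop_le: "below I E G \<Longrightarrow> superop_le I E G"
  by (auto simp: below_def superop_le_def pdo_def)

theorem proposition6p2:
  fixes B :: "'v \<Rightarrow> 'b set"
    and S :: "('v \<Rightarrow> 'b) set"
    and \<U> :: "'b list oper set"
    and F :: "('v, 'b, 'm) scheme"
  assumes "composite_basis B S"
    and "wf_scheme B \<U> F"
  shows "prog_equiv B S (Mu F) (subst F (Mu F)) \<and>
         (\<forall>P :: ('v, 'b, 'm) program.
            wf_program B \<U> P \<and> prog_equiv B S P (subst F P) \<longrightarrow> prog_le B S (Mu F) P)"
proof -
  note cb = assms(1)
  define f where "f n = sem B S (\<lambda>_ _. 0) (approx F n)" for n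
  define M where "M = mu_sem B S F"
  define \<Phi> where "\<Phi> E = sem B S (\<lambda>_. E) F" for E
  have f0: "f 0 = (\<lambda>\<rho>. 0)" by (simp add: f_def)
  have fSuc: "f (Suc n) = \<Phi> (f n)" for n by (simp add: f_def sem_subst \<Phi>_def)
  have wf: "wf_expr B \<U> (\<lambda>_. True) F" using assms(2) by (simp add: wf_scheme_def)
  have lub: "is_qlub S f M" and ap: "approximates S f M"
    using mu_sem_approximates[OF assms] unfolding f_def M_def by simp_all
  have \<Phi>_below: "below S (\<Phi> E) (\<Phi> G)" if "below S E G" for E G
    unfolding \<Phi>_def by (rule sem_below[where ok = "\<lambda>_. True", OF cb that wf])
  have least: "superop_le S M G" if "quantum_operation S G" "\<And>n. superop_le S (f n) G" for G
    using lub that unfolding is_qlub_def by blast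
  have qM: "quantum_operation S M" using lub by (simp add: is_qlub_def)
  \<comment> \<open>Continuity at \<open>M\<close>: the shifted sequence \<open>f (Suc n)\<close>
    now approximates both \<open>M\<close> and \<open>\<Phi> M\<close>, so their traces
    agree.\<close>
  have ap\<Phi>: "approximates S (\<lambda>n. f (Suc n)) (\<Phi> M)"
    unfolding fSuc \<Phi>_def by (rule sem_approximates[where ok = "\<lambda>_. True", OF cb ap wf])
  note q\<Phi> = below_qop(2)[OF approximates_below[OF ap\<Phi>]]
  \<comment> \<open>The approximation of \<open>\<Phi> M\<close> starts at \<open>f 1\<close>; the
    missing term \<open>f 0\<close> is the zero map.\<close>
  have "below S (f n) (\<Phi> M)" for n
  proof (cases n)
    case 0
    then show ?thesis using f0 below_zero[OF q\<Phi>] by simp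
  next
    case (Suc k)
    then show ?thesis using approximates_below[OF ap\<Phi>, of k] by simp
  qed
  then have le: "superop_le S M (\<Phi> M)" by (intro least[OF q\<Phi>] below_imp_superop_le)
  have fixpoint: "M \<rho> = \<Phi> M \<rho>" if \<rho>: "\<rho> \<in> pos_tc S" for \<rho>
  proof (rule lowner_rtr_eq[OF qop_pos[OF qM \<rho>] qop_pos[OF q\<Phi> \<rho>]
        superop_le_pos_tc[OF qM q\<Phi> le \<rho>]])
    have "(\<lambda>n. rtr S (f (Suc n) \<rho>)) \<longlonglongrightarrow> rtr S (M \<rho>)"
      by (rule LIMSEQ_Suc[OF approximates_rtr[OF ap \<rho>]])
    from LIMSEQ_unique[OF approximates_rtr[OF ap\<Phi> \<rho>] this]
    show "rtr S (\<Phi> M \<rho>) \<le> rtr S (M \<rho>)" by simp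
  qed
  have "prog_equiv B S (Mu F) (subst F (Mu F))"
    using fixpoint by (auto simp: prog_equiv_def denote_def sem_subst pdo_def \<Phi>_def M_def)
  moreover have "prog_le B S (Mu F) P"
    if P: "wf_program B \<U> P" and eq: "prog_equiv B S P (subst F P)" for P :: "('v, 'b, 'm) program"
  proof -
    let ?D = "denote B S P"
    \<comment> \<open>\<open>P\<close> may contain recursive programs, whose meanings are chosen
      suprema; these must be quantum operations before the induction over \<open>P\<close>
      applies.\<close>
    have "quantum_operation S (mu_sem B S G)" if "wf_scheme B \<U> G" for G :: "('v, 'b, 'm) scheme"
      by (rule below_qop(2)[OF approximates_below[OF mu_sem_approximates(2)[OF cb that]]])
    then have qD: "quantum_operation S ?D"
      unfolding denote_def
      using P sem_below[where ok = "wf_scheme B \<U>", OF cb below_refl]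
      by (intro below_qop(1)) (auto simp: wf_program_def)
    have eq': "?D \<rho> = \<Phi> ?D \<rho>" if "\<rho> \<in> pdo S" for \<rho>
      using eq that by (simp add: prog_equiv_def denote_def sem_subst \<Phi>_def)
    \<comment> \<open>Park induction: the iterates from the zero map stay below every fixed point of
      the monotone \<open>\<Phi>\<close>.\<close>
    have "below S (f n) ?D" for n
    proof (induction n)
      case 0
      show ?case unfolding f0 by (rule below_zero[OF qD])
    next
      case (Suc n)
      note b = \<Phi>_below[OF Suc]
      \<comment> \<open>The equation for \<open>P\<close> is known on partial density operators
        only, so the inequality is proved there and then rescaled to
        \<open>pos_tc S\<close>.\<close>
      have "superop_le S (f (Suc n)) ?D"
        using below_imp_superop_le[OF b] eq' unfolding superop_le_def fSuc by simp
      then show ?case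
        using superop_le_pos_tc[OF below_qop(1)[OF b] qD] below_qop(1)[OF b] qD
        unfolding below_def fSuc by blast
    qed
    then have "superop_le S M ?D" by (intro least[OF qD] below_imp_superop_le)
    then show ?thesis by (simp add: prog_le_def superop_le_def denote_def M_def)
  qed
  ultimately show ?thesis by blast
qed

end
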